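(* Let $H\in(\frac12,1)$, $\theta,\rho>0$, $\theta\neq\rho$, and let $X$ solve $X_0=0$, $dX_t=-\theta X_t\,dt+dV_t$, where $V_0=0$, $dV_t=-\rho V_t\,dt+dB^H_t$, and $B^H$ is a fractional Brownian motion of Hurst index $H$. Let $$\widehat\theta_T=-\frac{\int_0^T X_t\,\delta X_t}{\int_0^T X_t^2\,dt}.$$ Then $\widehat\theta_T\to\theta^*:=\theta+\rho$ almost surely as $T\to\infty$.
   Context: $B^H$ is a centered Gaussian process with $E(B^H_tB^H_s)=\frac12(t^{2H}+s^{2H}-|t-s|^{2H})$, on a complete probability space whose sigma-field is generated by $B^H$. The symbol $\int_0^T u_t\,\delta B^H_t$ denotes the Skorohod integral (divergence operator of Malliavin calculus with respect to $B^H$); for the processes considered here it equals the Young integral $\int_0^T u_t\,dB^H_t$ minus $H(2H-1)\int_0^T\int_0^T D_su_t|t-s|^{2H-2}\,ds\,dt$, with $D$ the Malliavin derivative. The integral against $X$ is understood as $\int_0^T X_t\,\delta X_t:=-\theta\int_0^T X_t^2\,dt-\rho\int_0^T X_tV_t\,dt+\int_0^T X_t\,\delta B^H_t$. *)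

theory Defs
  imports "HOL-Probability.Probability"
begin

section \<open>Fractional Brownian motion\<close>

text \<open>Centered Gaussian laws include the point mass at zero (needed, e.g., at time zero).\<close>

definition centered_gaussian_rv :: "'a measure \<Rightarrow> ('a \<Rightarrow> real) \<Rightarrow> bool" where
  "centered_gaussian_rv M Y \<longleftrightarrow>
     Y \<in> borel_measurable M \<and>
     ((AE \<omega> in M. Y \<omega> = 0) \<or> (\<exists>\<sigma>>0. distributed M lborel Y (normal_density 0 \<sigma>)))"

definition centered_gaussian_process :: "'a measure \<Rightarrow> (real \<Rightarrow> 'a \<Rightarrow> real) \<Rightarrow> bool" where
  "centered_gaussian_process M B \<longleftrightarrow>
     (\<forall>n (c :: nat \<Rightarrow> real) (t :: nat \<Rightarrow> real). (\<forall>i<n. 0 \<le> t i) \<longrightarrow>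
        centered_gaussian_rv M (\<lambda>\<omega>. \<Sum>i<n. c i * B (t i) \<omega>))"

definition fractional_brownian_motion :: "'a measure \<Rightarrow> real \<Rightarrow> (real \<Rightarrow> 'a \<Rightarrow> real) \<Rightarrow> bool" where
  "fractional_brownian_motion M H B \<longleftrightarrow>
     centered_gaussian_process M B \<and>
     (\<forall>t\<ge>0. \<forall>s\<ge>0. (\<integral>\<omega>. B t \<omega> * B s \<omega> \<partial>M) =
        (t powr (2 * H) + s powr (2 * H) - \<bar>t - s\<bar> powr (2 * H)) / 2) \<and>
     (AE \<omega> in M. continuous_on {0..} (\<lambda>t. B t \<omega>))"

definition process_sigma :: "'a measure \<Rightarrow> (real \<Rightarrow> 'a \<Rightarrow> real) \<Rightarrow> 'a measure" where
  "process_sigma M B = sigma (space M) {B t -` A \<inter> space M | t A. 0 \<le> t \<and> A \<in> sets borel}"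

text \<open>The probability space is complete, and its sigma-field is the one generated by \<open>B\<close>,
  augmented by the null sets.\<close>

definition completely_generated_by :: "'a measure \<Rightarrow> (real \<Rightarrow> 'a \<Rightarrow> real) \<Rightarrow> bool" where
  "completely_generated_by M B \<longleftrightarrow>
     (\<forall>t\<ge>0. B t \<in> borel_measurable M) \<and>
     M = completion (restr_to_subalg M (process_sigma M B))"


section \<open>The divergence operator\<close>

text \<open>For \<open>1/2 < H < 1\<close>, the Hilbert space of the isonormal process attached
  to \<open>B\<close> is the completion of the step functions on \<open>[0, \<infinity>)\<close> under
  \<open>\<langle>1\<^bsub>[0,t]\<^esub>, 1\<^bsub>[0,s]\<^esub>\<rangle> = E (B\<^sub>t B\<^sub>s)\<close>. On the functions \<open>\<phi>\<close> that satisfy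
  \<open>fbm_abs_space H \<phi>\<close>, which embed in it, its inner product is the double integral \<open>fbm_inner\<close>.
  On the diagonal the kernel has the value \<open>0 powr (2 * H - 2) = 0\<close>; this is a null set.\<close>

definition fbm_inner :: "real \<Rightarrow> (real \<Rightarrow> real) \<Rightarrow> (real \<Rightarrow> real) \<Rightarrow> real" where
  "fbm_inner H \<phi> \<psi> = H * (2 * H - 1) *
     (\<integral>(s, t). indicator ({0..} \<times> {0..}) (s, t) * (\<phi> s * \<psi> t * \<bar>t - s\<bar> powr (2 * H - 2))
        \<partial>(lborel \<Otimes>\<^sub>M lborel))"

definition fbm_abs_space :: "real \<Rightarrow> (real \<Rightarrow> real) \<Rightarrow> bool" where
  "fbm_abs_space H \<phi> \<longleftrightarrow>
     \<phi> \<in> borel_measurable borel \<and>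
     integrable (lborel \<Otimes>\<^sub>M lborel)
       (\<lambda>(s, t). indicator ({0..} \<times> {0..}) (s, t) * (\<bar>\<phi> s\<bar> * \<bar>\<phi> t\<bar> * \<bar>t - s\<bar> powr (2 * H - 2)))"

text \<open>Since the indicators \<open>1\<^bsub>[0,r]\<^esub>\<close> are total in the (separable) Hilbert space, the first
  condition is measurability of \<open>u\<close> as a Hilbert space valued random variable.\<close>

definition fbm_L2_process :: "'a measure \<Rightarrow> real \<Rightarrow> (real \<Rightarrow> 'a \<Rightarrow> real) \<Rightarrow> bool" where
  "fbm_L2_process M H u \<longleftrightarrow>
     (\<forall>r\<ge>0. (\<lambda>\<omega>. fbm_inner H (indicator {0..r}) (\<lambda>t. u t \<omega>)) \<in> borel_measurable M) \<and>
     (AE \<omega> in M. fbm_abs_space H (\<lambda>t. u t \<omega>)) \<and>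
     integrable M (\<lambda>\<omega>. fbm_inner H (\<lambda>t. \<bar>u t \<omega>\<bar>) (\<lambda>t. \<bar>u t \<omega>\<bar>))"

definition partial :: "nat \<Rightarrow> ((nat \<Rightarrow> real) \<Rightarrow> real) \<Rightarrow> (nat \<Rightarrow> real) \<Rightarrow> real" where
  "partial i f x = deriv (\<lambda>h. f (x(i := h))) (x i)"

text \<open>Smooth functions on \<open>\<real>\<^sup>n\<close> that are bounded together with all their partial derivatives. A
  function on \<open>\<real>\<^sup>n\<close> is encoded as a function of a sequence depending only on the first \<open>n\<close> entries;
  a list \<open>\<alpha>\<close> stands for the iterated partial derivative in the listed directions.\<close>

definition bounded_smooth :: "nat \<Rightarrow> ((nat \<Rightarrow> real) \<Rightarrow> real) \<Rightarrow> bool" where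
  "bounded_smooth n f \<longleftrightarrow>
     (\<forall>x y. (\<forall>i<n. x i = y i) \<longrightarrow> f x = f y) \<and>
     (\<forall>\<alpha>. set \<alpha> \<subseteq> {..<n} \<longrightarrow>
        continuous_on UNIV (foldr partial \<alpha> f) \<and>
        bounded (range (foldr partial \<alpha> f)) \<and>
        (\<forall>i<n. \<forall>x. (\<lambda>h. foldr partial \<alpha> f (x(i := h))) differentiable at (x i)))"

text \<open>The smooth functional \<open>f (B\<^bsub>t 0\<^esub>, \<dots>, B\<^bsub>t (n - 1)\<^esub>)\<close> and its Malliavin derivative
  at time \<open>s\<close>.\<close>

definition smooth_functional ::
    "(real \<Rightarrow> 'a \<Rightarrow> real) \<Rightarrow> ((nat \<Rightarrow> real) \<Rightarrow> real) \<Rightarrow> (nat \<Rightarrow> real) \<Rightarrow> 'a \<Rightarrow> real" where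
  "smooth_functional B f t \<omega> = f (\<lambda>i. B (t i) \<omega>)"

definition malliavin_deriv ::
    "(real \<Rightarrow> 'a \<Rightarrow> real) \<Rightarrow> nat \<Rightarrow> ((nat \<Rightarrow> real) \<Rightarrow> real) \<Rightarrow> (nat \<Rightarrow> real) \<Rightarrow> real \<Rightarrow> 'a \<Rightarrow> real" where
  "malliavin_deriv B n f t s \<omega> =
     (\<Sum>i<n. partial i f (\<lambda>j. B (t j) \<omega>) * indicator {0..t i} s)"

text \<open>\<open>u\<close> lies in the domain of the divergence operator and \<open>Z\<close> is a version of its divergence: the
  divergence is the adjoint of the Malliavin derivative, and the adjoint relation is tested on the
  smooth functionals, of which the Malliavin derivative is by definition the closure. All times
  \<open>t i \<ge> 0\<close> are allowed, also beyond the support of \<open>u\<close>. Here \<open>u\<close> is a process whose paths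
  are functions, with values in the space \<open>fbm_abs_space\<close>. The divergence is determined up to null sets when the sigma-field is generated by \<open>B\<close>.\<close>

definition has_divergence ::
    "'a measure \<Rightarrow> real \<Rightarrow> (real \<Rightarrow> 'a \<Rightarrow> real) \<Rightarrow> (real \<Rightarrow> 'a \<Rightarrow> real) \<Rightarrow> ('a \<Rightarrow> real) \<Rightarrow> bool" where
  "has_divergence M H B u Z \<longleftrightarrow>
     fbm_L2_process M H u \<and>
     Z \<in> borel_measurable M \<and> integrable M (\<lambda>\<omega>. (Z \<omega>)\<^sup>2) \<and>
     (\<forall>n f t. bounded_smooth n f \<and> (\<forall>i<n. 0 \<le> t i) \<longrightarrow>
        (\<integral>\<omega>. smooth_functional B f t \<omega> * Z \<omega> \<partial>M) =
        (\<integral>\<omega>. fbm_inner H (\<lambda>s. malliavin_deriv B n f t s \<omega>) (\<lambda>s. u s \<omega>) \<partial>M))"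

text \<open>For each \<open>T\<close> the divergence of \<open>u 1\<^bsub>[0,T]\<^esub>\<close> is only an almost sure equivalence class. For
  statements about all \<open>T\<close> simultaneously the continuous version of the integral process is
  meant, i.e. the one given by the Young integral minus the trace term.\<close>

definition skorohod_integral_process ::
    "'a measure \<Rightarrow> real \<Rightarrow> (real \<Rightarrow> 'a \<Rightarrow> real) \<Rightarrow> (real \<Rightarrow> 'a \<Rightarrow> real) \<Rightarrow> (real \<Rightarrow> 'a \<Rightarrow> real) \<Rightarrow> bool" where
  "skorohod_integral_process M H B u S \<longleftrightarrow>
     (\<forall>T>0. has_divergence M H B (\<lambda>t \<omega>. indicator {0..T} t * u t \<omega>) (S T)) \<and>
     (AE \<omega> in M. continuous_on {0<..} (\<lambda>T. S T \<omega>))"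


section \<open>The Ornstein-Uhlenbeck equations and the estimator\<close>

text \<open>\<open>dY = - a Y dt + dW\<close>, \<open>Y\<^sub>0 = 0\<close>, in integrated form.\<close>

definition solves_OU :: "'a measure \<Rightarrow> real \<Rightarrow> (real \<Rightarrow> 'a \<Rightarrow> real) \<Rightarrow> (real \<Rightarrow> 'a \<Rightarrow> real) \<Rightarrow> bool" where
  "solves_OU M a W Y \<longleftrightarrow>
     (AE \<omega> in M. continuous_on {0..} (\<lambda>t. Y t \<omega>) \<and> Y 0 \<omega> = 0 \<and>
        (\<forall>t\<ge>0. Y t \<omega> = - a * integral {0..t} (\<lambda>s. Y s \<omega>) + (W t \<omega> - W 0 \<omega>)))"

text \<open>In the next two definitions \<open>S T \<omega>\<close> stands for the Skorohod integral of \<open>X\<close> over \<open>[0,T]\<close>.\<close>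

definition integral_against_X ::
    "real \<Rightarrow> real \<Rightarrow> (real \<Rightarrow> 'a \<Rightarrow> real) \<Rightarrow> (real \<Rightarrow> 'a \<Rightarrow> real) \<Rightarrow> (real \<Rightarrow> 'a \<Rightarrow> real) \<Rightarrow> real \<Rightarrow> 'a \<Rightarrow> real" where
  "integral_against_X \<theta> \<rho> X V S T \<omega> =
     - \<theta> * integral {0..T} (\<lambda>t. (X t \<omega>)\<^sup>2)
     - \<rho> * integral {0..T} (\<lambda>t. X t \<omega> * V t \<omega>) + S T \<omega>"

definition theta_hat ::
    "real \<Rightarrow> real \<Rightarrow> (real \<Rightarrow> 'a \<Rightarrow> real) \<Rightarrow> (real \<Rightarrow> 'a \<Rightarrow> real) \<Rightarrow> (real \<Rightarrow> 'a \<Rightarrow> real) \<Rightarrow> real \<Rightarrow> 'a \<Rightarrow> real" where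
  "theta_hat \<theta> \<rho> X V S T \<omega> =
     - (integral_against_X \<theta> \<rho> X V S T \<omega> / integral {0..T} (\<lambda>t. (X t \<omega>)\<^sup>2))"

end

theory Submission
  imports Defs
begin

text \<open>Solving the two equations pathwise gives \<open>X = (\<rho> Z\<^sup>\<rho> - \<theta> Z\<^sup>\<theta>) / (\<rho> - \<theta>)\<close>, where \<open>Z\<^sup>a\<close> is the
  Ornstein-Uhlenbeck process with rate \<open>a\<close> driven by \<open>B\<close>. By the chain rule the Young integral of \<open>X\<close>
  against \<open>B\<close> over \<open>[0,T]\<close> is
  \<open>Y\<^sub>T = X\<^sub>T\<^sup>2 / 2 + (\<theta> + \<rho>) \<integral> X\<^sup>2 + \<theta> \<rho> (\<integral> X)\<^sup>2 / 2\<close>, and the Skorohod integral is \<open>Y\<^sub>T - E Y\<^sub>T\<close>: both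
  satisfy the duality relation for the functionals \<open>cos (\<phi> + N)\<close> with \<open>N\<close> in the span of \<open>B\<close>, and
  these functionals are total. Hence the estimator equals \<open>(E Y\<^sub>T - X\<^sub>T\<^sup>2 / 2) / \<integral> X\<^sup>2\<close>. It remains to see
  that \<open>X\<^sub>T\<^sup>2 / T \<rightarrow> 0\<close> and \<open>(\<integral> X\<^sup>2 - E \<integral> X\<^sup>2) / T \<rightarrow> 0\<close> almost surely, that \<open>E \<integral> X\<^sup>2\<close> grows linearly,
  and that the second moments of \<open>X\<close> and \<open>\<integral> X\<close> are bounded.\<close>

section \<open>Ornstein-Uhlenbeck equations along a path\<close>

text \<open>The Young integral enters only through its value \<open>Y\<close>, given by the chain
  rule, and the duality relation is evaluated explicitly. For N in the span of B, both sides reduce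
  by Gaussian formulas to the path h(s) = E(N X_s). Covariances obey the same linear equations as
  the paths: h solves the two equations driven by s -> E(N B_s), which is differentiable for s > 0
  and whose derivative is the kernel integral in the inner product. The chain rule for this
  deterministic path matches the two sides. The limit \<theta> + \<rho> is the coefficient of E
  \<integral> X^2 in E Y_T. The integral of X is again a combination of the two one-stage processes,
  because the driving path cancels, and so adds only a bounded term. X starts at 0 and is not
  stationary, so the law of large numbers rests on a variance bound: the variance of \<integral> X^2
  is at most of order T^(2H), which is o(T^2) for H < 1. This order comes from comparison with the
  second moment of \<integral> Z, and the comparison rests on the positive correlations available
  for H > 1/2.\<close>

text \<open>Paths are functions on the whole line that vanish on \<open>(-\<infinity>, 0]\<close>, so that a primitive is
  differentiable at every point and no one-sided derivatives at \<open>0\<close> occur.\<close>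

definition prim :: "(real \<Rightarrow> real) \<Rightarrow> real \<Rightarrow> real" where
  "prim w t = integral {0..t} w"

definition path0 :: "(real \<Rightarrow> real) \<Rightarrow> bool" where
  "path0 w \<longleftrightarrow> continuous_on UNIV w \<and> (\<forall>t\<le>0. w t = 0)"

lemma path0_continuous_on: "path0 w \<Longrightarrow> continuous_on A w"
  unfolding path0_def by (meson continuous_on_subset subset_UNIV)

text \<open>For \<open>t < 0\<close> the interval \<open>{0..t}\<close> is empty, so the integral is
  0 and not the negative of an integral over \<open>{t..0}\<close>.\<close>

lemma prim_nonpos: "t \<le> 0 \<Longrightarrow> prim w t = 0"
  by (cases "t = 0") (auto simp: prim_def)

text \<open>The base point is moved from 0 to some \<open>a\<close> strictly left of 0 and of
  \<open>t\<close>. This does not change the integral, since \<open>w\<close> vanishes up to 0, and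
  it makes \<open>t\<close> an interior point.\<close>

lemma prim_has_derivative:
  assumes "path0 w"
  shows "(prim w has_real_derivative w t) (at t)"
proof -
  have c: "continuous_on A w" for A
    using assms continuous_on_subset by (auto simp: path0_def)
  define a where "a = min 0 t - 1"
  have eq: "prim w x = integral {a..x} w" if "x > a" for x
  proof (cases "x \<le> 0")
    case True
    then have "integral {a..x} w = integral {a..x} (\<lambda>_. 0)"
      using assms by (intro integral_cong) (auto simp: path0_def)
    with True show ?thesis by (simp add: prim_nonpos)
  next
    case False
    have "integral {a..0} w = integral {a..0} (\<lambda>_. 0)"
      using assms by (intro integral_cong) (auto simp: path0_def)
    moreover have "integral {a..0} w + integral {0..x} w = integral {a..x} w"
      using False by (intro Henstock_Kurzweil_Integration.integral_combine integrable_continuous_interval c)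
        (auto simp: a_def)
    ultimately show ?thesis by (simp add: prim_def)
  qed
  have "((\<lambda>x. integral {a..x} w) has_real_derivative w t) (at t within {a..t+1})"
    by (rule integral_has_real_derivative[OF c]) (auto simp: a_def)
  then have "((\<lambda>x. integral {a..x} w) has_real_derivative w t) (at t)"
    by (subst (asm) at_within_interior) (auto simp: a_def)
  then show ?thesis
    by (rule has_field_derivative_transform_within_open[where S = "{a<..}"]) (auto simp: eq a_def)
qed

lemma prim_path0: "path0 w \<Longrightarrow> path0 (prim w)"
  unfolding path0_def[of "prim w"]
  by (auto intro!: prim_nonpos DERIV_isCont continuous_at_imp_continuous_on prim_has_derivative)

lemma path0_mult: "path0 w \<Longrightarrow> continuous_on UNIV k \<Longrightarrow> path0 (\<lambda>t. k t * w t)"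
  by (auto simp: path0_def intro!: continuous_intros)

lemma path0_lin: "path0 v \<Longrightarrow> path0 w \<Longrightarrow> path0 (\<lambda>t. a * v t + b * w t)"
  by (auto simp: path0_def intro!: continuous_intros)

text \<open>Integral identities become a comparison of derivatives: it is enough to differentiate
  the closed form and to look at nonpositive times.\<close>

lemma eq_prim:
  assumes "\<And>t. (F has_real_derivative f t) (at t)" "\<And>t. t \<le> 0 \<Longrightarrow> F t = 0"
  shows "F t = prim f t"
proof (cases "t \<le> 0")
  case True
  then show ?thesis by (simp add: prim_nonpos assms)
next
  case False
  have "(f has_integral (F t - F 0)) {0..t}"
    using False assms(1)
    by (intro fundamental_theorem_of_calculus)
       (auto simp: has_real_derivative_iff_has_vector_derivative[symmetric] intro: has_field_derivative_at_within)
  then show ?thesis using assms(2)[of 0] by (simp add: prim_def integral_unique)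
qed

lemma prim_lin:
  assumes "path0 v" "path0 w"
  shows "prim (\<lambda>s. a * v s + b * w s) t = a * prim v t + b * prim w t"
  using assms
  by (intro eq_prim[symmetric]) (auto intro!: derivative_eq_intros prim_has_derivative simp: prim_nonpos)

text \<open>The solution of \<open>dY = - a Y dt + dw\<close> after an integration by parts, which makes sense for
  every continuous \<open>w\<close>.\<close>

definition ou :: "real \<Rightarrow> (real \<Rightarrow> real) \<Rightarrow> real \<Rightarrow> real" where
  "ou a w t = w t - a * (exp (- (a * t)) * prim (\<lambda>s. exp (a * s) * w s) t)"

text \<open>By the product rule, the convolution c of \<open>w\<close> with exp(-a u) satisfies c' =
  w - a c, and this is \<open>ou a w\<close>. Hence c is the primitive of the solution, and the
  defining formula becomes the integral equation.\<close>

lemma ou_conv_has_derivative: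
  assumes "path0 w"
  shows "((\<lambda>t. exp (- (a * t)) * prim (\<lambda>s. exp (a * s) * w s) t) has_real_derivative ou a w t) (at t)"
proof -
  have p: "path0 (\<lambda>s. exp (a * s) * w s)"
    by (intro path0_mult assms continuous_intros)
  show ?thesis
    by (rule DERIV_cong, rule DERIV_mult[OF _ prim_has_derivative[OF p]])
       (auto intro!: derivative_eq_intros simp: ou_def exp_minus field_simps)
qed

lemma ou_path0: assumes "path0 w" shows "path0 (ou a w)"
proof -
  have "path0 (prim (\<lambda>s. exp (a * s) * w s))"
    by (intro prim_path0 path0_mult assms continuous_intros)
  with assms show ?thesis
    by (auto simp: path0_def ou_def[abs_def] intro!: continuous_intros)
qed

lemma ou_conv_eq_prim:
  assumes "path0 w"
  shows "exp (- (a * t)) * prim (\<lambda>s. exp (a * s) * w s) t = prim (ou a w) t"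
  by (rule eq_prim[OF ou_conv_has_derivative[OF assms]]) (simp add: prim_nonpos)

lemma ou_eq: "path0 w \<Longrightarrow> ou a w t = w t - a * prim (ou a w) t"
  by (subst ou_conv_eq_prim[symmetric]) (simp_all add: ou_def)

text \<open>Integrating factor: the difference \<open>D\<close> of the two primitives satisfies D' =
  -a D, so exp(a t) D(t) is constant, and it vanishes at 0.\<close>

lemma ou_unique_path0:
  assumes y: "path0 y" and w: "path0 w" and eq: "\<And>t. t \<ge> 0 \<Longrightarrow> y t = w t - a * prim y t"
  shows "y t = ou a w t"
proof -
  define D where "D t = prim y t - prim (ou a w) t" for t
  have yo: "y t - ou a w t = - a * D t" for t
  proof (cases "t \<ge> 0")
    case True
    then show ?thesis using eq[of t] ou_eq[OF w, of a t] by (simp add: D_def algebra_simps)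
  next
    case False
    then show ?thesis using y ou_path0[OF w, of a] by (simp add: D_def path0_def prim_nonpos)
  qed
  have "((\<lambda>t. exp (a * t) * D t) has_real_derivative 0) (at t)" for t
  proof -
    have "(D has_real_derivative y t - ou a w t) (at t)"
      unfolding D_def[abs_def] by (intro derivative_intros prim_has_derivative y ou_path0 w)
    then have "(D has_real_derivative - a * D t) (at t)" by (simp add: yo)
    from this show ?thesis
      by (auto intro!: derivative_eq_intros)
  qed
  then have "exp (a * t) * D t = exp (a * 0) * D 0" for t
    using DERIV_isconst_all[of "\<lambda>t. exp (a * t) * D t" t 0] by simp
  then have "D t = 0" for t by (simp add: D_def prim_nonpos)
  with yo show ?thesis by simp
qed

text \<open>A path given only for nonnegative times is extended to the left by its initial value 0,
  which reduces the claim to paths on the whole line.\<close>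

lemma ou_unique:
  assumes y: "continuous_on {0..} y" "y 0 = 0" and w: "path0 w"
    and eq: "\<And>t. t \<ge> 0 \<Longrightarrow> y t = - a * integral {0..t} y + w t" and t: "t \<ge> 0"
  shows "y t = ou a w t"
proof -
  define z where "z t = y (max 0 t)" for t
  have z: "path0 z"
  proof -
    have "continuous_on UNIV (y \<circ> (\<lambda>t. max 0 t))"
      by (intro continuous_on_compose continuous_intros continuous_on_subset[OF y(1)]) auto
    then show ?thesis using y(2) by (auto simp: path0_def z_def[abs_def] o_def)
  qed
  have "z t = ou a w t"
  proof (rule ou_unique_path0[OF z w])
    fix t :: real assume "t \<ge> 0"
    moreover have "prim z t = integral {0..t} y"
      unfolding prim_def by (intro integral_cong) (auto simp: z_def)
    ultimately show "z t = w t - a * prim z t"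
      using eq[of t] by (simp add: z_def)
  qed
  then show ?thesis using t by (simp add: z_def)
qed

text \<open>Partial fractions in operator form: with s for differentiation, \<open>ou a\<close> is s
  / (s + a), and s^2 / ((s + \<theta>) (s + \<rho>)) splits for distinct rates. The proof checks
  that the combination solves the outer equation.\<close>

lemma ou_ou_eq:
  assumes w: "path0 w" and ne: "\<theta> \<noteq> \<rho>"
  shows "ou \<theta> (ou \<rho> w) t = (\<rho> / (\<rho> - \<theta>)) * ou \<rho> w t + (- \<theta> / (\<rho> - \<theta>)) * ou \<theta> w t"
proof (rule ou_unique_path0[symmetric])
  show "path0 (\<lambda>t. (\<rho> / (\<rho> - \<theta>)) * ou \<rho> w t + (- \<theta> / (\<rho> - \<theta>)) * ou \<theta> w t)"
    by (intro path0_lin ou_path0 w)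
  show "path0 (ou \<rho> w)" by (rule ou_path0[OF w])
  fix t :: real
  define p q where "p = prim (ou \<rho> w) t" and "q = prim (ou \<theta> w) t"
  have "prim (\<lambda>t. (\<rho> / (\<rho> - \<theta>)) * ou \<rho> w t + (- \<theta> / (\<rho> - \<theta>)) * ou \<theta> w t) t
     = (\<rho> / (\<rho> - \<theta>)) * p + (- \<theta> / (\<rho> - \<theta>)) * q"
    unfolding p_def q_def by (intro prim_lin ou_path0 w)
  then have P: "prim (\<lambda>t. (\<rho> / (\<rho> - \<theta>)) * ou \<rho> w t + (- \<theta> / (\<rho> - \<theta>)) * ou \<theta> w t) t
     = (\<rho> * p - \<theta> * q) / (\<rho> - \<theta>)" by (simp add: diff_divide_distrib)
  have r: "ou \<rho> w t = w t - \<rho> * p" and q: "ou \<theta> w t = w t - \<theta> * q"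
    unfolding p_def q_def by (rule ou_eq[OF w])+
  show "(\<rho> / (\<rho> - \<theta>)) * ou \<rho> w t + (- \<theta> / (\<rho> - \<theta>)) * ou \<theta> w t =
    ou \<rho> w t - \<theta> * prim (\<lambda>t. (\<rho> / (\<rho> - \<theta>)) * ou \<rho> w t + (- \<theta> / (\<rho> - \<theta>)) * ou \<theta> w t) t"
    unfolding P unfolding r q using ne by (simp add: divide_simps) (simp add: algebra_simps)
qed

text \<open>As a times \<open>prim (ou a w)\<close> is w - \<open>ou a w\<close>, the path
  \<open>w\<close> cancels in the combination of the two primitives. So the integral of the
  two-stage process does not inherit the growth of the driving path.\<close>

lemma prim_ou_ou_eq:
  assumes w: "path0 w" and ne: "\<theta> \<noteq> \<rho>"
  shows "prim (ou \<theta> (ou \<rho> w)) t = (1 / (\<rho> - \<theta>)) * ou \<theta> w t + (- 1 / (\<rho> - \<theta>)) * ou \<rho> w t"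
proof -
  define p q where "p = prim (ou \<rho> w) t" and "q = prim (ou \<theta> w) t"
  have "prim (ou \<theta> (ou \<rho> w)) t = (\<rho> / (\<rho> - \<theta>)) * p + (- \<theta> / (\<rho> - \<theta>)) * q"
    unfolding ou_ou_eq[OF w ne, abs_def] p_def q_def by (intro prim_lin ou_path0 w)
  then have "prim (ou \<theta> (ou \<rho> w)) t = (\<rho> * p - \<theta> * q) / (\<rho> - \<theta>)"
    by (simp add: diff_divide_distrib)
  also have "\<rho> * p - \<theta> * q = ou \<theta> w t - ou \<rho> w t"
    unfolding p_def q_def using ou_eq[OF w, of \<rho> t] ou_eq[OF w, of \<theta> t] by simp
  finally show ?thesis by (simp add: diff_divide_distrib)
qed

text \<open>Eliminating the inner solution leaves one equation of second order, in which the rates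
  enter only through their sum and their product. The sum is what the estimator will detect.\<close>

lemma ou_ou_expand:
  assumes w: "path0 w"
  shows "ou \<theta> (ou \<rho> w) t = w t - (\<theta> + \<rho>) * prim (ou \<theta> (ou \<rho> w)) t
     - \<theta> * \<rho> * prim (prim (ou \<theta> (ou \<rho> w))) t"
proof -
  let ?v = "ou \<rho> w" let ?x = "ou \<theta> ?v"
  have v: "?v t = 1 * ?x t + \<theta> * prim ?x t" for t
    using ou_eq[OF ou_path0[OF w], of \<theta> \<rho> t] by simp
  have "prim ?v t = prim (\<lambda>t. 1 * ?x t + \<theta> * prim ?x t) t"
    by (rule arg_cong[where f = "\<lambda>f. prim f t"], rule ext, rule v)
  also have "\<dots> = 1 * prim ?x t + \<theta> * prim (prim ?x) t"
    by (intro prim_lin prim_path0 ou_path0 w)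
  finally have "prim ?v t = 1 * prim ?x t + \<theta> * prim (prim ?x) t" .
  then show ?thesis using v[of t] ou_eq[OF w, of \<rho> t] by (simp add: algebra_simps)
qed

text \<open>Replacing \<open>w s\<close> by the larger \<open>w t\<close> in the weighted integral
  leaves exp(-a t) \<open>w t\<close> as a lower bound.\<close>

lemma ou_nonneg:
  assumes w: "path0 w" and mono: "\<And>s t. s \<le> t \<Longrightarrow> w s \<le> w t" and a: "a > 0"
  shows "ou a w t \<ge> 0"
proof (cases "t \<le> 0")
  case True
  then show ?thesis using ou_path0[OF w, of a] by (simp add: path0_def)
next
  case False
  have c: "continuous_on A w" for A
    using w continuous_on_subset by (auto simp: path0_def)
  have nn: "w t \<ge> 0" using mono[of 0 t] w False by (auto simp: path0_def)
  have "((\<lambda>s. exp (a * s) * w t) has_integral (exp (a * t) / a * w t - exp (a * 0) / a * w t)) {0..t}"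
    using False a by (intro fundamental_theorem_of_calculus)
       (auto intro!: derivative_eq_intros simp: has_real_derivative_iff_has_vector_derivative[symmetric])
  from integral_unique[OF this] have i: "integral {0..t} (\<lambda>s. exp (a * s) * w t) = (exp (a * t) - 1) / a * w t"
    by (rule trans) (simp add: left_diff_distrib diff_divide_distrib)
  have "prim (\<lambda>s. exp (a * s) * w s) t \<le> (exp (a * t) - 1) / a * w t"
    unfolding prim_def i[symmetric]
    by (intro integral_le integrable_continuous_interval continuous_intros c mult_left_mono mono) auto
  then have "a * (exp (- (a * t)) * prim (\<lambda>s. exp (a * s) * w s) t)
      \<le> a * (exp (- (a * t)) * ((exp (a * t) - 1) / a * w t))"
    using a by (intro mult_left_mono) auto
  also have "\<dots> = (1 - exp (- (a * t))) * w t"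
    using a by (simp add: exp_minus field_simps)
  finally show ?thesis
    using mult_nonneg_nonneg[OF exp_ge_zero[of "- (a * t)"] nn] unfolding ou_def left_diff_distrib by simp
qed

text \<open>Chain rule for \<open>x\<^sup>2 / 2\<close> along \<open>dx = - (\<theta> + \<rho>) x dt - \<theta> \<rho> (\<integral> x) dt + dg\<close>.\<close>

lemma ou_ou_energy:
  fixes \<theta> \<rho> :: real
  assumes g: "path0 g" and g': "\<And>t. t > 0 \<Longrightarrow> (g has_real_derivative g' t) (at t)" and T: "T \<ge> 0"
  defines "x \<equiv> ou \<theta> (ou \<rho> g)"
  shows "((\<lambda>t. x t * g' t) has_integral
     ((x T)\<^sup>2 / 2 + (\<theta> + \<rho>) * prim (\<lambda>t. (x t)\<^sup>2) T + \<theta> * \<rho> * (prim x T)\<^sup>2 / 2)) {0..T}"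
proof -
  have x: "path0 x" unfolding x_def by (intro ou_path0 g)
  have x2: "path0 (\<lambda>t. (x t)\<^sup>2)"
    using x by (auto simp: path0_def intro!: continuous_intros)
  let ?F = "\<lambda>t. (x t)\<^sup>2 / 2 + (\<theta> + \<rho>) * prim (\<lambda>t. (x t)\<^sup>2) t + \<theta> * \<rho> * (prim x t)\<^sup>2 / 2"
  have xd: "(x has_real_derivative g' t - (\<theta> + \<rho>) * x t - \<theta> * \<rho> * prim x t) (at t)" if "t > 0" for t
  proof -
    have e: "(\<lambda>t. g t - (\<theta> + \<rho>) * prim x t - \<theta> * \<rho> * prim (prim x) t) = x"
      unfolding x_def by (rule ext, rule ou_ou_expand[OF g, symmetric])
    have "((\<lambda>t. g t - (\<theta> + \<rho>) * prim x t - \<theta> * \<rho> * prim (prim x) t) has_real_derivative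
        g' t - (\<theta> + \<rho>) * x t - \<theta> * \<rho> * prim x t) (at t)"
      by (intro DERIV_diff DERIV_cmult g' that prim_has_derivative prim_path0 x)
    then show ?thesis unfolding e .
  qed
  have "((\<lambda>t. x t * g' t) has_integral (?F T - ?F 0)) {0..T}"
  \<comment> \<open>The derivative of \<open>g\<close> is given for positive times only, so
    differentiability is used in the open interval and continuity at its ends.\<close>
  proof (rule fundamental_theorem_of_calculus_interior[OF T])
    show "continuous_on {0..T} ?F"
      by (intro continuous_intros path0_continuous_on prim_path0 x x2) auto
    fix t assume "t \<in> {0<..<T}"
    then have t: "t > 0" by auto
    have "(?F has_real_derivative x t * g' t) (at t)"
    proof (rule DERIV_cong)
      show "(?F has_real_derivative
        2 * x t * (g' t - (\<theta> + \<rho>) * x t - \<theta> * \<rho> * prim x t) / 2 + (\<theta> + \<rho>) * (x t)\<^sup>2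
          + \<theta> * \<rho> * (2 * prim x t * x t) / 2) (at t)"
        using DERIV_power[OF xd[OF t], of 2] DERIV_power[OF prim_has_derivative[OF x], of 2 t]
        by (intro DERIV_add DERIV_cmult DERIV_cdivide prim_has_derivative x2) (simp_all add: mult_ac)
    qed (simp add: power2_eq_square field_simps)
    then show "(?F has_vector_derivative x t * g' t) (at t)"
      by (simp add: has_real_derivative_iff_has_vector_derivative)
  qed
  moreover have "?F 0 = 0" using x by (simp add: prim_nonpos path0_def)
  ultimately show ?thesis by simp
qed

text \<open>The point \<open>x\<close> is approached by its dyadic truncations. Consecutive
  truncations are equal or neighbours on the finer grid, so the increments are dominated by a
  geometric series; continuity gives the limit.\<close>

lemma dyadic_chaining:
  fixes f :: "real \<Rightarrow> real"
  assumes cont: "continuous_on UNIV f" and r: "0 \<le> r" "r < 1" and w: "0 \<le> w"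
    and inc: "\<And>k j. j < 2 ^ k \<Longrightarrow> \<bar>f (a + real (Suc j) / 2 ^ k) - f (a + real j / 2 ^ k)\<bar> \<le> w * r ^ k"
    and x: "0 \<le> x" "x < 1"
  shows "\<bar>f (a + x) - f a\<bar> \<le> w / (1 - r)"
proof -
  define j where "j k = nat \<lfloor>2 ^ k * x\<rfloor>" for k :: nat
  define y where "y k = a + real (j k) / 2 ^ k" for k
  have jr: "real (j k) \<le> 2 ^ k * x" "2 ^ k * x < real (j k) + 1" for k
    using x by (auto simp: j_def)
  have jl: "j k < 2 ^ k" for k
  proof -
    have "real (j k) < 2 ^ k * 1" by (rule le_less_trans[OF jr(1)]) (intro mult_strict_left_mono x; simp)
    then show ?thesis by (metis mult_1_right of_nat_less_iff of_nat_numeral of_nat_power)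
  qed
  have step: "j (Suc k) = 2 * j k \<or> j (Suc k) = Suc (2 * j k)" for k
  proof -
    have "2 * real (j k) < real (j (Suc k)) + 1" "real (j (Suc k)) < 2 * real (j k) + 2"
      using jr[of k] jr[of "Suc k"] by auto
    then show ?thesis by linarith
  qed
  have d: "\<bar>f (y (Suc k)) - f (y k)\<bar> \<le> w * r ^ Suc k" for k
  proof -
    have e: "a + real (2 * j k) / 2 ^ Suc k = y k" by (simp add: y_def)
    from step[of k] show ?thesis
    proof
      assume "j (Suc k) = 2 * j k"
      then have "y (Suc k) = y k" using e by (simp add: y_def)
      then show ?thesis using r w by simp
    next
      assume j: "j (Suc k) = Suc (2 * j k)"
      have "2 * j k < 2 ^ Suc k" using jl[of k] by simp
      from inc[OF this] show ?thesis using e j by (simp add: y_def)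
    qed
  qed
  have b: "\<bar>f (y n) - f a\<bar> \<le> w * (\<Sum>k<Suc n. r ^ k)" for n
  proof (induction n)
    case 0
    have "j 0 = 0" using x by (simp add: j_def)
    then have "y 0 = a" by (simp add: y_def)
    then show ?case using w by simp
  next
    case (Suc n)
    then show ?case using d[of n] by (simp add: algebra_simps)
  qed
  have b': "\<bar>f (y n) - f a\<bar> \<le> w / (1 - r)" for n
  proof -
    have "(\<Sum>k<Suc n. r ^ k) \<le> 1 / (1 - r)"
      using r by (simp add: sum_gp_strict divide_right_mono del: sum.lessThan_Suc)
    from mult_left_mono[OF this w] b[of n] show ?thesis by simp
  qed
  have "(\<lambda>k. (1/2::real) ^ k) \<longlonglongrightarrow> 0" by (rule LIMSEQ_realpow_zero) simp_all
  then have lim0: "(\<lambda>k. a + x - (1/2) ^ k) \<longlonglongrightarrow> a + x - 0" by (intro tendsto_diff tendsto_const)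
  have "y \<longlonglongrightarrow> a + x"
  proof (rule tendsto_sandwich[OF _ _ _ tendsto_const])
    show "(\<lambda>k. a + x - (1/2) ^ k) \<longlonglongrightarrow> a + x" using lim0 by simp
    show "\<forall>\<^sub>F k in sequentially. a + x - (1/2) ^ k \<le> y k"
    proof (intro always_eventually allI)
      fix k
      have "x \<le> (real (j k) + 1) / 2 ^ k" using jr(2)[of k] by (simp add: field_simps)
      then show "a + x - (1/2) ^ k \<le> y k"
        by (simp add: y_def power_divide add_divide_distrib)
    qed
    show "\<forall>\<^sub>F k in sequentially. y k \<le> a + x"
      using jr(1) by (intro always_eventually allI) (simp add: y_def field_simps)
  qed
  then have "(\<lambda>k. f (y k)) \<longlonglongrightarrow> f (a + x)"
    using cont by (intro continuous_on_tendsto_compose[OF cont]) auto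
  then have "(\<lambda>k. \<bar>f (y k) - f a\<bar>) \<longlonglongrightarrow> \<bar>f (a + x) - f a\<bar>" by (intro tendsto_intros)
  then show ?thesis using b' by (intro LIMSEQ_le_const2) auto
qed

section \<open>Processes with continuous paths\<close>

text \<open>Time is rounded down to multiples of 1 / (n + 1). The discretised process is jointly
  measurable because it uses countably many times, and continuity of the paths gives pointwise
  convergence.\<close>

lemma continuous_process_measurable:
  fixes f :: "real \<Rightarrow> 'a \<Rightarrow> real"
  assumes meas: "\<And>t. f t \<in> borel_measurable M" and cont: "\<And>\<omega>. continuous_on UNIV (\<lambda>t. f t \<omega>)"
  shows "(\<lambda>(t, \<omega>). f t \<omega>) \<in> borel_measurable (borel \<Otimes>\<^sub>M M)"
proof (rule borel_measurable_LIMSEQ_real)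
  let ?u = "\<lambda>n p. f (real_of_int \<lfloor>real (Suc n) * fst p\<rfloor> / real (Suc n)) (snd p)"
  show "?u n \<in> borel_measurable (borel \<Otimes>\<^sub>M M)" for n
  proof (rule measurable_compose_countable[where f = "\<lambda>i p. f (real_of_int i / real (Suc n)) (snd p)"])
    show "(\<lambda>p. f (real_of_int i / real (Suc n)) (snd p)) \<in> borel_measurable (borel \<Otimes>\<^sub>M M)" for i :: int
      by (rule measurable_compose[OF measurable_snd meas])
  qed measurable
  fix p :: "real \<times> 'a"
  define t where "t = fst p"
  have "(\<lambda>n. real_of_int \<lfloor>real (Suc n) * t\<rfloor> / real (Suc n)) \<longlonglongrightarrow> t"
  proof (rule tendsto_sandwich[OF _ _ _ tendsto_const])
    have "(\<lambda>n. t - 1 / real (Suc n)) \<longlonglongrightarrow> t - 0"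
      by (intro tendsto_diff tendsto_const) (rule lim_1_over_n[THEN LIMSEQ_Suc])
    then show "(\<lambda>n. t - 1 / real (Suc n)) \<longlonglongrightarrow> t" by simp
    show "\<forall>\<^sub>F n in sequentially. t - 1 / real (Suc n) \<le> real_of_int \<lfloor>real (Suc n) * t\<rfloor> / real (Suc n)"
    proof (intro always_eventually allI)
      fix n
      have "real (Suc n) * t - 1 \<le> real_of_int \<lfloor>real (Suc n) * t\<rfloor>" by linarith
      then have "(real (Suc n) * t - 1) / real (Suc n) \<le> real_of_int \<lfloor>real (Suc n) * t\<rfloor> / real (Suc n)"
        by (intro divide_right_mono) auto
      then show "t - 1 / real (Suc n) \<le> real_of_int \<lfloor>real (Suc n) * t\<rfloor> / real (Suc n)"
        by (simp add: diff_divide_distrib del: of_nat_Suc)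
    qed
    show "\<forall>\<^sub>F n in sequentially. real_of_int \<lfloor>real (Suc n) * t\<rfloor> / real (Suc n) \<le> t"
    proof (intro always_eventually allI)
      fix n
      have "real_of_int \<lfloor>real (Suc n) * t\<rfloor> \<le> real (Suc n) * t" by linarith
      then have "real_of_int \<lfloor>real (Suc n) * t\<rfloor> / real (Suc n) \<le> real (Suc n) * t / real (Suc n)"
        by (intro divide_right_mono) auto
      then show "real_of_int \<lfloor>real (Suc n) * t\<rfloor> / real (Suc n) \<le> t" by (simp del: of_nat_Suc)
    qed
  qed
  then have "(\<lambda>n. f (real_of_int \<lfloor>real (Suc n) * t\<rfloor> / real (Suc n)) (snd p)) \<longlonglongrightarrow> f t (snd p)"
    by (intro continuous_on_tendsto_compose[OF cont]) auto
  then show "(\<lambda>n. ?u n p) \<longlonglongrightarrow> (case p of (t, \<omega>) \<Rightarrow> f t \<omega>)"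
    by (simp add: t_def case_prod_beta)
qed

section \<open>Expectations of time integrals, differentiation under the expectation, second-moment
  inequalities\<close>

context prob_space
begin

text \<open>Fubini for the process cut off to \<open>{0..t}\<close>: the uniform bound on first
  moments gives joint integrability, and for continuous paths the gauge integral in
  \<open>prim\<close> agrees with the Lebesgue integral. The last conclusion is what comparisons of
  integrated expectations require.\<close>

lemma expectation_prim:
  fixes f :: "real \<Rightarrow> 'a \<Rightarrow> real"
  assumes meas: "\<And>t. f t \<in> borel_measurable M" and cont: "\<And>\<omega>. continuous_on UNIV (\<lambda>t. f t \<omega>)"
    and int: "\<And>s. s \<in> {0..t} \<Longrightarrow> integrable M (f s)"
    and bound: "\<And>s. s \<in> {0..t} \<Longrightarrow> expectation (\<lambda>\<omega>. \<bar>f s \<omega>\<bar>) \<le> K"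
  shows "integrable M (\<lambda>\<omega>. prim (\<lambda>s. f s \<omega>) t)"
    and "expectation (\<lambda>\<omega>. prim (\<lambda>s. f s \<omega>) t) = prim (\<lambda>s. expectation (f s)) t"
    and "(\<lambda>s. expectation (f s)) integrable_on {0..t}"
proof -
  interpret P: pair_sigma_finite lborel M by standard
  define g where "g s \<omega> = indicator {0..t} s * f s \<omega>" for s \<omega>
  have fm: "(\<lambda>(t, \<omega>). f t \<omega>) \<in> borel_measurable (lborel \<Otimes>\<^sub>M M)"
    using continuous_process_measurable[OF meas cont]
    by (subst measurable_cong_sets[OF sets_pair_measure_cong[OF sets_lborel refl] refl])
  have [measurable]: "(\<lambda>x. f (fst x) (snd x)) \<in> borel_measurable (lborel \<Otimes>\<^sub>M M)"
    using fm by (simp add: case_prod_beta)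
  have gm: "case_prod g \<in> borel_measurable (lborel \<Otimes>\<^sub>M M)"
    unfolding g_def case_prod_beta by measurable
  have fs: "integrable M (g s)" for s
    using int[of s] by (cases "s \<in> {0..t}") (auto simp: g_def[abs_def])
  have gi: "integrable (lborel \<Otimes>\<^sub>M M) (case_prod g)"
  proof (rule P.Fubini_integrable[OF gm])
    show "integrable lborel (\<lambda>s. \<integral>\<omega>. norm (case_prod g (s, \<omega>)) \<partial>M)"
    proof (rule Bochner_Integration.integrable_bound)
      show "integrable lborel (\<lambda>s. indicator {0..t} s * K :: real)"
        by (intro integrable_mult_left integrable_real_indicator) (auto simp: emeasure_lborel_Icc_eq)
      show "(\<lambda>s. \<integral>\<omega>. norm (case_prod g (s, \<omega>)) \<partial>M) \<in> borel_measurable lborel"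
        using gm by measurable
      show "AE s in lborel. norm (\<integral>\<omega>. norm (case_prod g (s, \<omega>)) \<partial>M) \<le> norm (indicator {0..t} s * K)"
      proof (intro AE_I2)
        fix s
        show "norm (\<integral>\<omega>. norm (case_prod g (s, \<omega>)) \<partial>M) \<le> norm (indicator {0..t} s * K)"
          using bound[of s] by (cases "s \<in> {0..t}") (auto simp: g_def abs_mult)
      qed
    qed
    show "AE s in lborel. integrable M (\<lambda>\<omega>. case_prod g (s, \<omega>))"
      using fs by simp
  qed
  have path: "(\<integral>s. g s \<omega> \<partial>lborel) = prim (\<lambda>s. f s \<omega>) t" for \<omega>
  proof -
    have "set_integrable lborel {0..t} (\<lambda>s. f s \<omega>)"
      by (intro borel_integrable_atLeastAtMost' continuous_on_subset[OF cont]) auto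
    from set_borel_integral_eq_integral(2)[OF this] show ?thesis
      by (simp add: prim_def set_lebesgue_integral_def g_def)
  qed
  have "set_integrable lborel {0..t} (\<lambda>s. expectation (f s))"
  proof -
    have "integrable lborel (\<lambda>s. \<integral>\<omega>. g s \<omega> \<partial>M)" using P.integrable_fst[OF gi] .
    then show ?thesis by (simp add: set_integrable_def g_def)
  qed
  note e = set_borel_integral_eq_integral[OF this]
  have ex: "(\<integral>s. (\<integral>\<omega>. g s \<omega> \<partial>M) \<partial>lborel) = prim (\<lambda>s. expectation (f s)) t"
    using e(2) by (simp add: prim_def set_lebesgue_integral_def g_def)
  show "integrable M (\<lambda>\<omega>. prim (\<lambda>s. f s \<omega>) t)"
    using P.integrable_snd[OF gi] unfolding path .
  show "expectation (\<lambda>\<omega>. prim (\<lambda>s. f s \<omega>) t) = prim (\<lambda>s. expectation (f s)) t"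
    using P.Fubini_integral[OF gi] unfolding path ex .
  show "(\<lambda>s. expectation (f s)) integrable_on {0..t}" by (rule e(1))
qed

text \<open>Dominated convergence along arbitrary null sequences; the mean value inequality bounds
  every difference quotient by \<open>g\<close>.\<close>

lemma DERIV_expectation:
  fixes F F' :: "real \<Rightarrow> 'a \<Rightarrow> real"
  assumes int: "\<And>a. integrable M (F a)"
    and der: "\<And>a \<omega>. ((\<lambda>a. F a \<omega>) has_real_derivative F' a \<omega>) (at a)"
    and meas: "\<And>a. F' a \<in> borel_measurable M"
    and bound: "\<And>a \<omega>. \<bar>F' a \<omega>\<bar> \<le> g \<omega>" and g: "integrable M g"
  shows "((\<lambda>a. expectation (F a)) has_real_derivative expectation (F' a)) (at a)"
  unfolding DERIV_def tendsto_at_iff_sequentially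
proof (intro allI impI)
  fix X :: "nat \<Rightarrow> real"
  assume X: "\<forall>i. X i \<in> UNIV - {0}" "X \<longlonglongrightarrow> 0"
  have "(\<lambda>i. expectation (\<lambda>\<omega>. (F (a + X i) \<omega> - F a \<omega>) / X i)) \<longlonglongrightarrow> expectation (F' a)"
  proof (rule integral_dominated_convergence[where w = g])
    show "AE \<omega> in M. (\<lambda>i. (F (a + X i) \<omega> - F a \<omega>) / X i) \<longlonglongrightarrow> F' a \<omega>"
      using der[of _ a] X unfolding DERIV_def tendsto_at_iff_sequentially by (auto simp: o_def)
    show "AE \<omega> in M. norm ((F (a + X i) \<omega> - F a \<omega>) / X i) \<le> g \<omega>" for i
    proof (rule AE_I2)
      fix \<omega>
      have "\<bar>F (a + X i) \<omega> - F a \<omega>\<bar> \<le> g \<omega> * \<bar>(a + X i) - a\<bar>"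
        using field_differentiable_bound[of UNIV "\<lambda>a. F a \<omega>" "\<lambda>a. F' a \<omega>" "g \<omega>" "a + X i" a]
          der bound by (auto simp: has_field_derivative_at_within)
      then show "norm ((F (a + X i) \<omega> - F a \<omega>) / X i) \<le> g \<omega>"
        using X(1) by (simp add: divide_simps abs_mult)
    qed
  qed (use int meas g in \<open>auto intro!: borel_measurable_integrable\<close>)
  moreover have "expectation (\<lambda>\<omega>. (F (a + X i) \<omega> - F a \<omega>) / X i) = (expectation (F (a + X i)) - expectation (F a)) / X i" for i
    using int by simp
  ultimately show "((\<lambda>h. (expectation (F (a + h)) - expectation (F a)) / h) \<circ> X) \<longlonglongrightarrow> expectation (F' a)"
    unfolding o_def by (simp only:)
qed

lemma expectation_CS:
  fixes f g :: "'a \<Rightarrow> real"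
  assumes [measurable]: "f \<in> borel_measurable M" "g \<in> borel_measurable M"
    and f: "integrable M (\<lambda>\<omega>. (f \<omega>)\<^sup>2)" and g: "integrable M (\<lambda>\<omega>. (g \<omega>)\<^sup>2)"
  shows "integrable M (\<lambda>\<omega>. f \<omega> * g \<omega>)"
    and "(expectation (\<lambda>\<omega>. f \<omega> * g \<omega>))\<^sup>2 \<le> expectation (\<lambda>\<omega>. (f \<omega>)\<^sup>2) * expectation (\<lambda>\<omega>. (g \<omega>)\<^sup>2)"
proof -
  show fg: "integrable M (\<lambda>\<omega>. f \<omega> * g \<omega>)"
  proof (rule Bochner_Integration.integrable_bound)
    show "integrable M (\<lambda>\<omega>. (f \<omega>)\<^sup>2 + (g \<omega>)\<^sup>2)" using f g by simp
    show "AE \<omega> in M. norm (f \<omega> * g \<omega>) \<le> norm ((f \<omega>)\<^sup>2 + (g \<omega>)\<^sup>2)"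
    proof (rule AE_I2)
      fix \<omega>
      have "2 * \<bar>f \<omega> * g \<omega>\<bar> \<le> (f \<omega>)\<^sup>2 + (g \<omega>)\<^sup>2"
        using zero_le_power2[of "\<bar>f \<omega>\<bar> - \<bar>g \<omega>\<bar>"] by (simp add: power2_diff abs_mult)
      then show "norm (f \<omega> * g \<omega>) \<le> norm ((f \<omega>)\<^sup>2 + (g \<omega>)\<^sup>2)" by simp
    qed
  qed simp
  define a b c where "a = expectation (\<lambda>\<omega>. (f \<omega>)\<^sup>2)" and "b = expectation (\<lambda>\<omega>. f \<omega> * g \<omega>)"
    and "c = expectation (\<lambda>\<omega>. (g \<omega>)\<^sup>2)"
  have q: "0 \<le> a - 2 * x * b + x\<^sup>2 * c" for x
  proof -
    have "0 \<le> expectation (\<lambda>\<omega>. (f \<omega> - x * g \<omega>)\<^sup>2)" by simp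
    also have "(\<lambda>\<omega>. (f \<omega> - x * g \<omega>)\<^sup>2) = (\<lambda>\<omega>. (f \<omega>)\<^sup>2 - 2 * x * (f \<omega> * g \<omega>) + x\<^sup>2 * (g \<omega>)\<^sup>2)"
      by (auto simp: power2_eq_square algebra_simps)
    also have "expectation \<dots> = a - 2 * x * b + x\<^sup>2 * c"
      using f g fg by (simp add: a_def b_def c_def)
    finally show ?thesis .
  qed
  have c0: "c \<ge> 0" "a \<ge> 0" by (simp_all add: c_def a_def)
  have "b\<^sup>2 \<le> a * c"
  proof (cases "c = 0")
    case True
    have "b = 0"
    proof (rule ccontr)
      assume "b \<noteq> 0"
      \<comment> \<open>For c = 0 the quadratic is affine in x, and at this x it takes the value
        -1.\<close>
      then show False using q[of "(a + 1) / (2 * b)"] True by simp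
    qed
    then show ?thesis using True by simp
  next
    case False
    then have "0 \<le> (a - 2 * (b / c) * b + (b / c)\<^sup>2 * c) * c" using q[of "b / c"] c0 by (intro mult_nonneg_nonneg)
    also have "\<dots> = a * c - b\<^sup>2" using False by (simp add: field_simps power2_eq_square)
    finally show ?thesis by simp
  qed
  then show "(expectation (\<lambda>\<omega>. f \<omega> * g \<omega>))\<^sup>2 \<le> expectation (\<lambda>\<omega>. (f \<omega>)\<^sup>2) * expectation (\<lambda>\<omega>. (g \<omega>)\<^sup>2)"
    by (simp add: a_def b_def c_def)
qed

lemma integrable_of_square:
  fixes f :: "'a \<Rightarrow> real"
  assumes "f \<in> borel_measurable M" "integrable M (\<lambda>\<omega>. (f \<omega>)\<^sup>2)"
  shows "integrable M f" and "(expectation f)\<^sup>2 \<le> expectation (\<lambda>\<omega>. (f \<omega>)\<^sup>2)"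
  using expectation_CS[of f "\<lambda>_. 1"] assms by (simp_all add: prob_space)

lemma expectation_abs_le:
  fixes f :: "'a \<Rightarrow> real"
  assumes f[measurable]: "f \<in> borel_measurable M" "integrable M (\<lambda>\<omega>. (f \<omega>)\<^sup>2)"
  shows "expectation (\<lambda>\<omega>. \<bar>f \<omega>\<bar>) \<le> sqrt (expectation (\<lambda>\<omega>. (f \<omega>)\<^sup>2))"
  by (rule real_le_rsqrt) (use integrable_of_square(2)[of "\<lambda>\<omega>. \<bar>f \<omega>\<bar>"] f in simp)

text \<open>The series of these nonnegative variables has finite expectation, so it converges almost
  surely and its terms tend to 0. This takes the place of Borel-Cantelli.\<close>

lemma AE_tendsto_zero_of_summable_expectation:
  fixes R :: "nat \<Rightarrow> 'a \<Rightarrow> real"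
  assumes int: "\<And>n. integrable M (R n)" and nn: "\<And>n \<omega>. R n \<omega> \<ge> 0"
    and b: "\<And>n. expectation (R n) \<le> b n" "summable b"
  shows "AE \<omega> in M. (\<lambda>n. R n \<omega>) \<longlonglongrightarrow> 0"
proof -
  have [measurable]: "R n \<in> borel_measurable M" for n using int by simp
  have s: "summable (\<lambda>n. expectation (R n))"
    by (rule summable_comparison_test_ev[OF _ b(2)]) (use b(1) nn in \<open>auto intro!: always_eventually\<close>)
  have "(\<integral>\<^sup>+\<omega>. (\<Sum>n. ennreal (R n \<omega>)) \<partial>M) = (\<Sum>n. \<integral>\<^sup>+\<omega>. ennreal (R n \<omega>) \<partial>M)"
    by (rule nn_integral_suminf) measurable
  also have "\<dots> = (\<Sum>n. ennreal (expectation (R n)))"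
    using int nn by (simp add: nn_integral_eq_integral)
  also have "\<dots> = ennreal (\<Sum>n. expectation (R n))"
    using s nn by (intro suminf_ennreal2) auto
  finally have "AE \<omega> in M. (\<Sum>n. ennreal (R n \<omega>)) \<noteq> \<infinity>"
    by (intro nn_integral_PInf_AE) auto
  then show ?thesis
  proof eventually_elim
    fix \<omega> assume "(\<Sum>n. ennreal (R n \<omega>)) \<noteq> \<infinity>"
    then have "summable (\<lambda>n. R n \<omega>)"
      using nn by (intro summable_suminf_not_top) (auto simp: top_ennreal_def[symmetric])
    then show "(\<lambda>n. R n \<omega>) \<longlonglongrightarrow> 0" by (rule summable_LIMSEQ_zero)
  qed
qed

end

text \<open>The integral of the squared deviation of \<open>f\<close> from its mean \<open>m\<close>
  over the interval is nonnegative.\<close>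

lemma integral_square_le:
  fixes f :: "real \<Rightarrow> real"
  assumes c: "continuous_on {a..b} f" and ab: "a < b"
  shows "(integral {a..b} f)\<^sup>2 \<le> (b - a) * integral {a..b} (\<lambda>s. (f s)\<^sup>2)"
proof -
  define m where "m = integral {a..b} f / (b - a)"
  have "0 \<le> integral {a..b} (\<lambda>s. (f s - m)\<^sup>2)"
    by (intro integral_nonneg integrable_continuous_interval continuous_intros c) auto
  also have "(\<lambda>s. (f s - m)\<^sup>2) = (\<lambda>s. (f s)\<^sup>2 - 2 * m * f s + m\<^sup>2)"
    by (auto simp: power2_eq_square algebra_simps)
  also have "integral {a..b} \<dots> = integral {a..b} (\<lambda>s. (f s)\<^sup>2) - 2 * m * integral {a..b} f + m\<^sup>2 * (b - a)"
  proof -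
    have "integral {a..b} (\<lambda>s. (f s)\<^sup>2 - 2 * m * f s + m\<^sup>2)
      = integral {a..b} (\<lambda>s. (f s)\<^sup>2 - 2 * m * f s) + integral {a..b} (\<lambda>s. m\<^sup>2)"
      by (intro Henstock_Kurzweil_Integration.integral_add integrable_continuous_interval continuous_intros c)
    also have "integral {a..b} (\<lambda>s. (f s)\<^sup>2 - 2 * m * f s)
      = integral {a..b} (\<lambda>s. (f s)\<^sup>2) - integral {a..b} (\<lambda>s. 2 * m * f s)"
      by (intro Henstock_Kurzweil_Integration.integral_diff integrable_continuous_interval continuous_intros c)
    finally show ?thesis using ab by simp
  qed
  also have "m\<^sup>2 * (b - a) = m * integral {a..b} f"
    using ab by (simp add: m_def power2_eq_square)
  finally have "0 \<le> (b - a) * (integral {a..b} (\<lambda>s. (f s)\<^sup>2) - m * integral {a..b} f)"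
    using ab by (intro mult_nonneg_nonneg) auto
  also have "\<dots> = (b - a) * integral {a..b} (\<lambda>s. (f s)\<^sup>2) - (m * (b - a)) * integral {a..b} f"
    by (simp add: algebra_simps)
  also have "m * (b - a) = integral {a..b} f" using ab by (simp add: m_def)
  finally show ?thesis by (simp add: power2_eq_square)
qed

lemma prim_square_le:
  assumes f: "path0 f" and t: "t \<ge> 0"
  shows "(prim f t)\<^sup>2 \<le> t * prim (\<lambda>s. (f s)\<^sup>2) t"
proof (cases "t = 0")
  case False
  then show ?thesis
    using integral_square_le[OF path0_continuous_on[OF f], of 0 t] t by (simp add: prim_def)
qed (simp add: prim_nonpos)

section \<open>Totality of the trigonometric functionals\<close>

context prob_space
begin

lemma integrable_mult_bounded:
  fixes D g :: "'a \<Rightarrow> real"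
  assumes "integrable M D" and [measurable]: "g \<in> borel_measurable M" and "\<And>\<omega>. \<bar>g \<omega>\<bar> \<le> 1"
  shows "integrable M (\<lambda>\<omega>. D \<omega> * g \<omega>)"
proof (rule Bochner_Integration.integrable_bound[OF assms(1)])
  show "(\<lambda>\<omega>. D \<omega> * g \<omega>) \<in> borel_measurable M"
    using borel_measurable_integrable[OF assms(1)] by measurable
  show "AE \<omega> in M. norm (D \<omega> * g \<omega>) \<le> norm (D \<omega>)"
    using assms(3) by (intro AE_I2) (simp add: abs_mult mult_left_le)
qed

text \<open>Normalised to probability measures, the positive and the negative part of \<open>D\<close> give \<open>Y\<close> two
  laws with the same characteristic function.\<close>

lemma signed_char_unique:
  fixes D Y :: "'a \<Rightarrow> real"
  assumes D: "integrable M D" and Y[measurable]: "Y \<in> borel_measurable M"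
    and cos0: "\<And>c. expectation (\<lambda>\<omega>. D \<omega> * cos (c * Y \<omega>)) = 0"
    and sin0: "\<And>c. expectation (\<lambda>\<omega>. D \<omega> * sin (c * Y \<omega>)) = 0"
    and A[measurable]: "A \<in> sets borel"
  shows "expectation (\<lambda>\<omega>. D \<omega> * indicator A (Y \<omega>)) = 0"
proof -
  have [measurable]: "D \<in> borel_measurable M" using D by simp
  define p q where "p \<omega> = max 0 (D \<omega>)" and "q \<omega> = max 0 (- D \<omega>)" for \<omega>
  have [measurable]: "p \<in> borel_measurable M" "q \<in> borel_measurable M"
    by (simp_all add: p_def[abs_def] q_def[abs_def])
  have pi: "integrable M p" and qi: "integrable M q"
    unfolding p_def[abs_def] q_def[abs_def] using D by (auto intro!: integrable_max)
  have D_eq: "D \<omega> = p \<omega> - q \<omega>" for \<omega> by (simp add: p_def q_def max_def)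
  have nn: "p \<omega> \<ge> 0" "q \<omega> \<ge> 0" for \<omega> by (simp_all add: p_def q_def)
  define m where "m = expectation p"
  have m0: "m \<ge> 0" unfolding m_def using nn by (intro Bochner_Integration.integral_nonneg) auto
  have mq: "expectation q = m"
    using cos0[of 0] pi qi by (simp add: D_eq m_def)
  have pI: "integrable M (\<lambda>\<omega>. p \<omega> * indicator A (Y \<omega>))" and qI: "integrable M (\<lambda>\<omega>. q \<omega> * indicator A (Y \<omega>))"
    by (rule integrable_mult_bounded[OF pi] integrable_mult_bounded[OF qi]; simp add: indicator_def)+
  show ?thesis
  \<comment> \<open>The cosine hypothesis at frequency 0 gives both parts the same mass m. Without
    mass, \<open>D\<close> vanishes almost surely and there is nothing to normalise.\<close>
  proof (cases "m = 0")
    case True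
    have "AE \<omega> in M. p \<omega> = 0" "AE \<omega> in M. q \<omega> = 0"
      using integral_nonneg_eq_0_iff_AE[OF pi] integral_nonneg_eq_0_iff_AE[OF qi] nn True mq
      by (simp_all add: m_def)
    then have "AE \<omega> in M. D \<omega> * indicator A (Y \<omega>) = 0"
      by eventually_elim (simp add: D_eq)
    then show ?thesis by (rule integral_eq_zero_AE)
  next
    case False
    then have m: "m > 0" using m0 by simp
    have *: "prob_space (density M (\<lambda>\<omega>. ennreal (r \<omega> / m)))"
      if [measurable]: "r \<in> borel_measurable M" and r: "integrable M r" "\<And>\<omega>. r \<omega> \<ge> 0" "expectation r = m" for r
    proof
      have "(\<integral>\<^sup>+\<omega>. ennreal (r \<omega> / m) \<partial>M) = ennreal (expectation (\<lambda>\<omega>. r \<omega> / m))"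
        using r m by (intro nn_integral_eq_integral) auto
      also have "\<dots> = 1" using r m by simp
      finally show "emeasure (density M (\<lambda>\<omega>. ennreal (r \<omega> / m))) (space (density M (\<lambda>\<omega>. ennreal (r \<omega> / m)))) = 1"
        by (simp add: emeasure_density cong: nn_integral_cong)
    qed
    define M1 where "M1 = distr (density M (\<lambda>\<omega>. ennreal (p \<omega> / m))) borel Y"
    define M2 where "M2 = distr (density M (\<lambda>\<omega>. ennreal (q \<omega> / m))) borel Y"
    have rd: "real_distribution M1" "real_distribution M2"
      unfolding M1_def M2_def
      using *[OF _ pi nn(1) m_def[symmetric]] *[OF _ qi nn(2) mq]
      by (simp_all add: prob_space.real_distribution_distr)
    have ch: "char M1 c - char M2 c = 0" for c
    proof -
      have i: "integrable M (\<lambda>\<omega>. (r \<omega> / m) *\<^sub>R iexp (c * Y \<omega>))"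
        if [measurable]: "r \<in> borel_measurable M" and r: "integrable M r" for r
      proof (rule Bochner_Integration.integrable_bound)
        show "integrable M (\<lambda>\<omega>. r \<omega> / m)" using r by simp
      qed (auto simp: divide_simps)
      have "char M1 c - char M2 c = (CLINT \<omega>|M. (p \<omega> / m) *\<^sub>R iexp (c * Y \<omega>)) - (CLINT \<omega>|M. (q \<omega> / m) *\<^sub>R iexp (c * Y \<omega>))"
        unfolding M1_def M2_def char_def using nn m
        by (simp add: integral_distr integral_density)
      also have "\<dots> = (CLINT \<omega>|M. (p \<omega> / m) *\<^sub>R iexp (c * Y \<omega>) - (q \<omega> / m) *\<^sub>R iexp (c * Y \<omega>))"
        by (intro Bochner_Integration.integral_diff[symmetric] i pi qi) measurable
      also have "(\<lambda>\<omega>. (p \<omega> / m) *\<^sub>R iexp (c * Y \<omega>) - (q \<omega> / m) *\<^sub>R iexp (c * Y \<omega>)) = (\<lambda>\<omega>. (D \<omega> / m) *\<^sub>R iexp (c * Y \<omega>))"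
        by (simp add: D_eq diff_divide_distrib scaleR_left_diff_distrib)
      also have "(CLINT \<omega>|M. (D \<omega> / m) *\<^sub>R iexp (c * Y \<omega>)) = 0"
      proof (rule complex_eqI)
        have ii: "integrable M (\<lambda>\<omega>. (D \<omega> / m) *\<^sub>R iexp (c * Y \<omega>))" by (rule i) (use D in auto)
        have "Re (CLINT \<omega>|M. (D \<omega> / m) *\<^sub>R iexp (c * Y \<omega>)) = expectation (\<lambda>\<omega>. Re ((D \<omega> / m) *\<^sub>R iexp (c * Y \<omega>)))"
          by (rule integral_Re[OF ii, symmetric])
        also have "(\<lambda>\<omega>. Re ((D \<omega> / m) *\<^sub>R iexp (c * Y \<omega>))) = (\<lambda>\<omega>. (D \<omega> * cos (c * Y \<omega>)) / m)"
          by (simp add: Re_exp)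
        finally show "Re (CLINT \<omega>|M. (D \<omega> / m) *\<^sub>R iexp (c * Y \<omega>)) = Re 0" using cos0[of c] by simp
        have "Im (CLINT \<omega>|M. (D \<omega> / m) *\<^sub>R iexp (c * Y \<omega>)) = expectation (\<lambda>\<omega>. Im ((D \<omega> / m) *\<^sub>R iexp (c * Y \<omega>)))"
          by (rule integral_Im[OF ii, symmetric])
        also have "(\<lambda>\<omega>. Im ((D \<omega> / m) *\<^sub>R iexp (c * Y \<omega>))) = (\<lambda>\<omega>. (D \<omega> * sin (c * Y \<omega>)) / m)"
          by (simp add: Im_exp)
        finally show "Im (CLINT \<omega>|M. (D \<omega> / m) *\<^sub>R iexp (c * Y \<omega>)) = Im 0" using sin0[of c] by simp
      qed
      finally show ?thesis .
    qed
    have "M1 = M2" by (rule Levy_uniqueness[OF rd]) (use ch in auto)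
    then have "(\<integral>x. indicator A x \<partial>M1) = (\<integral>x. indicator A x \<partial>M2 :: real)" by simp
    then have "expectation (\<lambda>\<omega>. p \<omega> * indicator A (Y \<omega>)) = expectation (\<lambda>\<omega>. q \<omega> * indicator A (Y \<omega>))"
      unfolding M1_def M2_def using nn m
      by (simp add: integral_distr integral_density del: integral_indicator Bochner_Integration.integral_indicator)
    then show ?thesis using pI qI by (simp add: D_eq left_diff_distrib)
  qed
qed

text \<open>Induction on the number of indicators. Product-to-sum formulas express the cosine factor
  times cos or sin of \<open>u * B (s m)\<close> by cosines with one more time point, which the
  induction hypothesis covers; \<open>signed_char_unique\<close> then trades the free frequency u
  for an indicator. Hence the phase and the linear combination have to stay general.\<close>

lemma cylinder_expectation_zero:
  fixes D :: "'a \<Rightarrow> real" and B :: "real \<Rightarrow> 'a \<Rightarrow> real" and m n :: nat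
  assumes D: "integrable M D" and B[measurable]: "\<And>t. B t \<in> borel_measurable M"
    and zero: "\<And>(n::nat) c t \<phi>. expectation (\<lambda>\<omega>. D \<omega> * cos (\<phi> + (\<Sum>i<n. c i * B (t i) \<omega>))) = 0"
    and A: "\<And>j. j < m \<Longrightarrow> A j \<in> sets borel"
  shows "expectation (\<lambda>\<omega>. D \<omega> * (\<Prod>j<m. indicator (A j) (B (s j) \<omega>)) * cos (\<phi> + (\<Sum>i<n. c i * B (t i) \<omega>))) = 0"
  using A
proof (induction m arbitrary: n c t \<phi>)
  case 0
  then show ?case using zero by simp
next
  case (Suc m)
  have [measurable]: "j < Suc m \<Longrightarrow> A j \<in> sets borel" for j using Suc.prems by simp
  define P :: "'a \<Rightarrow> real" where "P \<omega> = (\<Prod>j<m. indicator (A j) (B (s j) \<omega>))" for \<omega>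
  have [measurable]: "P \<in> borel_measurable M"
    unfolding P_def[abs_def] by (intro borel_measurable_prod measurable_compose[OF B borel_measurable_indicator]) auto
  have P1: "\<bar>P \<omega>\<bar> \<le> 1" for \<omega>
    unfolding P_def abs_prod by (intro prod_le_1) (auto simp: indicator_def)
  let ?N = "\<lambda>\<omega>. \<Sum>i<n. c i * B (t i) \<omega>" and ?Y = "B (s m)"
  have DP: "integrable M (\<lambda>\<omega>. D \<omega> * P \<omega>)" by (rule integrable_mult_bounded[OF D _ P1]) measurable
  have IH0: "expectation (\<lambda>\<omega>. D \<omega> * P \<omega> * cos (x + (\<Sum>i<k. d i * B (r i) \<omega>))) = 0" for k :: nat and d r x
    unfolding P_def by (rule Suc.IH) (use Suc.prems in auto)
  have IH: "expectation (\<lambda>\<omega>. D \<omega> * P \<omega> * cos (\<psi> + (?N \<omega> + u * ?Y \<omega>))) = 0" for \<psi> u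
  proof -
    have "(\<Sum>i<n. (c(n := u)) i * B ((t(n := s m)) i) \<omega>) = ?N \<omega>" for \<omega>
      by (intro sum.cong) auto
    then show ?thesis
      using IH0[of \<psi> "c(n := u)" "t(n := s m)" "Suc n"] by (simp add: P_def)
  qed
  have i: "integrable M (\<lambda>\<omega>. D \<omega> * P \<omega> * cos (\<psi> + (?N \<omega> + u * ?Y \<omega>)))" for \<psi> u
    by (rule integrable_mult_bounded[OF DP]) auto
  have "expectation (\<lambda>\<omega>. (D \<omega> * P \<omega> * cos (\<phi> + ?N \<omega>)) * indicator (A m) (?Y \<omega>)) = 0"
  proof (rule signed_char_unique)
    show "integrable M (\<lambda>\<omega>. D \<omega> * P \<omega> * cos (\<phi> + ?N \<omega>))"
      by (rule integrable_mult_bounded[OF DP]) auto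
    fix u
    have e1: "d * cos (\<phi> + x) * cos y = (d * cos (\<phi> + (x + y)) + d * cos (\<phi> + (x + (- y)))) / 2" for d x y :: real
      by (simp only: add.assoc[symmetric] cos_add[of "\<phi> + x"]) (simp add: algebra_simps)
    have cs: "cos ((\<phi> - pi / 2) + z) = sin (\<phi> + z)" for z
      using sin_cos_eq[of "\<phi> + z"] cos_minus[of "pi / 2 - (\<phi> + z)"] by (simp add: algebra_simps)
    have e2: "d * cos (\<phi> + x) * sin y = (d * cos ((\<phi> - pi / 2) + (x + y)) - d * cos ((\<phi> - pi / 2) + (x + (- y)))) / 2" for d x y :: real
      unfolding cs by (simp only: add.assoc[symmetric] sin_add[of "\<phi> + x"]) (simp add: algebra_simps)
    have "(\<lambda>\<omega>. D \<omega> * P \<omega> * cos (\<phi> + ?N \<omega>) * cos (u * ?Y \<omega>)) =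
        (\<lambda>\<omega>. (D \<omega> * P \<omega> * cos (\<phi> + (?N \<omega> + u * ?Y \<omega>)) + D \<omega> * P \<omega> * cos (\<phi> + (?N \<omega> + (- u) * ?Y \<omega>))) / 2)"
      unfolding e1 by simp
    then show "expectation (\<lambda>\<omega>. D \<omega> * P \<omega> * cos (\<phi> + ?N \<omega>) * cos (u * ?Y \<omega>)) = 0"
      by (simp only: integral_divide_zero Bochner_Integration.integral_add[OF i i] IH) simp
    have "(\<lambda>\<omega>. D \<omega> * P \<omega> * cos (\<phi> + ?N \<omega>) * sin (u * ?Y \<omega>)) =
        (\<lambda>\<omega>. (D \<omega> * P \<omega> * cos ((\<phi> - pi / 2) + (?N \<omega> + u * ?Y \<omega>)) - D \<omega> * P \<omega> * cos ((\<phi> - pi / 2) + (?N \<omega> + (- u) * ?Y \<omega>))) / 2)"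
      unfolding e2 by simp
    then show "expectation (\<lambda>\<omega>. D \<omega> * P \<omega> * cos (\<phi> + ?N \<omega>) * sin (u * ?Y \<omega>)) = 0"
      by (simp only: integral_divide_zero Bochner_Integration.integral_diff[OF i i] IH) simp
  qed (use Suc.prems in auto)
  then show ?case by (simp add: P_def mult_ac)
qed

text \<open>Cylinder sets form an intersection-stable generator of the sigma-field of
  \<open>B\<close>, and \<open>D\<close> integrates to 0 over each of them. A Dynkin argument
  extends this to the whole sigma-field.\<close>

lemma AE_eq_0_of_trigonometric:
  fixes D :: "'a \<Rightarrow> real" and B :: "real \<Rightarrow> 'a \<Rightarrow> real"
  assumes gen: "completely_generated_by M B" and D: "integrable M D"
    and zero: "\<And>(n::nat) c t \<phi>. (\<forall>i<n. 0 \<le> t i) \<Longrightarrow> expectation (\<lambda>\<omega>. D \<omega> * cos (\<phi> + (\<Sum>i<n. c i * B (t i) \<omega>))) = 0"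
  shows "AE \<omega> in M. D \<omega> = 0"
proof -
  \<comment> \<open>Times are folded to the nonnegative half line, so that the cylinder lemma can be
    applied with arbitrary real times.\<close>
  define C where "C t = B (max 0 t)" for t
  have C[measurable]: "C t \<in> borel_measurable M" for t
    using gen by (simp add: C_def completely_generated_by_def)
  define G where "G = {{\<omega>\<in>space M. \<forall>j<m. C (s j) \<omega> \<in> A j} | (m::nat) s A. \<forall>j<m. A j \<in> sets borel}"
  define F where "F = process_sigma M B"
  have "Int_stable G"
  proof (rule Int_stableI)
    fix a b assume "a \<in> G" "b \<in> G"
    from \<open>a \<in> G\<close> obtain m :: nat and s A where a: "a = {\<omega>\<in>space M. \<forall>j<m. C (s j) \<omega> \<in> A j}" "\<forall>j<m. A j \<in> sets borel"
      unfolding G_def by blast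
    from \<open>b \<in> G\<close> obtain m' :: nat and s' A' where b: "b = {\<omega>\<in>space M. \<forall>j<m'. C (s' j) \<omega> \<in> A' j}" "\<forall>j<m'. A' j \<in> sets borel"
      unfolding G_def by blast
    define s'' A'' where "s'' j = (if j < m then s j else s' (j - m))"
      and "A'' j = (if j < m then A j else A' (j - m))" for j
    have "a \<inter> b = {\<omega>\<in>space M. \<forall>j<m+m'. C (s'' j) \<omega> \<in> A'' j}"
    proof -
      have "(\<forall>j<m+m'. C (s'' j) \<omega> \<in> A'' j) \<longleftrightarrow> (\<forall>j<m. C (s j) \<omega> \<in> A j) \<and> (\<forall>j<m'. C (s' j) \<omega> \<in> A' j)" for \<omega>
      proof (intro iffI conjI allI impI)
        fix j assume h: "\<forall>j<m+m'. C (s'' j) \<omega> \<in> A'' j"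
        { assume "j < m" then show "C (s j) \<omega> \<in> A j" using h[rule_format, of j] by (simp add: s''_def A''_def) }
        { assume "j < m'" then show "C (s' j) \<omega> \<in> A' j" using h[rule_format, of "m + j"] by (simp add: s''_def A''_def) }
      next
        fix j assume "(\<forall>j<m. C (s j) \<omega> \<in> A j) \<and> (\<forall>j<m'. C (s' j) \<omega> \<in> A' j)" "j < m + m'"
        then show "C (s'' j) \<omega> \<in> A'' j" by (auto simp: s''_def A''_def)
      qed
      then show ?thesis by (auto simp: a b)
    qed
    moreover have "\<forall>j<m+m'. A'' j \<in> sets borel" using a b by (auto simp: A''_def)
    ultimately show "a \<inter> b \<in> G" unfolding G_def by blast
  qed
  have Gp: "G \<subseteq> Pow (space M)" unfolding G_def by auto
  have Gs: "G \<subseteq> sets M"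
  proof -
    have meas: "{\<omega>\<in>space M. \<forall>j<m. C (s j) \<omega> \<in> A j} \<in> sets M" if "\<forall>j<m. A j \<in> sets borel" for m :: nat and s and A :: "nat \<Rightarrow> real set"
    proof -
      have "Measurable.pred M (\<lambda>\<omega>. \<forall>j\<in>{..<m}. C (s j) \<omega> \<in> A j)"
        by (intro pred_intros_finite pred_sets2[OF _ C]) (use that in auto)
      then have "{\<omega>\<in>space M. \<forall>j\<in>{..<m}. C (s j) \<omega> \<in> A j} \<in> sets M"
        by (rule pred_def[THEN iffD1])
      then show ?thesis by (simp only: Ball_def lessThan_iff)
    qed
    show ?thesis
    proof
      fix a assume "a \<in> G"
      then obtain m :: nat and s A where "a = {\<omega>\<in>space M. \<forall>j<m. C (s j) \<omega> \<in> A j}" "\<forall>j<m. A j \<in> sets borel"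
        unfolding G_def by blast
      then show "a \<in> sets M" by (simp only: meas)
    qed
  qed
  have gens: "{B t -` A \<inter> space M | t A. 0 \<le> t \<and> A \<in> sets borel} \<subseteq> G"
  proof safe
    fix t :: real and A :: "real set" assume "0 \<le> t" "A \<in> sets borel"
    then show "B t -` A \<inter> space M \<in> G"
      unfolding G_def by (intro CollectI exI[of _ "1::nat"] exI[of _ "\<lambda>_. t"] exI[of _ "\<lambda>_. A"]) (auto simp: C_def)
  qed
  have Fs: "sets F = sigma_sets (space M) {B t -` A \<inter> space M | t A. 0 \<le> t \<and> A \<in> sets borel}"
    unfolding F_def process_sigma_def by (subst sets_measure_of) auto
  have Fsp: "space F = space M" unfolding F_def process_sigma_def by (simp add: space_measure_of_conv)
  have FM: "sets F \<subseteq> sets M"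
    unfolding Fs by (rule sets.sigma_sets_subset) (use gens Gs in blast)
  have sub: "subalgebra M F" using FM Fsp by (simp add: subalgebra_def)
  have zeroC: "expectation (\<lambda>\<omega>. D \<omega> * cos (\<phi> + (\<Sum>i<n. c i * C (t i) \<omega>))) = 0" for n :: nat and c t \<phi>
    unfolding C_def by (rule zero) simp
  have P: "expectation (\<lambda>\<omega>. D \<omega> * indicator a \<omega>) = 0" if "a \<in> sigma_sets (space M) G" for a
    using \<open>Int_stable G\<close> Gp that
  proof (induction rule: sigma_sets_induct_disjoint)
    case (basic a)
    then obtain m :: nat and s A where a: "a = {\<omega>\<in>space M. \<forall>j<m. C (s j) \<omega> \<in> A j}" "\<forall>j<m. A j \<in> sets borel"
      unfolding G_def by blast
    have "expectation (\<lambda>\<omega>. D \<omega> * indicator a \<omega>) = expectation (\<lambda>\<omega>. D \<omega> * (\<Prod>j<m. indicator (A j) (C (s j) \<omega>)))"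
    proof (intro Bochner_Integration.integral_cong refl)
      fix \<omega> assume "\<omega> \<in> space M"
      then have "(indicator a \<omega> :: real) = (\<Prod>j<m. indicator (A j) (C (s j) \<omega>))"
        by (auto simp: a indicator_def)
      then show "D \<omega> * indicator a \<omega> = D \<omega> * (\<Prod>j<m. indicator (A j) (C (s j) \<omega>))" by simp
    qed
    also have "\<dots> = 0"
      using cylinder_expectation_zero[OF D C zeroC, where m = m and A = A and s = s and \<phi> = 0 and n = 0] a by simp
    finally show ?case .
  next
    case empty
    then show ?case by simp
  next
    case (compl a)
    have [measurable]: "a \<in> sets M" using compl(1) sets.sigma_sets_subset[OF Gs] by blast
    have "expectation (\<lambda>\<omega>. D \<omega> * indicator (space M - a) \<omega>) = expectation (\<lambda>\<omega>. D \<omega> - D \<omega> * indicator a \<omega>)"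
      by (intro Bochner_Integration.integral_cong) (auto simp: indicator_def)
    also have "\<dots> = expectation D - expectation (\<lambda>\<omega>. D \<omega> * indicator a \<omega>)"
      by (intro Bochner_Integration.integral_diff D integrable_mult_bounded) (auto simp: indicator_def)
    also have "expectation D = 0"
    proof -
      have "expectation (\<lambda>\<omega>. D \<omega> * cos (0 + (\<Sum>i<(0::nat). (\<lambda>_. 0) i * B ((\<lambda>_. 0) i) \<omega>))) = 0"
        by (rule zero) simp
      then show ?thesis by simp
    qed
    finally show ?case using compl(2) by simp
  next
    case (union a)
    have am: "range a \<subseteq> sets M" using union(2) sets.sigma_sets_subset[OF Gs] by blast
    then have [measurable]: "a i \<in> sets M" for i by auto
    have si: "set_integrable M (\<Union>i. a i) D"
      unfolding set_integrable_def by (subst scaleR_conv_of_real, subst mult.commute)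
        (auto intro!: integrable_mult_bounded D simp: indicator_def)
    have "(\<lambda>i. LINT \<omega>:a i|M. D \<omega>) sums (LINT \<omega>:(\<Union>i. a i)|M. D \<omega>)"
    proof -
      have "(LINT \<omega>:(\<Union>i. a i)|M. D \<omega>) = (\<Sum>i. (LINT \<omega>:a i|M. D \<omega>))"
        by (rule lebesgue_integral_countable_add[OF _ _ si]) (use union(1) in \<open>auto simp: disjoint_family_on_def\<close>)
      moreover have z: "(LINT \<omega>:a i|M. D \<omega>) = 0" for i
        using union(3)[of i] by (simp add: set_lebesgue_integral_def mult.commute)
      ultimately show ?thesis by simp
    qed
    moreover have "(LINT \<omega>:a i|M. D \<omega>) = 0" for i
      using union(3)[of i] by (simp add: set_lebesgue_integral_def mult.commute)
    ultimately have "(LINT \<omega>:(\<Union>i. a i)|M. D \<omega>) = 0" by (simp add: sums_iff)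
    then show ?case by (simp add: set_lebesgue_integral_def mult.commute)
  qed
  \<comment> \<open>\<open>D\<close> is known to be measurable for the completion of
    \<open>M'\<close> only. A version \<open>D'\<close> that is measurable for \<open>M'\<close>
    itself is the one determined by its integrals over the sets of \<open>M'\<close>.\<close>
  define M' where "M' = restr_to_subalg M F"
  have Mc: "M = completion M'" using gen by (simp add: completely_generated_by_def M'_def F_def)
  have sM': "sets M' = sets F" unfolding M'_def by (rule sets_restr_to_subalg[OF sub])
  have "D \<in> borel_measurable (completion M')" using borel_measurable_integrable[OF D] unfolding Mc[symmetric] .
  then obtain D' where D'[measurable]: "D' \<in> borel_measurable M'" and eq: "AE \<omega> in M'. D \<omega> = D' \<omega>"
    using completion_ex_borel_measurable_real by blast
  have eqM: "AE \<omega> in M. D \<omega> = D' \<omega>" using AE_completion[OF eq] unfolding Mc[symmetric] .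
  have D'M[measurable]: "D' \<in> borel_measurable M" using measurable_completion[OF D'] unfolding Mc[symmetric] .
  have D'i: "integrable M D'" using integrable_cong_AE[THEN iffD1, OF _ _ eqM D] D by simp
  interpret M': prob_space M'
    unfolding M'_def by (rule prob_space_restr_to_subalg[OF sub prob_space_axioms])
  have "integrable M' D'" using D'i integrable_completion[OF D'] unfolding Mc[symmetric] by simp
  then have "AE \<omega> in M'. D' \<omega> = 0"
  proof (rule M'.density_zero)
    fix a assume a: "a \<in> sets M'"
    then have [measurable]: "a \<in> sets M" using sM' FM by auto
    have "a \<in> sigma_sets (space M) G"
      using a sM' Fs sigma_sets_mono'[OF gens, of "space M"] by auto
    then have "0 = expectation (\<lambda>\<omega>. D \<omega> * indicator a \<omega>)" using P by simp
    also have "\<dots> = expectation (\<lambda>\<omega>. indicator a \<omega> *\<^sub>R D' \<omega>)"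
      using D by (intro integral_cong_AE) (use eqM in \<open>auto elim!: eventually_mono\<close>)
    also have "\<dots> = integral\<^sup>L (completion M') (\<lambda>\<omega>. indicator a \<omega> *\<^sub>R D' \<omega>)" by (simp only: Mc[symmetric])
    also have "\<dots> = (\<integral>\<omega>. indicator a \<omega> *\<^sub>R D' \<omega> \<partial>M')"
      using a by (intro integral_completion) auto
    finally show "set_lebesgue_integral M' a D' = 0" by (simp add: set_lebesgue_integral_def)
  qed
  then have "AE \<omega> in completion M'. D' \<omega> = 0" by (rule AE_completion)
  then have "AE \<omega> in M. D' \<omega> = 0" unfolding Mc[symmetric] .
  with eqM show ?thesis by eventually_elim simp
qed

end

text \<open>In a complete space a modification on a null set stays measurable. This serves processes
  altered on a null set, and the pathwise inner product in the duality relation, whose measurability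
  is inferred from an almost sure identity.\<close>

lemma completion_measurable_AE_eq:
  fixes f g :: "'a \<Rightarrow> real"
  assumes g: "g \<in> borel_measurable (completion N)" and eq: "AE \<omega> in completion N. f \<omega> = g \<omega>"
  shows "f \<in> borel_measurable (completion N)"
proof (rule measurableI)
  fix A :: "real set" assume A: "A \<in> sets borel"
  show "f -` A \<inter> space (completion N) \<in> sets (completion N)"
  proof (rule completion.in_sets_AE)
    show "g -` A \<inter> space (completion N) \<in> sets (completion N)"
      using measurable_sets[OF g A] .
    show "AE x in completion N. (x \<in> g -` A \<inter> space (completion N)) = (x \<in> f -` A \<inter> space (completion N))"
      using eq by eventually_elim auto
  qed auto
qed simp

section \<open>The first Wiener chaos\<close>

text \<open>For p > 1 the derivative exists at 0 too and equals 0, which the formula yields through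
  \<open>sgn 0 = 0\<close>.\<close>

lemma powr_abs_has_derivative:
  fixes p :: real
  assumes "p > 1"
  shows "((\<lambda>x. \<bar>x\<bar> powr p) has_real_derivative p * sgn x * \<bar>x\<bar> powr (p - 1)) (at x)"
proof (cases "x = 0")
  case False
  have "((\<lambda>x. (if x > 0 then x else - x) powr p) has_real_derivative p * sgn x * \<bar>x\<bar> powr (p - 1)) (at x)"
  proof (cases "x > 0")
    case True
    have "((\<lambda>x. x powr p) has_real_derivative p * x powr (p - 1)) (at x)"
      using True by (intro has_real_derivative_powr)
    then have "((\<lambda>x. (if x > 0 then x else - x) powr p) has_real_derivative p * x powr (p - 1)) (at x)"
      by (rule has_field_derivative_transform_within_open[where S = "{0<..}"]) (use True in auto)
    then show ?thesis using True by simp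
  next
    case n: False
    have "((\<lambda>x. (- x) powr p) has_real_derivative (p * (- x) powr (p - 1)) * (- 1)) (at x)"
      using n False by (intro DERIV_chain2[where f = "\<lambda>y. y powr p" and g = uminus] has_real_derivative_powr)
        (auto intro!: derivative_eq_intros)
    then have "((\<lambda>x. (if x > 0 then x else - x) powr p) has_real_derivative (p * (- x) powr (p - 1)) * (- 1)) (at x)"
      by (rule has_field_derivative_transform_within_open[where S = "{..<0}"]) (use n False in auto)
    then show ?thesis using n False by simp
  qed
  moreover have "(\<lambda>x::real. (if x > 0 then x else - x) powr p) = (\<lambda>x. \<bar>x\<bar> powr p)" by (auto simp: abs_if)
  ultimately show ?thesis by simp
next
  case True
  have "((\<lambda>h::real. \<bar>h\<bar> powr (p - 1)) \<longlongrightarrow> \<bar>0\<bar> powr (p - 1)) (at 0)"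
    using assms by (intro tendsto_powr' tendsto_intros) auto
  then have l: "((\<lambda>h::real. \<bar>h\<bar> powr (p - 1)) \<longlongrightarrow> 0) (at 0)" by simp
  have "((\<lambda>h::real. \<bar>h\<bar> powr p / h) \<longlongrightarrow> 0) (at 0)"
  proof (rule tendsto_rabs_zero_cancel, rule Lim_transform_eventually[OF l])
    have "\<forall>\<^sub>F h in at (0::real). h \<noteq> 0" by (simp add: eventually_at_filter)
    then show "\<forall>\<^sub>F h in at (0::real). \<bar>h\<bar> powr (p - 1) = \<bar>\<bar>h\<bar> powr p / h\<bar>"
      by eventually_elim (simp add: abs_divide powr_diff)
  qed
  then show ?thesis using True assms by (simp add: DERIV_def)
qed

text \<open>By convexity of |x|^p its increments over a fixed step are nondecreasing. With p = 2 H
  this becomes the positive correlation of the increments of fractional Brownian motion.\<close>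

lemma powr_abs_four_point:
  fixes p :: real
  assumes p: "p > 1" and "a \<le> c" "0 \<le> k"
  shows "\<bar>a + k\<bar> powr p - \<bar>a\<bar> powr p \<le> \<bar>c + k\<bar> powr p - \<bar>c\<bar> powr p"
proof (rule DERIV_nonneg_imp_nondecreasing[OF \<open>a \<le> c\<close>])
  fix x :: real
  have m: "sgn x * \<bar>x\<bar> powr (p - 1) \<le> sgn y * \<bar>y\<bar> powr (p - 1)" if "x \<le> y" for x y :: real
  proof -
    consider "x \<ge> 0" | "x < 0" "y \<ge> 0" | "y < 0" by linarith
    then show ?thesis
    proof cases
      case 1
      then show ?thesis using that p powr_mono2[of "p - 1" x y] by (auto simp: sgn_if)
    next
      case 2
      then show ?thesis by (auto simp: sgn_if intro: order_trans[of _ 0])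
    next
      case 3
      then show ?thesis using that p powr_mono2[of "p - 1" "-y" "-x"] by (auto simp: sgn_if)
    qed
  qed
  have "((\<lambda>x. \<bar>x + k\<bar> powr p - \<bar>x\<bar> powr p) has_real_derivative
      (p * sgn (x + k) * \<bar>x + k\<bar> powr (p - 1)) * 1 - p * sgn x * \<bar>x\<bar> powr (p - 1)) (at x)"
    by (intro DERIV_diff powr_abs_has_derivative p DERIV_chain2[where f = "\<lambda>x. \<bar>x\<bar> powr p"]) (auto intro!: derivative_eq_intros)
  moreover have "0 \<le> (p * sgn (x + k) * \<bar>x + k\<bar> powr (p - 1)) * 1 - p * sgn x * \<bar>x\<bar> powr (p - 1)"
    using mult_left_mono[OF m[of x "x + k"], of p] assms by (simp add: mult.assoc)
  ultimately show "\<exists>y. ((\<lambda>x. \<bar>x + k\<bar> powr p - \<bar>x\<bar> powr p) has_real_derivative y) (at x) \<and> 0 \<le> y" by blast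
qed

lemma cos_lipschitz: "\<bar>cos x - cos y\<bar> \<le> \<bar>x - y\<bar>" for x y :: real
  using field_differentiable_bound[of UNIV cos "\<lambda>x. - sin x" 1 x y]
  by (auto intro!: derivative_eq_intros)

lemma sin_lipschitz: "\<bar>sin x - sin y\<bar> \<le> \<bar>x - y\<bar>" for x y :: real
  using field_differentiable_bound[of UNIV sin cos 1 x y]
  by (auto intro!: derivative_eq_intros)

section \<open>Gaussian variables through their characteristic functions\<close>

context prob_space
begin

text \<open>Real and imaginary part of the characteristic function at 1; the point mass at zero has
  no density and is treated apart.\<close>

lemma centered_gaussian_trig:
  assumes "centered_gaussian_rv M Y"
  shows "integrable M (\<lambda>\<omega>. (Y \<omega>)\<^sup>2)"
    and "expectation (\<lambda>\<omega>. cos (Y \<omega>)) = exp (- expectation (\<lambda>\<omega>. (Y \<omega>)\<^sup>2) / 2)"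
    and "expectation (\<lambda>\<omega>. sin (Y \<omega>)) = 0"
proof -
  have [measurable]: "Y \<in> borel_measurable M" using assms by (simp add: centered_gaussian_rv_def)
  consider "AE \<omega> in M. Y \<omega> = 0" | \<sigma> where "\<sigma> > 0" "distributed M lborel Y (normal_density 0 \<sigma>)"
    using assms by (auto simp: centered_gaussian_rv_def)
  then have "integrable M (\<lambda>\<omega>. (Y \<omega>)\<^sup>2) \<and> expectation (\<lambda>\<omega>. cos (Y \<omega>)) = exp (- expectation (\<lambda>\<omega>. (Y \<omega>)\<^sup>2) / 2)
     \<and> expectation (\<lambda>\<omega>. sin (Y \<omega>)) = 0"
  proof cases
    case 1
    have "expectation (\<lambda>\<omega>. cos (Y \<omega>)) = expectation (\<lambda>\<omega>. 1)"
      by (rule integral_cong_AE) (use 1 in \<open>auto elim!: eventually_mono\<close>)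
    moreover have "expectation (\<lambda>\<omega>. sin (Y \<omega>)) = expectation (\<lambda>\<omega>. 0)"
      by (rule integral_cong_AE) (use 1 in \<open>auto elim!: eventually_mono\<close>)
    moreover have "expectation (\<lambda>\<omega>. (Y \<omega>)\<^sup>2) = expectation (\<lambda>\<omega>. 0)"
      by (rule integral_cong_AE) (use 1 in \<open>auto elim!: eventually_mono\<close>)
    moreover have "integrable M (\<lambda>\<omega>. (Y \<omega>)\<^sup>2)"
      by (rule integrable_cong_AE[THEN iffD1, of "\<lambda>_. 0"]) (use 1 in \<open>auto elim!: eventually_mono\<close>)
    ultimately show ?thesis by (simp add: prob_space)
  next
    case 2
    note D = 2(2)
    have int: "integrable M (\<lambda>\<omega>. (Y \<omega>)\<^sup>2)"
      using integrable_normal_moment[OF 2(1), of 0 2] distributed_integrable[OF D, of "\<lambda>x. x\<^sup>2"] by simp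
    have var: "expectation (\<lambda>\<omega>. (Y \<omega>)\<^sup>2) = \<sigma>\<^sup>2"
      using integral_normal_moment_even[OF 2(1), of 0 1] distributed_integral[OF D, of "\<lambda>x. x\<^sup>2", symmetric]
      by (simp add: eval_nat_numeral)
    have "distributed M lborel (\<lambda>\<omega>. (Y \<omega> - 0) / \<sigma>) std_normal_density"
      using normal_standard_normal_convert[OF 2(1), of Y 0] D by simp
    then have eq: "distr M lborel (\<lambda>\<omega>. Y \<omega> / \<sigma>) = std_normal_distribution"
      by (auto simp: distributed_def)
    have "(CLINT \<omega>|M. iexp (Y \<omega>)) = (CLINT x|distr M lborel (\<lambda>\<omega>. Y \<omega> / \<sigma>). iexp (\<sigma> * x))"
      using 2(1) by (subst integral_distr) auto
    also have "\<dots> = char std_normal_distribution \<sigma>" unfolding eq char_def ..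
    also have "\<dots> = complex_of_real (exp (- \<sigma>\<^sup>2 / 2))" by (simp add: char_std_normal_distribution)
    finally have ch: "(CLINT \<omega>|M. iexp (Y \<omega>)) = complex_of_real (exp (- \<sigma>\<^sup>2 / 2))" .
    have i: "complex_integrable M (\<lambda>\<omega>. iexp (Y \<omega>))" by (rule integrable_iexp) simp_all
    show ?thesis
      using integral_Re[OF i] integral_Im[OF i] int unfolding ch var by (simp add: Re_exp Im_exp)
  qed
  then show "integrable M (\<lambda>\<omega>. (Y \<omega>)\<^sup>2)"
    "expectation (\<lambda>\<omega>. cos (Y \<omega>)) = exp (- expectation (\<lambda>\<omega>. (Y \<omega>)\<^sup>2) / 2)"
    "expectation (\<lambda>\<omega>. sin (Y \<omega>)) = 0" by auto
qed

text \<open>The characteristic function identifies the law by Levy's theorem, and normal moments are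
  finite. This form suits L2 limits of Gaussian variables, for which it is the characteristic
  function that passes to the limit.\<close>

lemma integrable_power_of_gaussian_char:
  fixes Y :: "'a \<Rightarrow> real" and v :: real
  assumes Y[measurable]: "Y \<in> borel_measurable M" and v: "v \<ge> 0"
    and ch: "\<And>u. expectation (\<lambda>\<omega>. cos (u * Y \<omega>)) = exp (- (u\<^sup>2 * v) / 2)"
      "\<And>u. expectation (\<lambda>\<omega>. sin (u * Y \<omega>)) = 0"
    and v0: "v = 0 \<Longrightarrow> AE \<omega> in M. Y \<omega> = 0"
  shows "integrable M (\<lambda>\<omega>. Y \<omega> ^ k)"
proof (cases "v = 0")
  case True
  have "integrable M (\<lambda>\<omega>. 0 ^ k :: real)" by simp
  then show ?thesis
    by (rule integrable_cong_AE[THEN iffD1, rotated 3]) (use v0[OF True] in \<open>auto elim!: eventually_mono\<close>)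
next
  case False
  define s where "s = sqrt v"
  have s: "s > 0" "s\<^sup>2 = v" using False v by (auto simp: s_def)
  have "distr M borel (\<lambda>\<omega>. Y \<omega> / s) = std_normal_distribution"
  proof (rule Levy_uniqueness[OF _ real_dist_normal_dist])
    show "real_distribution (distr M borel (\<lambda>\<omega>. Y \<omega> / s))" by simp
    have "char (distr M borel (\<lambda>\<omega>. Y \<omega> / s)) t = complex_of_real (exp (- t\<^sup>2 / 2))" for t
    proof -
      have i: "complex_integrable M (\<lambda>\<omega>. iexp (t / s * Y \<omega>))" by (rule integrable_iexp) simp_all
      have "char (distr M borel (\<lambda>\<omega>. Y \<omega> / s)) t = (CLINT \<omega>|M. iexp (t / s * Y \<omega>))"
        unfolding char_def by (subst integral_distr) auto
      also have "\<dots> = complex_of_real (exp (- t\<^sup>2 / 2))"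
        using integral_Re[OF i] integral_Im[OF i] ch[of "t / s"] s False
        by (intro complex_eqI) (simp_all add: Re_exp Im_exp power_divide)
      finally show ?thesis .
    qed
    then show "char (distr M borel (\<lambda>\<omega>. Y \<omega> / s)) = char std_normal_distribution"
      by (auto simp: char_std_normal_distribution)
  qed
  then have "integrable (distr M borel (\<lambda>\<omega>. Y \<omega> / s)) (\<lambda>x. x ^ k)"
    by (simp add: integrable_std_normal_distribution_moment)
  then have "integrable M (\<lambda>\<omega>. (Y \<omega> / s) ^ k)" by (subst (asm) integrable_distr_eq) auto
  then have "integrable M (\<lambda>\<omega>. s ^ k * (Y \<omega> / s) ^ k)" by (rule integrable_mult_right)
  then show ?thesis using s by (simp add: power_divide)
qed

end

text \<open>A normalised version of the process: regular at every sample point instead of almost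
  surely, and defined for all real times with value 0 before time 0. Pathwise lemmas then apply
  without exceptional sets.\<close>

locale fbm = prob_space M for M :: "'a measure" +
  fixes H :: real and B :: "real \<Rightarrow> 'a \<Rightarrow> real"
  assumes H: "1 / 2 < H" "H < 1"
    and B_meas[measurable]: "\<And>t. B t \<in> borel_measurable M"
    and B_path: "\<And>\<omega>. path0 (\<lambda>t. B t \<omega>)"
    and B_gauss: "\<And>(n::nat) c t. centered_gaussian_rv M (\<lambda>\<omega>. \<Sum>i<n. c i * B (t i) \<omega>)"
    and B_cov: "\<And>s t. 0 \<le> s \<Longrightarrow> 0 \<le> t \<Longrightarrow> expectation (\<lambda>\<omega>. B t \<omega> * B s \<omega>) =
        (t powr (2 * H) + s powr (2 * H) - \<bar>t - s\<bar> powr (2 * H)) / 2"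
begin

definition B_span :: "('a \<Rightarrow> real) set" where
  "B_span = {Y. \<exists>(n::nat) c t. Y = (\<lambda>\<omega>. \<Sum>i<n. c i * B (t i) \<omega>)}"

lemma span_gauss: "Y \<in> B_span \<Longrightarrow> centered_gaussian_rv M Y"
  using B_gauss by (auto simp: B_span_def)

lemma span_measurable: "Y \<in> B_span \<Longrightarrow> Y \<in> borel_measurable M"
  using span_gauss by (simp add: centered_gaussian_rv_def)

lemma span_lin:
  assumes "Y \<in> B_span" "Z \<in> B_span"
  shows "(\<lambda>\<omega>. a * Y \<omega> + b * Z \<omega>) \<in> B_span"
proof -
  from assms(1) obtain n :: nat and c t where Y: "Y = (\<lambda>\<omega>. \<Sum>i<n. c i * B (t i) \<omega>)" by (auto simp: B_span_def)
  from assms(2) obtain m :: nat and d r where Z: "Z = (\<lambda>\<omega>. \<Sum>i<m. d i * B (r i) \<omega>)" by (auto simp: B_span_def)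
  define e where "e i = (if i < n then a * c i else b * d (i - n))" for i
  define q where "q i = (if i < n then t i else r (i - n))" for i
  have "(\<Sum>i<n+m. e i * B (q i) \<omega>) = a * Y \<omega> + b * Z \<omega>" for \<omega>
  proof -
    have "(\<Sum>i<n+m. e i * B (q i) \<omega>) = (\<Sum>i<n. e i * B (q i) \<omega>) + (\<Sum>i=n..<n+m. e i * B (q i) \<omega>)"
      using sum.atLeastLessThan_concat[of 0 n "n + m" "\<lambda>i. e i * B (q i) \<omega>"] by (simp add: atLeast0LessThan)
    also have "(\<Sum>i<n. e i * B (q i) \<omega>) = a * Y \<omega>"
      unfolding Y sum_distrib_left by (intro sum.cong) (auto simp: e_def q_def)
    also have "(\<Sum>i=n..<n+m. e i * B (q i) \<omega>) = (\<Sum>i<m. e (i + n) * B (q (i + n)) \<omega>)"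
      using sum.shift_bounds_nat_ivl[of "\<lambda>i. e i * B (q i) \<omega>" 0 n m] by (simp add: atLeast0LessThan add.commute)
    also have "\<dots> = b * Z \<omega>"
      unfolding Z sum_distrib_left by (intro sum.cong) (auto simp: e_def q_def)
    finally show ?thesis .
  qed
  then have "(\<lambda>\<omega>. a * Y \<omega> + b * Z \<omega>) = (\<lambda>\<omega>. \<Sum>i<n+m. e i * B (q i) \<omega>)" by simp
  then show ?thesis unfolding B_span_def by blast
qed

lemma B_in_span: "B t \<in> B_span"
  unfolding B_span_def
  by (intro CollectI exI[of _ "1::nat"] exI[of _ "\<lambda>_. 1"] exI[of _ "\<lambda>_. t"]) simp

lemma span_square: "Y \<in> B_span \<Longrightarrow> integrable M (\<lambda>\<omega>. (Y \<omega>)\<^sup>2)"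
  by (rule centered_gaussian_trig(1)[OF span_gauss])

text \<open>The L2 closure of \<open>B_span\<close>, formulated by approximation and made of
  functions rather than classes, so that pathwise integrals of \<open>B\<close> can be members
  themselves.\<close>

definition chaos :: "('a \<Rightarrow> real) set" where
  "chaos = {Y. Y \<in> borel_measurable M \<and> integrable M (\<lambda>\<omega>. (Y \<omega>)\<^sup>2) \<and>
     (\<forall>e>0. \<exists>N\<in>B_span. expectation (\<lambda>\<omega>. (Y \<omega> - N \<omega>)\<^sup>2) < e)}"

lemma chaos_measurable[measurable_dest]: "Y \<in> chaos \<Longrightarrow> Y \<in> borel_measurable M"
  and chaos_square: "Y \<in> chaos \<Longrightarrow> integrable M (\<lambda>\<omega>. (Y \<omega>)\<^sup>2)"
  by (simp_all add: chaos_def)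

lemma span_chaos: "Y \<in> B_span \<Longrightarrow> Y \<in> chaos"
  by (auto simp: chaos_def span_square span_measurable intro!: bexI[of _ Y])

lemma square_lin_integrable:
  fixes Y Z :: "'a \<Rightarrow> real"
  assumes [measurable]: "Y \<in> borel_measurable M" "Z \<in> borel_measurable M"
    and "integrable M (\<lambda>\<omega>. (Y \<omega>)\<^sup>2)" "integrable M (\<lambda>\<omega>. (Z \<omega>)\<^sup>2)"
  shows "integrable M (\<lambda>\<omega>. (a * Y \<omega> + b * Z \<omega>)\<^sup>2)"
    and "expectation (\<lambda>\<omega>. (a * Y \<omega> + b * Z \<omega>)\<^sup>2) =
      a\<^sup>2 * expectation (\<lambda>\<omega>. (Y \<omega>)\<^sup>2) + 2 * a * b * expectation (\<lambda>\<omega>. Y \<omega> * Z \<omega>) + b\<^sup>2 * expectation (\<lambda>\<omega>. (Z \<omega>)\<^sup>2)"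
    and "expectation (\<lambda>\<omega>. (a * Y \<omega> + b * Z \<omega>)\<^sup>2) \<le>
      2 * a\<^sup>2 * expectation (\<lambda>\<omega>. (Y \<omega>)\<^sup>2) + 2 * b\<^sup>2 * expectation (\<lambda>\<omega>. (Z \<omega>)\<^sup>2)"
proof -
  have YZ: "integrable M (\<lambda>\<omega>. Y \<omega> * Z \<omega>)" using assms by (intro expectation_CS(1))
  have e: "(\<lambda>\<omega>. (a * Y \<omega> + b * Z \<omega>)\<^sup>2) = (\<lambda>\<omega>. a\<^sup>2 * (Y \<omega>)\<^sup>2 + 2 * a * b * (Y \<omega> * Z \<omega>) + b\<^sup>2 * (Z \<omega>)\<^sup>2)"
    by (auto simp: power2_eq_square algebra_simps)
  show i: "integrable M (\<lambda>\<omega>. (a * Y \<omega> + b * Z \<omega>)\<^sup>2)" unfolding e using assms YZ by simp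
  show "expectation (\<lambda>\<omega>. (a * Y \<omega> + b * Z \<omega>)\<^sup>2) =
      a\<^sup>2 * expectation (\<lambda>\<omega>. (Y \<omega>)\<^sup>2) + 2 * a * b * expectation (\<lambda>\<omega>. Y \<omega> * Z \<omega>) + b\<^sup>2 * expectation (\<lambda>\<omega>. (Z \<omega>)\<^sup>2)"
    unfolding e using assms YZ by simp
  have "expectation (\<lambda>\<omega>. (a * Y \<omega> + b * Z \<omega>)\<^sup>2) \<le> expectation (\<lambda>\<omega>. 2 * a\<^sup>2 * (Y \<omega>)\<^sup>2 + 2 * b\<^sup>2 * (Z \<omega>)\<^sup>2)"
  proof (rule integral_mono[OF i])
    fix \<omega>
    show "(a * Y \<omega> + b * Z \<omega>)\<^sup>2 \<le> 2 * a\<^sup>2 * (Y \<omega>)\<^sup>2 + 2 * b\<^sup>2 * (Z \<omega>)\<^sup>2"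
      using zero_le_power2[of "a * Y \<omega> - b * Z \<omega>"] by (simp add: power2_diff power2_sum power_mult_distrib)
  qed (use assms in simp)
  also have "\<dots> = 2 * a\<^sup>2 * expectation (\<lambda>\<omega>. (Y \<omega>)\<^sup>2) + 2 * b\<^sup>2 * expectation (\<lambda>\<omega>. (Z \<omega>)\<^sup>2)"
    using assms by simp
  finally show "expectation (\<lambda>\<omega>. (a * Y \<omega> + b * Z \<omega>)\<^sup>2) \<le>
      2 * a\<^sup>2 * expectation (\<lambda>\<omega>. (Y \<omega>)\<^sup>2) + 2 * b\<^sup>2 * expectation (\<lambda>\<omega>. (Z \<omega>)\<^sup>2)" .
qed

lemma chaos_closed:
  assumes Y: "Y \<in> borel_measurable M" "integrable M (\<lambda>\<omega>. (Y \<omega>)\<^sup>2)"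
    and app: "\<And>e. e > 0 \<Longrightarrow> \<exists>Z\<in>chaos. expectation (\<lambda>\<omega>. (Y \<omega> - Z \<omega>)\<^sup>2) < e"
  shows "Y \<in> chaos"
  unfolding chaos_def
proof (intro CollectI conjI Y allI impI)
  fix e :: real assume "e > 0"
  then have "e / 4 > 0" by simp
  from app[OF this] obtain Z where Z: "Z \<in> chaos" "expectation (\<lambda>\<omega>. (Y \<omega> - Z \<omega>)\<^sup>2) < e / 4" by blast
  from Z(1) \<open>e / 4 > 0\<close> obtain N where N: "N \<in> B_span" "expectation (\<lambda>\<omega>. (Z \<omega> - N \<omega>)\<^sup>2) < e / 4"
    unfolding chaos_def by blast
  note [measurable] = Y(1) chaos_measurable[OF Z(1)] span_measurable[OF N(1)]
  have 1: "integrable M (\<lambda>\<omega>. (Y \<omega> - Z \<omega>)\<^sup>2)"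
    using square_lin_integrable(1)[OF _ _ Y(2) chaos_square[OF Z(1)], of 1 "-1"] by simp
  have 2: "integrable M (\<lambda>\<omega>. (Z \<omega> - N \<omega>)\<^sup>2)"
    using square_lin_integrable(1)[OF _ _ chaos_square[OF Z(1)] span_square[OF N(1)], of 1 "-1"] by simp
  have "expectation (\<lambda>\<omega>. (1 * (Y \<omega> - Z \<omega>) + 1 * (Z \<omega> - N \<omega>))\<^sup>2) \<le>
      2 * 1\<^sup>2 * expectation (\<lambda>\<omega>. (Y \<omega> - Z \<omega>)\<^sup>2) + 2 * 1\<^sup>2 * expectation (\<lambda>\<omega>. (Z \<omega> - N \<omega>)\<^sup>2)"
    by (rule square_lin_integrable(3)[OF _ _ 1 2]) measurable
  then have "expectation (\<lambda>\<omega>. (Y \<omega> - N \<omega>)\<^sup>2) < e" using Z(2) N(2) by simp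
  with N(1) show "\<exists>N\<in>B_span. expectation (\<lambda>\<omega>. (Y \<omega> - N \<omega>)\<^sup>2) < e" by blast
qed

lemma chaos_lin:
  assumes Y: "Y \<in> chaos" and Z: "Z \<in> chaos"
  shows "(\<lambda>\<omega>. a * Y \<omega> + b * Z \<omega>) \<in> chaos"
proof (rule chaos_closed)
  note [measurable] = chaos_measurable[OF Y] chaos_measurable[OF Z]
  show "(\<lambda>\<omega>. a * Y \<omega> + b * Z \<omega>) \<in> borel_measurable M" by measurable
  show "integrable M (\<lambda>\<omega>. (a * Y \<omega> + b * Z \<omega>)\<^sup>2)"
    by (rule square_lin_integrable) (use chaos_square Y Z in auto)
  fix e :: real assume e: "e > 0"
  define d where "d = e / (2 * a\<^sup>2 + 2 * b\<^sup>2 + 1)"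
  have p: "2 * a\<^sup>2 + 2 * b\<^sup>2 + 1 > 0" by (simp add: add_nonneg_pos)
  have d: "d > 0" using e p by (simp add: d_def)
  obtain N where N: "N \<in> B_span" "expectation (\<lambda>\<omega>. (Y \<omega> - N \<omega>)\<^sup>2) < d" using Y d unfolding chaos_def by blast
  obtain L where L: "L \<in> B_span" "expectation (\<lambda>\<omega>. (Z \<omega> - L \<omega>)\<^sup>2) < d" using Z d unfolding chaos_def by blast
  note [measurable] = span_measurable[OF N(1)] span_measurable[OF L(1)]
  have 1: "integrable M (\<lambda>\<omega>. (Y \<omega> - N \<omega>)\<^sup>2)"
    using square_lin_integrable(1)[OF _ _ chaos_square[OF Y] span_square[OF N(1)], of 1 "-1"] by simp
  have 2: "integrable M (\<lambda>\<omega>. (Z \<omega> - L \<omega>)\<^sup>2)"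
    using square_lin_integrable(1)[OF _ _ chaos_square[OF Z] span_square[OF L(1)], of 1 "-1"] by simp
  have "expectation (\<lambda>\<omega>. (a * (Y \<omega> - N \<omega>) + b * (Z \<omega> - L \<omega>))\<^sup>2) \<le>
      2 * a\<^sup>2 * expectation (\<lambda>\<omega>. (Y \<omega> - N \<omega>)\<^sup>2) + 2 * b\<^sup>2 * expectation (\<lambda>\<omega>. (Z \<omega> - L \<omega>)\<^sup>2)"
    by (rule square_lin_integrable(3)[OF _ _ 1 2]) measurable
  also have "\<dots> \<le> 2 * a\<^sup>2 * d + 2 * b\<^sup>2 * d"
    using N(2) L(2) by (intro add_mono mult_left_mono) auto
  also have "\<dots> < (2 * a\<^sup>2 + 2 * b\<^sup>2 + 1) * d" using d by (simp add: algebra_simps)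
  also have "\<dots> = e" using p by (simp add: d_def)
  finally have "expectation (\<lambda>\<omega>. (a * (Y \<omega> - N \<omega>) + b * (Z \<omega> - L \<omega>))\<^sup>2) < e" .
  moreover have "(\<lambda>\<omega>. (a * (Y \<omega> - N \<omega>) + b * (Z \<omega> - L \<omega>))\<^sup>2) = (\<lambda>\<omega>. (a * Y \<omega> + b * Z \<omega> - (a * N \<omega> + b * L \<omega>))\<^sup>2)"
    by (auto simp: algebra_simps)
  ultimately show "\<exists>X\<in>chaos. expectation (\<lambda>\<omega>. (a * Y \<omega> + b * Z \<omega> - X \<omega>)\<^sup>2) < e"
    using span_chaos[OF span_lin[OF N(1) L(1), of a b]] by (intro bexI[of _ "\<lambda>\<omega>. a * N \<omega> + b * L \<omega>"]) simp_all
qed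

lemma chaos_scale: "Y \<in> chaos \<Longrightarrow> (\<lambda>\<omega>. a * Y \<omega>) \<in> chaos"
  using chaos_lin[of Y Y a 0] by simp

lemma chaos_diff: "Y \<in> chaos \<Longrightarrow> Z \<in> chaos \<Longrightarrow> (\<lambda>\<omega>. Y \<omega> - Z \<omega>) \<in> chaos"
  using chaos_lin[of Y Z 1 "-1"] by simp

text \<open>Cosine and sine are 1-Lipschitz and the second moments converge, so both sides of the
  Gaussian formulas pass from \<open>B_span\<close> to the L2 limit.\<close>

lemma chaos_trig:
  assumes Y: "Y \<in> chaos"
  shows "expectation (\<lambda>\<omega>. cos (Y \<omega>)) = exp (- expectation (\<lambda>\<omega>. (Y \<omega>)\<^sup>2) / 2)"
    and "expectation (\<lambda>\<omega>. sin (Y \<omega>)) = 0"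
proof -
  have "\<exists>N\<in>B_span. expectation (\<lambda>\<omega>. (Y \<omega> - N \<omega>)\<^sup>2) < 1 / real (Suc n)" for n
    using Y unfolding chaos_def by simp
  then obtain N where N: "\<And>n. N n \<in> B_span" "\<And>n. expectation (\<lambda>\<omega>. (Y \<omega> - N n \<omega>)\<^sup>2) < 1 / real (Suc n)"
    by metis
  note [measurable] = chaos_measurable[OF Y] span_measurable[OF N(1)]
  have sq: "integrable M (\<lambda>\<omega>. (Y \<omega> - N n \<omega>)\<^sup>2)" for n
    using square_lin_integrable(1)[OF _ _ chaos_square[OF Y] span_square[OF N(1)[of n]], of 1 "-1"] by simp
  have lim: "(\<lambda>n. expectation (\<lambda>\<omega>. (Y \<omega> - N n \<omega>)\<^sup>2)) \<longlonglongrightarrow> 0"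
  proof (rule tendsto_sandwich[OF _ _ tendsto_const])
    show "(\<lambda>n. 1 / real (Suc n)) \<longlonglongrightarrow> 0" by (rule lim_1_over_n[THEN LIMSEQ_Suc])
  qed (use N(2) in \<open>auto intro!: always_eventually less_imp_le\<close>)
  have lim2: "(\<lambda>n. sqrt (expectation (\<lambda>\<omega>. (Y \<omega> - N n \<omega>)\<^sup>2))) \<longlonglongrightarrow> 0"
    using tendsto_real_sqrt[OF lim] by simp
  have L: "(\<lambda>n. expectation (\<lambda>\<omega>. g (N n \<omega>))) \<longlonglongrightarrow> expectation (\<lambda>\<omega>. g (Y \<omega>))"
    if g: "\<And>x y. \<bar>g x - g y\<bar> \<le> \<bar>x - y\<bar>" "\<And>x. \<bar>g x\<bar> \<le> 1" "g \<in> borel_measurable borel" for g :: "real \<Rightarrow> real"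
  proof -
    note [measurable] = g(3)
    have i: "integrable M (\<lambda>\<omega>. g (N n \<omega>))" "integrable M (\<lambda>\<omega>. g (Y \<omega>))" for n
      using g(2) by (auto intro!: integrable_const_bound[where B = 1])
    have "\<bar>expectation (\<lambda>\<omega>. g (N n \<omega>)) - expectation (\<lambda>\<omega>. g (Y \<omega>))\<bar> \<le> sqrt (expectation (\<lambda>\<omega>. (Y \<omega> - N n \<omega>)\<^sup>2))" for n
    proof -
      have d: "integrable M (\<lambda>\<omega>. Y \<omega> - N n \<omega>)" by (rule integrable_of_square[OF _ sq]) measurable
      have "\<bar>expectation (\<lambda>\<omega>. g (N n \<omega>)) - expectation (\<lambda>\<omega>. g (Y \<omega>))\<bar> = \<bar>expectation (\<lambda>\<omega>. g (N n \<omega>) - g (Y \<omega>))\<bar>"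
        using i by simp
      also have "\<dots> \<le> expectation (\<lambda>\<omega>. \<bar>g (N n \<omega>) - g (Y \<omega>)\<bar>)" by (rule integral_abs_bound)
      also have "\<dots> \<le> expectation (\<lambda>\<omega>. \<bar>Y \<omega> - N n \<omega>\<bar>)"
        using i d g(1) by (intro integral_mono) (auto simp: abs_minus_commute)
      also have "\<dots> \<le> sqrt (expectation (\<lambda>\<omega>. (Y \<omega> - N n \<omega>)\<^sup>2))"
        by (rule expectation_abs_le[OF _ sq]) measurable
      finally show ?thesis .
    qed
    then have "(\<lambda>n. \<bar>expectation (\<lambda>\<omega>. g (N n \<omega>)) - expectation (\<lambda>\<omega>. g (Y \<omega>))\<bar>) \<longlonglongrightarrow> 0"
      by (intro tendsto_sandwich[OF _ _ tendsto_const lim2]) (auto intro!: always_eventually)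
    then show ?thesis by (simp add: tendsto_rabs_zero_iff LIM_zero_iff)
  qed
  have V: "(\<lambda>n. expectation (\<lambda>\<omega>. (N n \<omega>)\<^sup>2)) \<longlonglongrightarrow> expectation (\<lambda>\<omega>. (Y \<omega>)\<^sup>2)"
  proof -
    let ?d = "\<lambda>n. expectation (\<lambda>\<omega>. (Y \<omega> - N n \<omega>)\<^sup>2)"
    have "\<bar>expectation (\<lambda>\<omega>. (N n \<omega>)\<^sup>2) - expectation (\<lambda>\<omega>. (Y \<omega>)\<^sup>2)\<bar> \<le> 2 * (sqrt (expectation (\<lambda>\<omega>. (Y \<omega>)\<^sup>2)) * sqrt (?d n)) + ?d n" for n
    proof -
      let ?c = "expectation (\<lambda>\<omega>. Y \<omega> * (Y \<omega> - N n \<omega>))"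
      have q: "expectation (\<lambda>\<omega>. (1 * Y \<omega> + (- 1) * (Y \<omega> - N n \<omega>))\<^sup>2) =
        1\<^sup>2 * expectation (\<lambda>\<omega>. (Y \<omega>)\<^sup>2) + 2 * 1 * (- 1) * ?c + (- 1)\<^sup>2 * ?d n"
        by (rule square_lin_integrable(2)[OF _ _ chaos_square[OF Y] sq]) measurable
      have "?c\<^sup>2 \<le> expectation (\<lambda>\<omega>. (Y \<omega>)\<^sup>2) * ?d n"
        by (rule expectation_CS(2)[OF _ _ chaos_square[OF Y] sq]) measurable
      then have c: "\<bar>?c\<bar> \<le> sqrt (expectation (\<lambda>\<omega>. (Y \<omega>)\<^sup>2)) * sqrt (?d n)"
        unfolding real_sqrt_mult[symmetric] by (rule real_le_rsqrt[of "\<bar>?c\<bar>", simplified])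
      have d: "?d n \<ge> 0" by simp
      have "expectation (\<lambda>\<omega>. (N n \<omega>)\<^sup>2) = expectation (\<lambda>\<omega>. (Y \<omega>)\<^sup>2) - 2 * ?c + ?d n"
        using q by simp
      with c d show ?thesis by linarith
    qed
    note bnd = this
    have "(\<lambda>n. 2 * (sqrt (expectation (\<lambda>\<omega>. (Y \<omega>)\<^sup>2)) * sqrt (?d n)) + ?d n) \<longlonglongrightarrow> 2 * (sqrt (expectation (\<lambda>\<omega>. (Y \<omega>)\<^sup>2)) * 0) + 0"
      by (intro tendsto_add tendsto_mult tendsto_const lim lim2)
    then have l0: "(\<lambda>n. 2 * (sqrt (expectation (\<lambda>\<omega>. (Y \<omega>)\<^sup>2)) * sqrt (?d n)) + ?d n) \<longlonglongrightarrow> 0" by simp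
    have "(\<lambda>n. \<bar>expectation (\<lambda>\<omega>. (N n \<omega>)\<^sup>2) - expectation (\<lambda>\<omega>. (Y \<omega>)\<^sup>2)\<bar>) \<longlonglongrightarrow> 0"
      by (rule tendsto_sandwich[OF _ _ tendsto_const l0]; intro always_eventually allI bnd abs_ge_zero)
    then show ?thesis by (simp add: tendsto_rabs_zero_iff LIM_zero_iff)
  qed
  have "(\<lambda>n. exp (- expectation (\<lambda>\<omega>. (N n \<omega>)\<^sup>2) / 2)) \<longlonglongrightarrow> exp (- expectation (\<lambda>\<omega>. (Y \<omega>)\<^sup>2) / 2)"
    by (intro tendsto_intros V) simp
  moreover have "(\<lambda>n. exp (- expectation (\<lambda>\<omega>. (N n \<omega>)\<^sup>2) / 2)) \<longlonglongrightarrow> expectation (\<lambda>\<omega>. cos (Y \<omega>))"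
    using L[of cos] centered_gaussian_trig(2)[OF span_gauss[OF N(1)]] cos_lipschitz by simp
  ultimately show "expectation (\<lambda>\<omega>. cos (Y \<omega>)) = exp (- expectation (\<lambda>\<omega>. (Y \<omega>)\<^sup>2) / 2)"
    using LIMSEQ_unique by blast
  have "(\<lambda>n. 0) \<longlonglongrightarrow> expectation (\<lambda>\<omega>. sin (Y \<omega>))"
    using L[of sin] centered_gaussian_trig(3)[OF span_gauss[OF N(1)]] sin_lipschitz by simp
  then show "expectation (\<lambda>\<omega>. sin (Y \<omega>)) = 0" using LIMSEQ_unique[OF tendsto_const] by metis
qed

lemma chaos_power_integrable:
  assumes Y: "Y \<in> chaos"
  shows "integrable M (\<lambda>\<omega>. Y \<omega> ^ k)"
proof (rule integrable_power_of_gaussian_char)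
  let ?v = "expectation (\<lambda>\<omega>. (Y \<omega>)\<^sup>2)"
  show "Y \<in> borel_measurable M" by (rule chaos_measurable[OF Y])
  show "?v \<ge> 0" by simp
  show "expectation (\<lambda>\<omega>. cos (u * Y \<omega>)) = exp (- (u\<^sup>2 * ?v) / 2)" for u
    using chaos_trig(1)[OF chaos_scale[OF Y, of u]] by (simp add: power_mult_distrib)
  show "expectation (\<lambda>\<omega>. sin (u * Y \<omega>)) = 0" for u
    by (rule chaos_trig(2)[OF chaos_scale[OF Y]])
  show "AE \<omega> in M. Y \<omega> = 0" if "?v = 0"
    using integral_nonneg_eq_0_iff_AE[OF chaos_square[OF Y]] that by simp
qed

lemma chaos_integrable: "Y \<in> chaos \<Longrightarrow> integrable M Y"
  using chaos_power_integrable[of Y 1] by simp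

lemma chaos_prod_integrable: "Y \<in> chaos \<Longrightarrow> Z \<in> chaos \<Longrightarrow> integrable M (\<lambda>\<omega>. Y \<omega> * Z \<omega>)"
  by (intro expectation_CS chaos_square chaos_measurable)

lemma chaos_square_prod_integrable:
  assumes "Y \<in> chaos" "Z \<in> chaos"
  shows "integrable M (\<lambda>\<omega>. (Y \<omega>)\<^sup>2 * (Z \<omega>)\<^sup>2)"
  using chaos_power_integrable[OF assms(1), of 4] chaos_power_integrable[OF assms(2), of 4] chaos_measurable[OF assms(1)] chaos_measurable[OF assms(2)]
  by (intro expectation_CS) (simp_all flip: power_mult)

end

text \<open>The error of a one-point quadrature rule, written as the primitive of a path that starts
  at 0, so that second-moment bounds for primitives apply to it.\<close>

lemma prim_increment:
  assumes f: "path0 f" and h: "h \<ge> 0"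
  shows "prim f (a + h) - prim f a - h * f a = prim (\<lambda>u. f (a + max 0 u) - f a) h"
proof -
  have "((\<lambda>u. f (a + u) - f a) has_integral ((prim f (a + h) - h * f a) - (prim f (a + 0) - 0 * f a))) {0..h}"
  proof (rule fundamental_theorem_of_calculus[OF h])
    fix u
    have "((\<lambda>u. prim f (a + u) - u * f a) has_real_derivative f (a + u) * 1 - f a) (at u)"
      by (intro DERIV_diff DERIV_chain2[where f = "prim f" and g = "\<lambda>u. a + u"] prim_has_derivative f)
         (auto intro!: derivative_eq_intros)
    then show "((\<lambda>u. prim f (a + u) - u * f a) has_vector_derivative f (a + u) - f a) (at u within {0..h})"
      by (simp add: has_real_derivative_iff_has_vector_derivative has_vector_derivative_at_within)
  qed
  then have "integral {0..h} (\<lambda>u. f (a + u) - f a) = prim f (a + h) - prim f a - h * f a"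
    by (simp add: integral_unique)
  moreover have "prim (\<lambda>u. f (a + max 0 u) - f a) h = integral {0..h} (\<lambda>u. f (a + u) - f a)"
    unfolding prim_def by (intro integral_cong) auto
  ultimately show ?thesis by simp
qed

lemma path0_shift:
  assumes "path0 f"
  shows "path0 (\<lambda>u. f (a + max 0 u) - f a)"
proof -
  have "continuous_on UNIV (\<lambda>u. f (a + max 0 u))"
    by (rule continuous_on_compose2[OF path0_continuous_on[OF assms, of UNIV]]) (auto intro!: continuous_intros)
  then show ?thesis by (auto simp: path0_def intro!: continuous_intros)
qed

lemma path0_square: "path0 f \<Longrightarrow> path0 (\<lambda>u. (f u)\<^sup>2)"
  by (auto simp: path0_def intro!: continuous_intros)

lemma prim_cmult: "prim (\<lambda>s. c * f s) t = c * prim f t" for c :: real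
  by (simp add: prim_def)

lemma prim_nonneg_mono:
  assumes "path0 f" "\<And>s. f s \<ge> 0" "s \<le> t"
  shows "prim f s \<le> prim f t"
  by (rule DERIV_nonneg_imp_nondecreasing[OF assms(3)]) (use prim_has_derivative[OF assms(1)] assms(2) in blast)

section \<open>Second moments of time integrals\<close>

context prob_space
begin

text \<open>Cauchy-Schwarz in time along each path, then Fubini.\<close>

lemma prim_square_expectation:
  assumes meas: "\<And>s. f s \<in> borel_measurable M" and p: "\<And>\<omega>. path0 (\<lambda>s. f s \<omega>)"
    and int: "\<And>s. s \<in> {0..t} \<Longrightarrow> integrable M (\<lambda>\<omega>. (f s \<omega>)\<^sup>2)"
    and bnd: "\<And>s. s \<in> {0..t} \<Longrightarrow> expectation (\<lambda>\<omega>. (f s \<omega>)\<^sup>2) \<le> K" and t: "t \<ge> 0"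
  shows "(\<lambda>\<omega>. prim (\<lambda>s. f s \<omega>) t) \<in> borel_measurable M"
    and "integrable M (\<lambda>\<omega>. (prim (\<lambda>s. f s \<omega>) t)\<^sup>2)"
    and "expectation (\<lambda>\<omega>. (prim (\<lambda>s. f s \<omega>) t)\<^sup>2) \<le> t * (t * K)"
proof -
  have c: "continuous_on UNIV (\<lambda>s. f s \<omega>)" for \<omega> by (rule path0_continuous_on[OF p])
  have "integrable M (\<lambda>\<omega>. prim (\<lambda>s. f s \<omega>) t)"
  proof (rule expectation_prim(1)[OF meas c])
    fix s assume s: "s \<in> {0..t}"
    show "integrable M (f s)" by (rule integrable_of_square(1)[OF meas int[OF s]])
    show "expectation (\<lambda>\<omega>. \<bar>f s \<omega>\<bar>) \<le> sqrt K"
      by (rule order_trans[OF expectation_abs_le[OF meas int[OF s]]]) (use bnd[OF s] in simp)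
  qed
  then show m: "(\<lambda>\<omega>. prim (\<lambda>s. f s \<omega>) t) \<in> borel_measurable M" by simp
  note 2 = expectation_prim[where f = "\<lambda>s \<omega>. (f s \<omega>)\<^sup>2" and t = t and K = K]
  have 1: "integrable M (\<lambda>\<omega>. prim (\<lambda>s. (f s \<omega>)\<^sup>2) t)"
    and 3: "expectation (\<lambda>\<omega>. prim (\<lambda>s. (f s \<omega>)\<^sup>2) t) = prim (\<lambda>s. expectation (\<lambda>\<omega>. (f s \<omega>)\<^sup>2)) t"
    and 4: "(\<lambda>s. expectation (\<lambda>\<omega>. (f s \<omega>)\<^sup>2)) integrable_on {0..t}"
    using meas int bnd by (auto intro!: 2 continuous_intros c)
  have le: "(prim (\<lambda>s. f s \<omega>) t)\<^sup>2 \<le> t * prim (\<lambda>s. (f s \<omega>)\<^sup>2) t" for \<omega>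
    by (rule prim_square_le[OF p t])
  show i: "integrable M (\<lambda>\<omega>. (prim (\<lambda>s. f s \<omega>) t)\<^sup>2)"
  proof (rule Bochner_Integration.integrable_bound)
    show "integrable M (\<lambda>\<omega>. t * prim (\<lambda>s. (f s \<omega>)\<^sup>2) t)" using 1 by simp
    show "AE \<omega> in M. norm ((prim (\<lambda>s. f s \<omega>) t)\<^sup>2) \<le> norm (t * prim (\<lambda>s. (f s \<omega>)\<^sup>2) t)"
      using le by (intro AE_I2) (metis abs_ge_self abs_of_nonneg order_trans real_norm_def zero_le_power2)
  qed (use m in measurable)
  have "expectation (\<lambda>\<omega>. (prim (\<lambda>s. f s \<omega>) t)\<^sup>2) \<le> expectation (\<lambda>\<omega>. t * prim (\<lambda>s. (f s \<omega>)\<^sup>2) t)"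
    using 1 le by (intro integral_mono i) auto
  also have "\<dots> = t * prim (\<lambda>s. expectation (\<lambda>\<omega>. (f s \<omega>)\<^sup>2)) t" using 3 by simp
  also have "\<dots> \<le> t * integral {0..t} (\<lambda>_. K)"
    unfolding prim_def by (intro mult_left_mono t integral_le 4 bnd) auto
  also have "\<dots> = t * (t * K)" using t by simp
  finally show "expectation (\<lambda>\<omega>. (prim (\<lambda>s. f s \<omega>) t)\<^sup>2) \<le> t * (t * K)" .
qed

end

text \<open>Fubini with a random weight; |W f| \<le> W^2 + f^2 supplies the uniform bound on first
  moments.\<close>

lemma (in prob_space) expectation_mult_prim:
  fixes f :: "real \<Rightarrow> 'a \<Rightarrow> real"
  assumes W: "W \<in> borel_measurable M" "integrable M (\<lambda>\<omega>. (W \<omega>)\<^sup>2)"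
    and meas: "\<And>s. f s \<in> borel_measurable M" and p: "\<And>\<omega>. path0 (\<lambda>s. f s \<omega>)"
    and int: "\<And>s. integrable M (\<lambda>\<omega>. (f s \<omega>)\<^sup>2)"
    and bnd: "\<And>s. s \<in> {0..t} \<Longrightarrow> expectation (\<lambda>\<omega>. (f s \<omega>)\<^sup>2) \<le> K"
  shows "expectation (\<lambda>\<omega>. W \<omega> * prim (\<lambda>s. f s \<omega>) t) = prim (\<lambda>s. expectation (\<lambda>\<omega>. W \<omega> * f s \<omega>)) t"
    and "(\<lambda>s. expectation (\<lambda>\<omega>. W \<omega> * f s \<omega>)) integrable_on {0..t}"
proof -
  note [measurable] = W(1) meas
  have i: "integrable M (\<lambda>\<omega>. W \<omega> * f s \<omega>)" for s by (rule expectation_CS(1)[OF W(1) meas W(2) int])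
  have b: "expectation (\<lambda>\<omega>. \<bar>W \<omega> * f s \<omega>\<bar>) \<le> expectation (\<lambda>\<omega>. (W \<omega>)\<^sup>2) + K" if s: "s \<in> {0..t}" for s
  proof -
    have "expectation (\<lambda>\<omega>. \<bar>W \<omega> * f s \<omega>\<bar>) \<le> expectation (\<lambda>\<omega>. (W \<omega>)\<^sup>2 + (f s \<omega>)\<^sup>2)"
    proof (rule integral_mono)
      show "integrable M (\<lambda>\<omega>. \<bar>W \<omega> * f s \<omega>\<bar>)" by (intro integrable_abs i)
      show "integrable M (\<lambda>\<omega>. (W \<omega>)\<^sup>2 + (f s \<omega>)\<^sup>2)"
        by (intro Bochner_Integration.integrable_add W int)
      show "\<bar>W \<omega> * f s \<omega>\<bar> \<le> (W \<omega>)\<^sup>2 + (f s \<omega>)\<^sup>2" for \<omega>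
      proof -
        have "2 * (\<bar>W \<omega>\<bar> * \<bar>f s \<omega>\<bar>) \<le> (W \<omega>)\<^sup>2 + (f s \<omega>)\<^sup>2"
          using zero_le_power2[of "\<bar>W \<omega>\<bar> - \<bar>f s \<omega>\<bar>"] by (simp add: power2_diff)
        moreover have "0 \<le> \<bar>W \<omega>\<bar> * \<bar>f s \<omega>\<bar>" by simp
        ultimately show ?thesis unfolding abs_mult[of "W \<omega>"] by linarith
      qed
    qed
    also have "\<dots> = expectation (\<lambda>\<omega>. (W \<omega>)\<^sup>2) + expectation (\<lambda>\<omega>. (f s \<omega>)\<^sup>2)"
      by (intro Bochner_Integration.integral_add W int)
    finally show ?thesis using bnd[OF s] by simp
  qed
  have c: "continuous_on UNIV (\<lambda>s. W \<omega> * f s \<omega>)" for \<omega>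
    by (intro continuous_on_mult continuous_on_const path0_continuous_on[OF p])
  have m: "(\<lambda>\<omega>. W \<omega> * f s \<omega>) \<in> borel_measurable M" for s by measurable
  note E = expectation_prim[of "\<lambda>s \<omega>. W \<omega> * f s \<omega>" t, OF m c i b]
  show "expectation (\<lambda>\<omega>. W \<omega> * prim (\<lambda>s. f s \<omega>) t) = prim (\<lambda>s. expectation (\<lambda>\<omega>. W \<omega> * f s \<omega>)) t"
    using E(2) by (simp only: prim_cmult)
  show "(\<lambda>s. expectation (\<lambda>\<omega>. W \<omega> * f s \<omega>)) integrable_on {0..t}" by (rule E(3))
qed

section \<open>Time integrals in the chaos, covariance paths, the one-stage process\<close>

context fbm
begin

lemma chaos_sum: "(\<And>j. j < n \<Longrightarrow> f j \<in> chaos) \<Longrightarrow> (\<lambda>\<omega>. \<Sum>j<n. f j \<omega>) \<in> chaos" for n :: nat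
proof (induction n)
  case 0
  have "(\<lambda>\<omega>. 0 * B 0 \<omega>) \<in> chaos" by (rule chaos_scale[OF span_chaos[OF B_in_span]])
  then show ?case by simp
next
  case (Suc n)
  have "(\<lambda>\<omega>. 1 * (\<Sum>j<n. f j \<omega>) + 1 * f n \<omega>) \<in> chaos"
    using Suc by (intro chaos_lin) auto
  then show ?case by simp
qed

text \<open>Riemann sums lie in the chaos, and uniform continuity in mean square makes their error
  small in L2.\<close>

lemma prim_chaos:
  assumes fG: "\<And>s. f s \<in> chaos" and p: "\<And>\<omega>. path0 (\<lambda>s. f s \<omega>)"
    and modulus: "\<And>e. e > 0 \<Longrightarrow> \<exists>d>0. \<forall>s\<in>{0..t}. \<forall>r\<in>{0..t}. \<bar>s - r\<bar> \<le> d \<longrightarrow> expectation (\<lambda>\<omega>. (f s \<omega> - f r \<omega>)\<^sup>2) \<le> e"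
    and bnd: "\<And>s. s \<in> {0..t} \<Longrightarrow> expectation (\<lambda>\<omega>. (f s \<omega>)\<^sup>2) \<le> K"
  shows "(\<lambda>\<omega>. prim (\<lambda>s. f s \<omega>) t) \<in> chaos"
proof (cases "t \<le> 0")
  case True
  have "(\<lambda>\<omega>. 0 * B 0 \<omega>) \<in> chaos" by (rule chaos_scale[OF span_chaos[OF B_in_span]])
  then show ?thesis using True by (simp add: prim_nonpos)
next
  case False
  then have t: "t > 0" by simp
  have meas: "f s \<in> borel_measurable M" for s by (rule chaos_measurable[OF fG])
  note sq = prim_square_expectation[OF meas p chaos_square[OF fG] bnd less_imp_le[OF t]]
  show ?thesis
  proof (rule chaos_closed[OF sq(1,2)])
    fix e :: real assume e: "e > 0"
    \<comment> \<open>With n blocks of length h = t / n, each block error has second moment at most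
      h^2 e / (2 t^2). Squaring the sum of the n errors costs another factor n, so the total is at
      most e / 2.\<close>
    then have "e / (2 * t\<^sup>2) > 0" using t by simp
    from modulus[OF this] obtain d where d: "d > 0"
      "\<And>s r. s \<in> {0..t} \<Longrightarrow> r \<in> {0..t} \<Longrightarrow> \<bar>s - r\<bar> \<le> d \<Longrightarrow> expectation (\<lambda>\<omega>. (f s \<omega> - f r \<omega>)\<^sup>2) \<le> e / (2 * t\<^sup>2)"
      by blast
    obtain n :: nat where n: "t / d < real n" using reals_Archimedean2 by blast
    have n0: "real n > 0" by (rule le_less_trans[OF _ n]) (use t d in simp)
    define h where "h = t / real n"
    have h: "h > 0" "h \<le> d" "real n * h = t" using n n0 t d by (simp_all add: h_def field_simps)
    define D where "D j \<omega> = prim (\<lambda>u. f (real j * h + max 0 u) \<omega> - f (real j * h) \<omega>) h" for j \<omega>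
    have jr: "real j * h + max 0 u \<in> {0..t}" "real j * h \<in> {0..t}" if "j < n" "u \<in> {0..h}" for j u
    proof -
      have "real j + 1 \<le> real n" using that by simp
      from mult_right_mono[OF this, of h] h have "real j * h + h \<le> t" by (simp add: algebra_simps)
      then show "real j * h + max 0 u \<in> {0..t}" "real j * h \<in> {0..t}"
        using that h by auto
    qed
    have Dq: "(\<lambda>\<omega>. D j \<omega>) \<in> borel_measurable M \<and> integrable M (\<lambda>\<omega>. (D j \<omega>)\<^sup>2) \<and>
        expectation (\<lambda>\<omega>. (D j \<omega>)\<^sup>2) \<le> h * (h * (e / (2 * t\<^sup>2)))" if j: "j < n" for j
    proof -
      let ?w = "\<lambda>u \<omega>. f (real j * h + max 0 u) \<omega> - f (real j * h) \<omega>"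
      have w1: "?w u \<in> borel_measurable M" for u using meas by simp
      have w2: "path0 (\<lambda>u. ?w u \<omega>)" for \<omega> by (rule path0_shift[OF p])
      have w3: "integrable M (\<lambda>\<omega>. (?w u \<omega>)\<^sup>2)" for u by (rule chaos_square[OF chaos_diff[OF fG fG]])
      have w4: "expectation (\<lambda>\<omega>. (?w u \<omega>)\<^sup>2) \<le> e / (2 * t\<^sup>2)" if "u \<in> {0..h}" for u
      proof (rule d(2))
        show "real j * h + max 0 u \<in> {0..t}" "real j * h \<in> {0..t}" by (rule jr[OF j that])+
        show "\<bar>real j * h + max 0 u - real j * h\<bar> \<le> d" using that h by simp
      qed
      note * = prim_square_expectation[of ?w h "e / (2 * t\<^sup>2)", OF w1 w2 w3 w4 less_imp_le[OF h(1)]]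
      show ?thesis unfolding D_def by (intro conjI *)
    qed
    let ?Z = "\<lambda>\<omega>. \<Sum>j<n. h * f (real j * h) \<omega>"
    have Z: "?Z \<in> chaos" by (intro chaos_sum chaos_scale fG)
    have diff: "prim (\<lambda>s. f s \<omega>) t - ?Z \<omega> = (\<Sum>j<n. D j \<omega>)" for \<omega>
    proof -
      have "(\<Sum>j<n. D j \<omega>) = (\<Sum>j<n. (prim (\<lambda>s. f s \<omega>) (real (Suc j) * h) - prim (\<lambda>s. f s \<omega>) (real j * h)) - h * f (real j * h) \<omega>)"
        unfolding D_def using h by (intro sum.cong refl, subst prim_increment[OF p, symmetric]) (auto simp: algebra_simps)
      also have "\<dots> = (\<Sum>j<n. prim (\<lambda>s. f s \<omega>) (real (Suc j) * h) - prim (\<lambda>s. f s \<omega>) (real j * h)) - ?Z \<omega>"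
        by (rule sum_subtractf)
      also have "(\<Sum>j<n. prim (\<lambda>s. f s \<omega>) (real (Suc j) * h) - prim (\<lambda>s. f s \<omega>) (real j * h)) = prim (\<lambda>s. f s \<omega>) t"
        using sum_lessThan_telescope[of "\<lambda>j. prim (\<lambda>s. f s \<omega>) (real j * h)" n] h(3) by (simp add: prim_nonpos)
      finally show ?thesis by simp
    qed
    have "expectation (\<lambda>\<omega>. (prim (\<lambda>s. f s \<omega>) t - ?Z \<omega>)\<^sup>2) \<le> expectation (\<lambda>\<omega>. (\<Sum>j<n. (D j \<omega>)\<^sup>2) * real n)"
    proof (rule integral_mono)
      have [measurable]: "(\<lambda>\<omega>. prim (\<lambda>s. f s \<omega>) t) \<in> borel_measurable M" by (rule sq(1))
      have [measurable]: "?Z \<in> borel_measurable M" by (rule chaos_measurable[OF Z])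
      show "integrable M (\<lambda>\<omega>. (prim (\<lambda>s. f s \<omega>) t - ?Z \<omega>)\<^sup>2)"
        using square_lin_integrable(1)[OF _ _ sq(2) chaos_square[OF Z], of 1 "-1"] by simp
      show "integrable M (\<lambda>\<omega>. (\<Sum>j<n. (D j \<omega>)\<^sup>2) * real n)"
        by (intro integrable_mult_left Bochner_Integration.integrable_sum) (use Dq in auto)
      show "(prim (\<lambda>s. f s \<omega>) t - ?Z \<omega>)\<^sup>2 \<le> (\<Sum>j<n. (D j \<omega>)\<^sup>2) * real n" for \<omega>
        unfolding diff using sum_squared_le_sum_of_squares[of "\<lambda>j. D j \<omega>" "{..<n}"] by simp
    qed
    also have "\<dots> = (\<Sum>j<n. expectation (\<lambda>\<omega>. (D j \<omega>)\<^sup>2)) * real n" using Dq by simp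
    also have "\<dots> \<le> (\<Sum>j<n. h * (h * (e / (2 * t\<^sup>2)))) * real n"
      using Dq by (intro mult_right_mono sum_mono) auto
    also have "\<dots> = (real n * h)\<^sup>2 * (e / (2 * t\<^sup>2))" by (simp add: power2_eq_square)
    also have "\<dots> < e" using t e unfolding h(3) by simp
    finally show "\<exists>Z\<in>chaos. expectation (\<lambda>\<omega>. (prim (\<lambda>s. f s \<omega>) t - Z \<omega>)\<^sup>2) < e" by (rule bexI[OF _ Z])
  qed
qed

lemma B_max: "B t = B (max 0 t)"
  using B_path by (cases "t \<le> 0") (auto simp: path0_def)

lemma B_square: "0 \<le> t \<Longrightarrow> expectation (\<lambda>\<omega>. (B t \<omega>)\<^sup>2) = t powr (2 * H)"
  using B_cov[of t t] by (simp add: power2_eq_square)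

lemma B_scaled_increment:
  assumes "0 \<le> s" "0 \<le> t"
  shows "expectation (\<lambda>\<omega>. (a * B t \<omega> - b * B s \<omega>)\<^sup>2) = a\<^sup>2 * t powr (2 * H)
     - a * b * (t powr (2 * H) + s powr (2 * H) - \<bar>t - s\<bar> powr (2 * H)) + b\<^sup>2 * s powr (2 * H)"
  using square_lin_integrable(2)[OF B_meas[of t] B_meas[of s] span_square[OF B_in_span] span_square[OF B_in_span], of a "-b"] assms
  unfolding B_cov[OF assms] by (simp add: B_square field_simps)

lemma B_increment: "expectation (\<lambda>\<omega>. (B t \<omega> - B s \<omega>)\<^sup>2) \<le> \<bar>t - s\<bar> powr (2 * H)"
proof -
  have "expectation (\<lambda>\<omega>. (B (max 0 t) \<omega> - B (max 0 s) \<omega>)\<^sup>2) = \<bar>max 0 t - max 0 s\<bar> powr (2 * H)"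
    using B_scaled_increment[of "max 0 s" "max 0 t" 1 1] by simp
  also have "\<dots> \<le> \<bar>t - s\<bar> powr (2 * H)"
    using H by (intro powr_mono2) auto
  finally show ?thesis by (simp flip: B_max)
qed

text \<open>The covariance of two increments is half a four-point difference of |x|^(2 H),
  nonnegative by convexity.\<close>

lemma B_increments_nonneg:
  assumes "u \<le> u'" "v \<le> v'"
  shows "expectation (\<lambda>\<omega>. (B u' \<omega> - B u \<omega>) * (B v' \<omega> - B v \<omega>)) \<ge> 0"
proof -
  have *: "expectation (\<lambda>\<omega>. (B u' \<omega> - B u \<omega>) * (B v' \<omega> - B v \<omega>)) \<ge> 0"
    if "0 \<le> u" "u \<le> u'" "0 \<le> v" "v \<le> v'" for u u' v v'
  proof -
    have i: "integrable M (\<lambda>\<omega>. B s \<omega> * B t \<omega>)" for s t by (intro chaos_prod_integrable span_chaos B_in_span)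
    have e: "(\<lambda>\<omega>. (B u' \<omega> - B u \<omega>) * (B v' \<omega> - B v \<omega>)) =
        (\<lambda>\<omega>. B u' \<omega> * B v' \<omega> - B u' \<omega> * B v \<omega> - B u \<omega> * B v' \<omega> + B u \<omega> * B v \<omega>)"
      by (auto simp: algebra_simps)
    have "\<bar>(u - v') + (v' - v)\<bar> powr (2 * H) - \<bar>u - v'\<bar> powr (2 * H)
        \<le> \<bar>(u' - v') + (v' - v)\<bar> powr (2 * H) - \<bar>u' - v'\<bar> powr (2 * H)"
      by (rule powr_abs_four_point) (use H that in auto)
    then show ?thesis unfolding e using that by (simp add: i B_cov field_simps)
  qed
  have "expectation (\<lambda>\<omega>. (B (max 0 u') \<omega> - B (max 0 u) \<omega>) * (B (max 0 v') \<omega> - B (max 0 v) \<omega>)) \<ge> 0"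
    by (rule *) (use assms in auto)
  then show ?thesis by (simp flip: B_max)
qed

definition L2 :: "('a \<Rightarrow> real) \<Rightarrow> real" where "L2 Y = sqrt (expectation (\<lambda>\<omega>. (Y \<omega>)\<^sup>2))"

lemma L2_nonneg[simp]: "L2 Y \<ge> 0" and L2_square: "(L2 Y)\<^sup>2 = expectation (\<lambda>\<omega>. (Y \<omega>)\<^sup>2)"
  by (simp_all add: L2_def)

lemma L2_CS: "Y \<in> chaos \<Longrightarrow> Z \<in> chaos \<Longrightarrow> \<bar>expectation (\<lambda>\<omega>. Y \<omega> * Z \<omega>)\<bar> \<le> L2 Y * L2 Z"
  unfolding L2_def real_sqrt_mult[symmetric]
  by (intro real_le_rsqrt) (simp add: expectation_CS(2) chaos_measurable chaos_square)

text \<open>For \<open>W\<close> in the chaos this is the Cameron-Martin path attached to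
  \<open>W\<close>. The covariance of \<open>W\<close> with a linear functional of the path of
  \<open>B\<close> is the same functional of this path, so covariances satisfy the equations of the
  processes.\<close>

definition covB :: "('a \<Rightarrow> real) \<Rightarrow> real \<Rightarrow> real" where
  "covB W t = expectation (\<lambda>\<omega>. W \<omega> * B t \<omega>)"

lemma covB_holder:
  assumes W: "W \<in> chaos"
  shows "\<bar>covB W t - covB W s\<bar> \<le> L2 W * \<bar>t - s\<bar> powr H"
proof -
  have Bd: "(\<lambda>\<omega>. B t \<omega> - B s \<omega>) \<in> chaos" by (intro chaos_diff span_chaos B_in_span)
  have "covB W t - covB W s = expectation (\<lambda>\<omega>. W \<omega> * (B t \<omega> - B s \<omega>))"
    unfolding covB_def right_diff_distrib
    by (intro Bochner_Integration.integral_diff[symmetric] chaos_prod_integrable W span_chaos B_in_span)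
  also have "\<bar>\<dots>\<bar> \<le> L2 W * L2 (\<lambda>\<omega>. B t \<omega> - B s \<omega>)" by (rule L2_CS[OF W Bd])
  also have "L2 (\<lambda>\<omega>. B t \<omega> - B s \<omega>) \<le> sqrt (\<bar>t - s\<bar> powr (2 * H))"
    unfolding L2_def by (intro real_sqrt_le_mono B_increment)
  also have "sqrt (\<bar>t - s\<bar> powr (2 * H)) = \<bar>t - s\<bar> powr H"
    by (rule real_sqrt_unique) (simp_all add: power2_eq_square flip: powr_add)
  finally show ?thesis by (simp add: mult_left_mono)
qed

lemma covB_path0:
  assumes W: "W \<in> chaos"
  shows "path0 (covB W)"
  unfolding path0_def
proof (intro conjI allI impI)
  show "continuous_on UNIV (covB W)"
  proof (intro continuous_at_imp_continuous_on ballI)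
    fix t
    have "((\<lambda>s. L2 W * \<bar>s - t\<bar> powr H) \<longlongrightarrow> L2 W * \<bar>t - t\<bar> powr H) (at t)"
      using H by (intro tendsto_mult tendsto_const tendsto_powr' tendsto_intros) auto
    then have l: "((\<lambda>s. L2 W * \<bar>s - t\<bar> powr H) \<longlongrightarrow> 0) (at t)" by simp
    have "((\<lambda>s. \<bar>covB W s - covB W t\<bar>) \<longlongrightarrow> 0) (at t)"
      by (rule tendsto_sandwich[OF _ _ tendsto_const l]; intro always_eventually allI covB_holder W abs_ge_zero)
    then show "isCont (covB W) t" unfolding isCont_def by (simp add: tendsto_rabs_zero_iff LIM_zero_iff)
  qed
  show "covB W t = 0" if "t \<le> 0" for t
    using B_path that by (simp add: covB_def path0_def)
qed

text \<open>The second moment is an explicit function \<open>Q\<close>, continuous on the square and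
  zero on the diagonal; uniform continuity gives the modulus.\<close>

lemma scaled_B_modulus:
  fixes k :: "real \<Rightarrow> real"
  assumes k: "continuous_on UNIV k" and e: "e > 0"
  shows "\<exists>d>0. \<forall>s\<in>{0..t}. \<forall>r\<in>{0..t}. \<bar>s - r\<bar> \<le> d \<longrightarrow> expectation (\<lambda>\<omega>. (k s * B s \<omega> - k r * B r \<omega>)\<^sup>2) \<le> e"
proof -
  define Q where "Q p = (k (fst p))\<^sup>2 * fst p powr (2 * H) - k (fst p) * k (snd p) *
    (fst p powr (2 * H) + snd p powr (2 * H) - \<bar>fst p - snd p\<bar> powr (2 * H)) + (k (snd p))\<^sup>2 * snd p powr (2 * H)" for p :: "real \<times> real"
  have Q: "expectation (\<lambda>\<omega>. (k s * B s \<omega> - k r * B r \<omega>)\<^sup>2) = Q (s, r)" if "s \<ge> 0" "r \<ge> 0" for s r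
    using B_scaled_increment[of r s "k s" "k r"] that by (simp add: Q_def)
  have k1: "continuous_on A (\<lambda>p. k (fst p))" "continuous_on A (\<lambda>p. k (snd p))" for A :: "(real \<times> real) set"
    by (rule continuous_on_compose2[OF k continuous_on_fst[OF continuous_on_id]], simp,
        rule continuous_on_compose2[OF k continuous_on_snd[OF continuous_on_id]], simp)
  have "continuous_on ({0..t} \<times> {0..t}) Q"
  proof -
    have "continuous_on ({0..t} \<times> {0..t}) (\<lambda>p::real\<times>real. fst p powr (2 * H))"
      by (rule continuous_on_powr'[OF continuous_on_fst[OF continuous_on_id] continuous_on_const]) (use H in auto)
    moreover have "continuous_on ({0..t} \<times> {0..t}) (\<lambda>p::real\<times>real. snd p powr (2 * H))"
      by (rule continuous_on_powr'[OF continuous_on_snd[OF continuous_on_id] continuous_on_const]) (use H in auto)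
    moreover have "continuous_on ({0..t} \<times> {0..t}) (\<lambda>p::real\<times>real. \<bar>fst p - snd p\<bar> powr (2 * H))"
      by (rule continuous_on_powr'[OF continuous_on_rabs[OF continuous_on_diff[OF continuous_on_fst[OF continuous_on_id]
            continuous_on_snd[OF continuous_on_id]]] continuous_on_const]) (use H in auto)
    ultimately show ?thesis
      unfolding Q_def[abs_def]
      by (intro continuous_on_add continuous_on_diff continuous_on_mult continuous_on_power k1)
  qed
  then have "uniformly_continuous_on ({0..t} \<times> {0..t}) Q"
    by (intro compact_uniformly_continuous compact_Times) auto
  then obtain d where d: "d > 0" "\<And>p q. p \<in> {0..t} \<times> {0..t} \<Longrightarrow> q \<in> {0..t} \<times> {0..t} \<Longrightarrow> dist q p < d \<Longrightarrow> dist (Q q) (Q p) < e"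
    unfolding uniformly_continuous_on_def using e by blast
  have "expectation (\<lambda>\<omega>. (k s * B s \<omega> - k r * B r \<omega>)\<^sup>2) \<le> e"
    if "s \<in> {0..t}" "r \<in> {0..t}" "\<bar>s - r\<bar> \<le> d / 2" for s r
  proof -
    have "dist (s, r) (s, s) = \<bar>s - r\<bar>"
      by (simp add: dist_Pair_Pair dist_real_def abs_minus_commute)
    also have "\<dots> < d" by (rule le_less_trans[OF that(3)]) (use d(1) in simp)
    finally have "dist (s, r) (s, s) < d" .
    then have "dist (Q (s, r)) (Q (s, s)) < e" using that by (intro d(2)) auto
    moreover have "Q (s, s) = 0" by (simp add: Q_def power2_eq_square algebra_simps)
    ultimately show ?thesis using Q[of s r] that by (simp add: dist_real_def)
  qed
  then show ?thesis using d(1) by (intro exI[of _ "d / 2"]) auto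
qed

lemma scaled_B_bound:
  assumes k: "continuous_on UNIV k"
  obtains K where "\<And>s. s \<in> {0..t} \<Longrightarrow> expectation (\<lambda>\<omega>. (k s * B s \<omega>)\<^sup>2) \<le> K"
proof -
  have "continuous_on {0..t} (\<lambda>s. (k s)\<^sup>2 * s powr (2 * H))"
    using H by (intro continuous_on_mult continuous_on_power continuous_on_subset[OF k]
        continuous_on_powr'[OF continuous_on_id continuous_on_const]) auto
  then have "bounded ((\<lambda>s. (k s)\<^sup>2 * s powr (2 * H)) ` {0..t})"
    by (intro compact_imp_bounded compact_continuous_image) auto
  then obtain K where "\<forall>x\<in>(\<lambda>s. (k s)\<^sup>2 * s powr (2 * H)) ` {0..t}. norm x \<le> K"
    unfolding bounded_iff by blast
  then have K: "\<bar>(k s)\<^sup>2 * s powr (2 * H)\<bar> \<le> K" if "s \<in> {0..t}" for s using that by auto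
  show ?thesis
  proof (rule that)
    fix s assume s: "s \<in> {0..t}"
    then show "expectation (\<lambda>\<omega>. (k s * B s \<omega>)\<^sup>2) \<le> K"
      using K[OF s] B_square[of s] by (simp add: power_mult_distrib)
  qed
qed

lemma prim_scaled_B_chaos:
  assumes k: "continuous_on UNIV k"
  shows "(\<lambda>\<omega>. prim (\<lambda>s. k s * B s \<omega>) t) \<in> chaos"
proof -
  obtain K where K: "\<And>s. s \<in> {0..t} \<Longrightarrow> expectation (\<lambda>\<omega>. (k s * B s \<omega>)\<^sup>2) \<le> K"
    using scaled_B_bound[OF k] by blast
  show ?thesis
    by (rule prim_chaos[OF _ _ scaled_B_modulus[OF k] K]) (assumption | intro chaos_scale span_chaos B_in_span path0_mult B_path k)+
qed

lemma covB_prim: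
  assumes k: "continuous_on UNIV k" and W: "W \<in> chaos"
  shows "expectation (\<lambda>\<omega>. W \<omega> * prim (\<lambda>s. k s * B s \<omega>) t) = prim (\<lambda>s. k s * covB W s) t"
proof -
  obtain K where K: "\<And>s. s \<in> {0..t} \<Longrightarrow> expectation (\<lambda>\<omega>. (k s * B s \<omega>)\<^sup>2) \<le> K"
    using scaled_B_bound[OF k] by blast
  have kB: "(\<lambda>\<omega>. k s * B s \<omega>) \<in> chaos" for s by (intro chaos_scale span_chaos B_in_span)
  have "expectation (\<lambda>\<omega>. W \<omega> * prim (\<lambda>s. k s * B s \<omega>) t) = prim (\<lambda>s. expectation (\<lambda>\<omega>. W \<omega> * (k s * B s \<omega>))) t"
    by (rule expectation_mult_prim(1)[OF chaos_measurable[OF W] chaos_square[OF W] chaos_measurable[OF kB]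
          path0_mult[OF B_path k] chaos_square[OF kB] K])
  moreover have "expectation (\<lambda>\<omega>. W \<omega> * (k s * B s \<omega>)) = k s * covB W s" for s
    by (simp add: covB_def mult.left_commute[of "W _"])
  ultimately show ?thesis by simp
qed

definition Z :: "real \<Rightarrow> real \<Rightarrow> 'a \<Rightarrow> real" where "Z a t \<omega> = ou a (\<lambda>s. B s \<omega>) t"

lemma Z_path0: "path0 (\<lambda>t. Z a t \<omega>)"
  unfolding Z_def by (rule ou_path0[OF B_path])

lemma Z_chaos: "Z a t \<in> chaos"
proof -
  have "(\<lambda>\<omega>. 1 * B t \<omega> + (- (a * exp (- (a * t)))) * prim (\<lambda>s. exp (a * s) * B s \<omega>) t) \<in> chaos"
    by (intro chaos_lin span_chaos B_in_span prim_scaled_B_chaos continuous_intros)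
  then show ?thesis by (simp add: Z_def[abs_def] ou_def mult.assoc)
qed

text \<open>The map \<open>ou a\<close> is linear in the path, so it can be exchanged with the
  expectation against \<open>W\<close>.\<close>

lemma cov_Z:
  assumes W: "W \<in> chaos"
  shows "expectation (\<lambda>\<omega>. W \<omega> * Z a t \<omega>) = ou a (covB W) t"
proof -
  have P: "(\<lambda>\<omega>. prim (\<lambda>s. exp (a * s) * B s \<omega>) t) \<in> chaos" by (intro prim_scaled_B_chaos continuous_intros)
  have "expectation (\<lambda>\<omega>. W \<omega> * Z a t \<omega>) =
     expectation (\<lambda>\<omega>. W \<omega> * B t \<omega> - a * exp (- (a * t)) * (W \<omega> * prim (\<lambda>s. exp (a * s) * B s \<omega>) t))"
    by (simp add: Z_def ou_def algebra_simps)
  also have "\<dots> = covB W t - a * exp (- (a * t)) * prim (\<lambda>s. exp (a * s) * covB W s) t"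
    using chaos_prod_integrable[OF W span_chaos[OF B_in_span], of t] chaos_prod_integrable[OF W P]
    by (simp add: covB_prim[OF _ W] covB_def[of W t] continuous_intros)
  finally show ?thesis by (simp add: ou_def)
qed

text \<open>For \<open>H > 1/2\<close> the increments of \<open>B\<close> are positively correlated, and \<open>ou a\<close> maps
  nondecreasing paths to nonnegative ones; this is applied once in each time variable.\<close>

lemma cov_Z_nonneg:
  assumes "a > 0" "b > 0"
  shows "expectation (\<lambda>\<omega>. Z b s \<omega> * Z a t \<omega>) \<ge> 0"
  unfolding cov_Z[OF Z_chaos]
proof (rule ou_nonneg[OF covB_path0[OF Z_chaos] _ assms(1)])
  fix u u' :: real assume u: "u \<le> u'"
  have W: "(\<lambda>\<omega>. B u' \<omega> - B u \<omega>) \<in> chaos" by (intro chaos_diff span_chaos B_in_span)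
  have "ou b (covB (\<lambda>\<omega>. B u' \<omega> - B u \<omega>)) s \<ge> 0"
  proof (rule ou_nonneg[OF covB_path0[OF W] _ assms(2)])
    fix v v' :: real assume v: "v \<le> v'"
    have "covB (\<lambda>\<omega>. B u' \<omega> - B u \<omega>) v' - covB (\<lambda>\<omega>. B u' \<omega> - B u \<omega>) v = expectation (\<lambda>\<omega>. (B u' \<omega> - B u \<omega>) * (B v' \<omega> - B v \<omega>))"
      unfolding covB_def right_diff_distrib[of "B u' _ - B u _"]
      by (intro Bochner_Integration.integral_diff[symmetric] chaos_prod_integrable W span_chaos B_in_span)
    then show "covB (\<lambda>\<omega>. B u' \<omega> - B u \<omega>) v \<le> covB (\<lambda>\<omega>. B u' \<omega> - B u \<omega>) v'"
      using B_increments_nonneg[OF u v] by simp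
  qed
  then have "0 \<le> expectation (\<lambda>\<omega>. (B u' \<omega> - B u \<omega>) * Z b s \<omega>)" by (simp add: cov_Z[OF W])
  also have "\<dots> = expectation (\<lambda>\<omega>. Z b s \<omega> * B u' \<omega> - Z b s \<omega> * B u \<omega>)"
    by (simp add: algebra_simps)
  also have "\<dots> = covB (Z b s) u' - covB (Z b s) u"
    unfolding covB_def by (intro Bochner_Integration.integral_diff chaos_prod_integrable Z_chaos span_chaos B_in_span)
  finally show "covB (Z b s) u \<le> covB (Z b s) u'" by simp
qed

lemma cov_Z_eq:
  assumes W: "W \<in> chaos"
  shows "ou a (covB W) t - ou a (covB W) s = covB W t - covB W s - a * (prim (ou a (covB W)) t - prim (ou a (covB W)) s)"
  using ou_eq[OF covB_path0[OF W], of a t] ou_eq[OF covB_path0[OF W], of a s] by (simp add: algebra_simps)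

text \<open>With \<open>m s = E (Z\<^sub>t Z\<^sub>s) \<ge> 0\<close> one has \<open>m = g - a \<integral> m\<close>, where \<open>g\<close> is Hoelder continuous with
  constant \<open>|Z\<^sub>t|\<close>. On \<open>[t - 1, t]\<close> this yields \<open>(1 + a) |Z\<^sub>t| \<le> |Z\<^bsub>t-1\<^esub>| + 1 + a\<close>.\<close>

lemma Z_L2_bound:
  assumes a: "a > 0"
  shows "L2 (Z a t) \<le> (1 + a) / a"
proof -
  \<comment> \<open>The fixed point of q -> (q + 1 + a) / (1 + a), the map behind the recursion. The
    process is 0 up to time 0, and from there the norms stay below \<open>K\<close>.\<close>
  define K where "K = (1 + a) / a"
  have K: "K > 0" "K + 1 + a = (1 + a) * K" using a by (simp_all add: K_def field_simps)
  have "\<forall>t. t \<le> real n \<longrightarrow> L2 (Z a t) \<le> K" for n :: nat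
  proof (induction n)
    case 0
    then show ?case using Z_path0 K by (auto simp: path0_def L2_def)
  next
    case (Suc n)
    show ?case
    proof (intro allI impI)
      fix t :: real assume t: "t \<le> real (Suc n)"
      define q where "q = L2 (Z a t)"
      let ?g = "covB (Z a t)" let ?m = "ou a ?g"
      have g: "path0 ?g" by (rule covB_path0[OF Z_chaos])
      have m: "path0 ?m" by (rule ou_path0[OF g])
      have mnn: "?m s \<ge> 0" for s using cov_Z_nonneg[OF a a, of t s] by (simp add: cov_Z[OF Z_chaos])
      have mt: "?m t = q\<^sup>2" using cov_Z[OF Z_chaos, of a t a t] unfolding q_def L2_square by (simp add: power2_eq_square)
      have h: "?g t - ?g s \<le> q" if "t - 1 \<le> s" "s \<le> t" for s
      proof -
        have "\<bar>?g t - ?g s\<bar> \<le> q * \<bar>t - s\<bar> powr H" unfolding q_def by (rule covB_holder[OF Z_chaos])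
        also have "\<dots> \<le> q * 1" using that H by (intro mult_left_mono powr_le_one_le) (auto simp: q_def powr_le1)
        finally show ?thesis by simp
      qed
      have ms: "?m s \<ge> q\<^sup>2 - q" if "t - 1 \<le> s" "s \<le> t" for s
      proof -
        have "?m t - ?m s = ?g t - ?g s - a * (prim ?m t - prim ?m s)" by (rule cov_Z_eq[OF Z_chaos])
        moreover have "0 \<le> a * (prim ?m t - prim ?m s)"
          using a prim_nonneg_mono[OF m mnn that(2)] by simp
        ultimately show ?thesis using h[OF that] mt by linarith
      qed
      \<comment> \<open>The integral of \<open>?m\<close> over the last unit interval equals a value
        of \<open>?m\<close> inside it, hence is at least q^2 - q.\<close>
      obtain z where z: "t - 1 < z" "z < t" "prim ?m t - prim ?m (t - 1) = (t - (t - 1)) * ?m z"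
        using MVT2[of "t - 1" t "prim ?m" ?m] prim_has_derivative[OF m] by auto
      have "prim ?m t - prim ?m (t - 1) \<ge> q\<^sup>2 - q" using z ms[of z] by simp
      then have "a * (q\<^sup>2 - q) \<le> a * (prim ?m t - prim ?m (t - 1))" using a by (intro mult_left_mono) auto
      moreover have "?m t - ?m (t - 1) = ?g t - ?g (t - 1) - a * (prim ?m t - prim ?m (t - 1))" by (rule cov_Z_eq[OF Z_chaos])
      moreover have "?m (t - 1) \<le> q * K"
      proof -
        have "?m (t - 1) \<le> q * L2 (Z a (t - 1))"
          using L2_CS[OF Z_chaos[of a t] Z_chaos[of a "t - 1"]] by (simp add: cov_Z[OF Z_chaos] q_def)
        also have "\<dots> \<le> q * K" using Suc.IH[rule_format, of "t - 1"] t by (intro mult_left_mono) (auto simp: q_def)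
        finally show ?thesis .
      qed
      ultimately have "q\<^sup>2 \<le> q * K + q - a * (q\<^sup>2 - q)" using h[of "t - 1"] mt by linarith
      then have "q * ((1 + a) * q) \<le> q * (K + 1 + a)" by (simp add: power2_eq_square algebra_simps)
      then have "q = 0 \<or> (1 + a) * q \<le> (1 + a) * K"
        using K(2) L2_nonneg[of "Z a t"] unfolding q_def[symmetric] by (metis mult_le_cancel_left_pos order_le_less)
      then show "L2 (Z a t) \<le> K" using a K(1) by (auto simp: q_def[symmetric])
    qed
  qed
  note bound = this
  obtain n :: nat where "t \<le> real n" using real_arch_simple by blast
  then show ?thesis using bound[of n] unfolding K_def by blast
qed

text \<open>With q the norm of the increment \<open>?W\<close>, the square q^2 is itself an
  increment of \<open>?m\<close>, the covariance path of \<open>?W\<close> with the process. The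
  equation for \<open>?m\<close> bounds it by q times the claimed quantity, and q cancels.\<close>

lemma Z_increment_bound:
  assumes a: "a > 0"
  shows "L2 (\<lambda>\<omega>. Z a t \<omega> - Z a s \<omega>) \<le> \<bar>t - s\<bar> powr H + (1 + a) * \<bar>t - s\<bar>"
proof -
  let ?W = "\<lambda>\<omega>. Z a t \<omega> - Z a s \<omega>"
  have W: "?W \<in> chaos" by (intro chaos_diff Z_chaos)
  define q where "q = L2 ?W"
  let ?g = "covB ?W" let ?m = "ou a ?g"
  have g: "path0 ?g" by (rule covB_path0[OF W])
  have m: "path0 ?m" by (rule ou_path0[OF g])
  have mb: "\<bar>?m r\<bar> \<le> q * ((1 + a) / a)" for r
  proof -
    have "\<bar>?m r\<bar> \<le> q * L2 (Z a r)" using L2_CS[OF W Z_chaos[of a r]] by (simp add: cov_Z[OF W] q_def)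
    also have "\<dots> \<le> q * ((1 + a) / a)" using Z_L2_bound[OF a] by (intro mult_left_mono) (auto simp: q_def)
    finally show ?thesis .
  qed
  have "q\<^sup>2 = ?m t - ?m s"
  proof -
    have "q\<^sup>2 = expectation (\<lambda>\<omega>. ?W \<omega> * Z a t \<omega> - ?W \<omega> * Z a s \<omega>)"
      unfolding q_def L2_square by (simp add: power2_eq_square algebra_simps)
    also have "\<dots> = expectation (\<lambda>\<omega>. ?W \<omega> * Z a t \<omega>) - expectation (\<lambda>\<omega>. ?W \<omega> * Z a s \<omega>)"
      by (intro Bochner_Integration.integral_diff chaos_prod_integrable W Z_chaos)
    finally show ?thesis by (simp only: cov_Z[OF W])
  qed
  also have "\<dots> = ?g t - ?g s - a * (prim ?m t - prim ?m s)" by (rule cov_Z_eq[OF W])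
  also have "\<dots> \<le> \<bar>?g t - ?g s\<bar> + a * \<bar>prim ?m t - prim ?m s\<bar>"
  proof -
    have "- (a * (prim ?m t - prim ?m s)) \<le> a * \<bar>prim ?m t - prim ?m s\<bar>"
      unfolding mult_minus_right[symmetric] using a by (intro mult_left_mono) auto
    then show ?thesis by linarith
  qed
  also have "\<dots> \<le> q * \<bar>t - s\<bar> powr H + a * (q * ((1 + a) / a) * \<bar>t - s\<bar>)"
  proof (intro add_mono mult_left_mono)
    show "\<bar>?g t - ?g s\<bar> \<le> q * \<bar>t - s\<bar> powr H" unfolding q_def by (rule covB_holder[OF W])
    show "\<bar>prim ?m t - prim ?m s\<bar> \<le> q * ((1 + a) / a) * \<bar>t - s\<bar>"
      using field_differentiable_bound[of UNIV "prim ?m" ?m "q * ((1 + a) / a)" t s] mb prim_has_derivative[OF m]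
      by (auto simp: has_field_derivative_at_within)
  qed (use a in auto)
  also have "\<dots> = q * (\<bar>t - s\<bar> powr H + (1 + a) * \<bar>t - s\<bar>)" using a by (simp add: field_simps)
  finally have "q * q \<le> q * (\<bar>t - s\<bar> powr H + (1 + a) * \<bar>t - s\<bar>)" by (simp add: power2_eq_square)
  moreover have "q \<ge> 0" by (simp add: q_def)
  ultimately have "q = 0 \<or> q \<le> \<bar>t - s\<bar> powr H + (1 + a) * \<bar>t - s\<bar>"
    by (metis mult_le_cancel_left_pos order_le_less)
  then show ?thesis using a unfolding q_def[symmetric] by auto
qed

end

lemma prim_diff_eq_integral:
  assumes "path0 f" "0 \<le> a" "a \<le> b"
  shows "prim f b - prim f a = integral {a..b} f"
  using Henstock_Kurzweil_Integration.integral_combine[of 0 a b f] assms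
  by (simp add: prim_def integrable_continuous_interval path0_continuous_on)

lemma prim_increment_square_le:
  assumes f: "path0 f" and "0 \<le> a" "a < b"
  shows "(prim f b - prim f a)\<^sup>2 \<le> (b - a) * (prim (\<lambda>s. (f s)\<^sup>2) b - prim (\<lambda>s. (f s)\<^sup>2) a)"
  using integral_square_le[OF path0_continuous_on[OF f], of a b] assms
  by (simp add: prim_diff_eq_integral path0_square)

lemma square_add3_le: "(a + b + c)\<^sup>2 \<le> 3 * (a\<^sup>2 + b\<^sup>2 + c\<^sup>2)" for a b c :: real
  using zero_le_power2[of "a - b"] zero_le_power2[of "b - c"] zero_le_power2[of "a - c"]
  by (simp add: power2_eq_square algebra_simps)

lemma square_diff_le: "(a - b)\<^sup>2 \<le> 2 * a\<^sup>2 + 2 * b\<^sup>2" for a b :: real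
  using zero_le_power2[of "a + b"] by (simp add: power2_sum power2_diff)

text \<open>The path \<open>w\<close> is x plus multiples of its single and its double primitive. In
  a second difference the double primitive becomes, by the mean value theorem, an increment of the
  single one, so x near t controls everything; a first difference would leave a value of the single
  primitive, which depends on the whole past.\<close>

lemma ou_ou_second_difference:
  fixes \<theta> \<rho> :: real
  assumes w: "path0 w" and n: "0 \<le> n" and t: "n \<le> t" "t \<le> n + 1"
  defines "x \<equiv> ou \<theta> (ou \<rho> w)"
  defines "A \<equiv> prim (\<lambda>s. (x s)\<^sup>2)"
  shows "(w (t + 2) - 2 * w (t + 1) + w t)\<^sup>2 \<le>
    9 * ((x (t + 2))\<^sup>2 + 4 * (x (t + 1))\<^sup>2 + (x t)\<^sup>2) + (12 * (\<theta> + \<rho>)\<^sup>2 + 3 * (\<theta> * \<rho>)\<^sup>2) * (A (n + 3) - A n)"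
proof -
  have x: "path0 x" unfolding x_def by (intro ou_path0 w)
  define S where "S = prim x"
  define P where "P = prim S"
  have S: "path0 S" unfolding S_def by (rule prim_path0[OF x])
  have x2: "path0 (\<lambda>s. (x s)\<^sup>2)" by (rule path0_square[OF x])
  have Am: "A r \<le> A s" if "r \<le> s" for r s
    unfolding A_def by (rule prim_nonneg_mono[OF x2 _ that]) simp
  have w_eq: "w t = x t + (\<theta> + \<rho>) * S t + \<theta> * \<rho> * P t" for t
    using ou_ou_expand[OF w, of \<theta> \<rho> t] by (simp add: x_def S_def P_def)
  \<comment> \<open>All unit intervals that occur lie in \<open>{n..n+3}\<close>: the second
    difference reaches t + 2, and t is at most n + 1.\<close>
  have Sd: "(S (r + 1) - S r)\<^sup>2 \<le> A (n + 3) - A n" if "n \<le> r" "r \<le> n + 2" for r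
  proof -
    have "(S (r + 1) - S r)\<^sup>2 \<le> (r + 1 - r) * (A (r + 1) - A r)"
      unfolding S_def A_def using n that by (intro prim_increment_square_le x) auto
    then show ?thesis using Am[of "r + 1" "n + 3"] Am[of n r] that by simp
  qed
  obtain z where z: "t < z" "z < t + 1" "(P (t + 1 + 1) - P (t + 1)) - (P (t + 1) - P t) = (t + 1 - t) * (S (z + 1) - S z)"
  proof -
    have "((\<lambda>u. P (u + 1) - P u) has_real_derivative S (u + 1) * 1 - S u) (at u)" for u
      unfolding P_def
      by (intro DERIV_diff DERIV_chain2[where f = "prim S" and g = "\<lambda>u. u + 1"] prim_has_derivative S)
         (auto intro!: derivative_eq_intros)
    then show ?thesis
      using MVT2[of t "t + 1" "\<lambda>u. P (u + 1) - P u" "\<lambda>u. S (u + 1) - S u"] that by auto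
  qed
  let ?a = "x (t + 2) + (- 2 * x (t + 1)) + x t"
  let ?b = "(S (t + 1 + 1) - S (t + 1)) - (S (t + 1) - S t)"
  let ?c = "S (z + 1) - S z"
  have e: "w (t + 2) - 2 * w (t + 1) + w t = ?a + (\<theta> + \<rho>) * ?b + \<theta> * \<rho> * ?c"
  proof -
    have "t + 1 + 1 = t + 2" by simp
    with z(3) have "?c = P (t + 2) - 2 * P (t + 1) + P t" by (simp only:) simp
    then show ?thesis unfolding w_eq by (simp only:) (simp add: algebra_simps)
  qed
  have a: "?a\<^sup>2 \<le> 3 * ((x (t + 2))\<^sup>2 + 4 * (x (t + 1))\<^sup>2 + (x t)\<^sup>2)"
    using square_add3_le[of "x (t + 2)" "- 2 * x (t + 1)" "x t"] by (simp add: power_mult_distrib)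
  have b: "?b\<^sup>2 \<le> 4 * (A (n + 3) - A n)"
  proof -
    have "?b\<^sup>2 \<le> 2 * (S (t + 1 + 1) - S (t + 1))\<^sup>2 + 2 * (S (t + 1) - S t)\<^sup>2"
      by (rule square_diff_le)
    also have "\<dots> \<le> 2 * (A (n + 3) - A n) + 2 * (A (n + 3) - A n)"
      using Sd[of "t + 1"] Sd[of t] t by (intro add_mono mult_left_mono) auto
    finally show ?thesis by simp
  qed
  have c: "?c\<^sup>2 \<le> A (n + 3) - A n" using Sd[of z] z t by simp
  have "(w (t + 2) - 2 * w (t + 1) + w t)\<^sup>2 \<le> 3 * (?a\<^sup>2 + ((\<theta> + \<rho>) * ?b)\<^sup>2 + (\<theta> * \<rho> * ?c)\<^sup>2)"
    unfolding e by (rule square_add3_le)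
  also have "\<dots> \<le> 3 * (3 * ((x (t + 2))\<^sup>2 + 4 * (x (t + 1))\<^sup>2 + (x t)\<^sup>2) + (\<theta> + \<rho>)\<^sup>2 * (4 * (A (n + 3) - A n)) + (\<theta> * \<rho>)\<^sup>2 * (A (n + 3) - A n))"
    unfolding power_mult_distrib[of "\<theta> + \<rho>"] power_mult_distrib[of "\<theta> * \<rho>"]
    by (intro mult_left_mono add_mono a b c) auto
  also have "\<dots> = 9 * ((x (t + 2))\<^sup>2 + 4 * (x (t + 1))\<^sup>2 + (x t)\<^sup>2) + (12 * (\<theta> + \<rho>)\<^sup>2 + 3 * (\<theta> * \<rho>)\<^sup>2) * (A (n + 3) - A n)"
    by (simp add: algebra_simps)
  finally show ?thesis .
qed

section \<open>Gaussian product formulas\<close>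

context fbm
begin

lemma expectation_cos_phase:
  assumes N: "N \<in> chaos"
  shows "expectation (\<lambda>\<omega>. cos (\<phi> + N \<omega>)) = cos \<phi> * exp (- expectation (\<lambda>\<omega>. (N \<omega>)\<^sup>2) / 2)"
proof -
  note [measurable] = chaos_measurable[OF N]
  have i: "integrable M (\<lambda>\<omega>. cos (N \<omega>))" "integrable M (\<lambda>\<omega>. sin (N \<omega>))"
    by (auto intro!: integrable_const_bound[where B = 1])
  show ?thesis unfolding cos_add using i chaos_trig[OF N] by simp
qed

text \<open>Both identities come from differentiating \<open>a \<mapsto> E cos (\<phi> + N + a Y)\<close>, which is an explicit
  Gaussian expression, at \<open>a = 0\<close>.\<close>

lemma wick:
  assumes N: "N \<in> chaos" and Y: "Y \<in> chaos"
  shows "expectation (\<lambda>\<omega>. Y \<omega> * sin (\<phi> + N \<omega>)) =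
      cos \<phi> * expectation (\<lambda>\<omega>. N \<omega> * Y \<omega>) * exp (- expectation (\<lambda>\<omega>. (N \<omega>)\<^sup>2) / 2)"
    and "expectation (\<lambda>\<omega>. (Y \<omega>)\<^sup>2 * cos (\<phi> + N \<omega>)) =
      cos \<phi> * (expectation (\<lambda>\<omega>. (Y \<omega>)\<^sup>2) - (expectation (\<lambda>\<omega>. N \<omega> * Y \<omega>))\<^sup>2) * exp (- expectation (\<lambda>\<omega>. (N \<omega>)\<^sup>2) / 2)"
proof -
  note [measurable] = chaos_measurable[OF N] chaos_measurable[OF Y]
  define c s v where "c = expectation (\<lambda>\<omega>. N \<omega> * Y \<omega>)" and "s = expectation (\<lambda>\<omega>. (Y \<omega>)\<^sup>2)"
    and "v = expectation (\<lambda>\<omega>. (N \<omega>)\<^sup>2)"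
  have q: "expectation (\<lambda>\<omega>. (N \<omega> + a * Y \<omega>)\<^sup>2) = v + 2 * a * c + a\<^sup>2 * s" for a
    using square_lin_integrable(2)[OF _ _ chaos_square[OF N] chaos_square[OF Y], of 1 a] by (simp add: c_def s_def v_def)
  have F: "expectation (\<lambda>\<omega>. cos (\<phi> + (N \<omega> + a * Y \<omega>))) = cos \<phi> * exp (- (v + 2 * a * c + a\<^sup>2 * s) / 2)" for a
    using expectation_cos_phase[of "\<lambda>\<omega>. 1 * N \<omega> + a * Y \<omega>" \<phi>] chaos_lin[OF N Y, of 1 a] q[of a] by simp
  have Yi: "integrable M (\<lambda>\<omega>. \<bar>Y \<omega>\<bar>)" by (intro integrable_abs chaos_integrable Y)
  have "((\<lambda>a. expectation (\<lambda>\<omega>. cos (\<phi> + (N \<omega> + a * Y \<omega>)))) has_real_derivative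
      expectation (\<lambda>\<omega>. - sin (\<phi> + (N \<omega> + a * Y \<omega>)) * Y \<omega>)) (at a)" for a
  proof (rule DERIV_expectation[where g = "\<lambda>\<omega>. \<bar>Y \<omega>\<bar>", OF _ _ _ _ Yi])
    show "integrable M (\<lambda>\<omega>. cos (\<phi> + (N \<omega> + a * Y \<omega>)))" for a
      by (auto intro!: integrable_const_bound[where B = 1])
    show "((\<lambda>a. cos (\<phi> + (N \<omega> + a * Y \<omega>))) has_real_derivative - sin (\<phi> + (N \<omega> + a * Y \<omega>)) * Y \<omega>) (at a)" for a \<omega>
      by (auto intro!: derivative_eq_intros)
    show "\<bar>- sin (\<phi> + (N \<omega> + a * Y \<omega>)) * Y \<omega>\<bar> \<le> \<bar>Y \<omega>\<bar>" for a \<omega>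
      by (simp add: abs_mult mult_left_le_one_le)
  qed measurable
  moreover have "((\<lambda>a. cos \<phi> * exp (- (v + 2 * a * c + a\<^sup>2 * s) / 2)) has_real_derivative
      - (cos \<phi> * (c + a * s) * exp (- (v + 2 * a * c + a\<^sup>2 * s) / 2))) (at a)" for a
    by (auto intro!: derivative_eq_intros simp: field_simps)
  ultimately have D1: "expectation (\<lambda>\<omega>. - sin (\<phi> + (N \<omega> + a * Y \<omega>)) * Y \<omega>)
      = - (cos \<phi> * (c + a * s) * exp (- (v + 2 * a * c + a\<^sup>2 * s) / 2))" for a
    unfolding F by (rule DERIV_unique)
  have "expectation (\<lambda>\<omega>. - sin (\<phi> + (N \<omega> + 0 * Y \<omega>)) * Y \<omega>) = - expectation (\<lambda>\<omega>. Y \<omega> * sin (\<phi> + N \<omega>))"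
    by (simp add: mult.commute)
  with D1[of 0] show "expectation (\<lambda>\<omega>. Y \<omega> * sin (\<phi> + N \<omega>)) =
      cos \<phi> * expectation (\<lambda>\<omega>. N \<omega> * Y \<omega>) * exp (- expectation (\<lambda>\<omega>. (N \<omega>)\<^sup>2) / 2)"
    by (simp add: c_def v_def)
  have "((\<lambda>a. expectation (\<lambda>\<omega>. - sin (\<phi> + (N \<omega> + a * Y \<omega>)) * Y \<omega>)) has_real_derivative
      expectation (\<lambda>\<omega>. - cos (\<phi> + (N \<omega> + a * Y \<omega>)) * (Y \<omega>)\<^sup>2)) (at a)" for a
  proof (rule DERIV_expectation[where g = "\<lambda>\<omega>. (Y \<omega>)\<^sup>2", OF _ _ _ _ chaos_square[OF Y]])
    show "integrable M (\<lambda>\<omega>. - sin (\<phi> + (N \<omega> + a * Y \<omega>)) * Y \<omega>)" for a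
      by (rule Bochner_Integration.integrable_bound[OF Yi]) (auto simp: abs_mult mult_left_le_one_le)
    show "((\<lambda>a. - sin (\<phi> + (N \<omega> + a * Y \<omega>)) * Y \<omega>) has_real_derivative - cos (\<phi> + (N \<omega> + a * Y \<omega>)) * (Y \<omega>)\<^sup>2) (at a)" for a \<omega>
      by (auto intro!: derivative_eq_intros simp: power2_eq_square)
    show "\<bar>- cos (\<phi> + (N \<omega> + a * Y \<omega>)) * (Y \<omega>)\<^sup>2\<bar> \<le> (Y \<omega>)\<^sup>2" for a \<omega>
      by (simp add: abs_mult mult_left_le_one_le)
  qed measurable
  note D2 = this[of 0, unfolded D1]
  have "((\<lambda>a. - (cos \<phi> * (c + a * s) * exp (- (v + 2 * a * c + a\<^sup>2 * s) / 2))) has_real_derivative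
      - (cos \<phi> * (s - c\<^sup>2) * exp (- v / 2))) (at 0)"
    by (auto intro!: derivative_eq_intros simp: power2_eq_square algebra_simps)
  from DERIV_unique[OF D2 this] show "expectation (\<lambda>\<omega>. (Y \<omega>)\<^sup>2 * cos (\<phi> + N \<omega>)) =
      cos \<phi> * (expectation (\<lambda>\<omega>. (Y \<omega>)\<^sup>2) - (expectation (\<lambda>\<omega>. N \<omega> * Y \<omega>))\<^sup>2) * exp (- expectation (\<lambda>\<omega>. (N \<omega>)\<^sup>2) / 2)"
    by (simp add: c_def s_def v_def mult.commute[of "cos _" "(Y _)\<^sup>2"])
qed

text \<open>Second derivative at b = 0 of E Y^2 cos(b N), which \<open>wick\<close> gives in closed
  form. It is the case of Isserlis' formula that yields the covariance of two squares.\<close>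

lemma wick_4:
  assumes N: "N \<in> chaos" and Y: "Y \<in> chaos"
  shows "expectation (\<lambda>\<omega>. (Y \<omega>)\<^sup>2 * (N \<omega>)\<^sup>2) =
    expectation (\<lambda>\<omega>. (Y \<omega>)\<^sup>2) * expectation (\<lambda>\<omega>. (N \<omega>)\<^sup>2) + 2 * (expectation (\<lambda>\<omega>. N \<omega> * Y \<omega>))\<^sup>2"
proof -
  note [measurable] = chaos_measurable[OF N] chaos_measurable[OF Y]
  define c s v where "c = expectation (\<lambda>\<omega>. N \<omega> * Y \<omega>)" and "s = expectation (\<lambda>\<omega>. (Y \<omega>)\<^sup>2)"
    and "v = expectation (\<lambda>\<omega>. (N \<omega>)\<^sup>2)"
  have F: "expectation (\<lambda>\<omega>. (Y \<omega>)\<^sup>2 * cos (b * N \<omega>)) = (s - b\<^sup>2 * c\<^sup>2) * exp (- (b\<^sup>2 * v) / 2)" for b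
    using wick(2)[OF chaos_scale[OF N, of b] Y, of 0] by (simp add: c_def s_def v_def power_mult_distrib mult.assoc)
  have YN: "integrable M (\<lambda>\<omega>. (Y \<omega>)\<^sup>2 * (N \<omega>)\<^sup>2)" by (rule chaos_square_prod_integrable[OF Y N])
  have Y1: "integrable M (\<lambda>\<omega>. (Y \<omega>)\<^sup>2 * \<bar>N \<omega>\<bar>)"
  proof (rule Bochner_Integration.integrable_bound)
    show "integrable M (\<lambda>\<omega>. (Y \<omega>)\<^sup>2 + (Y \<omega>)\<^sup>2 * (N \<omega>)\<^sup>2)" using YN chaos_square[OF Y] by simp
    show "AE \<omega> in M. norm ((Y \<omega>)\<^sup>2 * \<bar>N \<omega>\<bar>) \<le> norm ((Y \<omega>)\<^sup>2 + (Y \<omega>)\<^sup>2 * (N \<omega>)\<^sup>2)"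
    proof (rule AE_I2)
      fix \<omega>
      have "\<bar>N \<omega>\<bar> \<le> 1 + (N \<omega>)\<^sup>2" using zero_le_power2[of "\<bar>N \<omega>\<bar> - 1"] using zero_le_power2[of "N \<omega>"] unfolding power2_diff by simp
      from mult_left_mono[OF this, of "(Y \<omega>)\<^sup>2"]
      show "norm ((Y \<omega>)\<^sup>2 * \<bar>N \<omega>\<bar>) \<le> norm ((Y \<omega>)\<^sup>2 + (Y \<omega>)\<^sup>2 * (N \<omega>)\<^sup>2)" by (simp add: algebra_simps)
    qed
  qed measurable
  have "((\<lambda>b. expectation (\<lambda>\<omega>. (Y \<omega>)\<^sup>2 * cos (b * N \<omega>))) has_real_derivative
      expectation (\<lambda>\<omega>. (Y \<omega>)\<^sup>2 * (- sin (b * N \<omega>) * N \<omega>))) (at b)" for b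
  proof (rule DERIV_expectation[OF _ _ _ _ Y1])
    show "integrable M (\<lambda>\<omega>. (Y \<omega>)\<^sup>2 * cos (b * N \<omega>))" for b
      by (rule Bochner_Integration.integrable_bound[OF chaos_square[OF Y]]) (auto simp: abs_mult mult_left_le)
    show "((\<lambda>b. (Y \<omega>)\<^sup>2 * cos (b * N \<omega>)) has_real_derivative (Y \<omega>)\<^sup>2 * (- sin (b * N \<omega>) * N \<omega>)) (at b)" for b \<omega>
      by (auto intro!: derivative_eq_intros)
    show "\<bar>(Y \<omega>)\<^sup>2 * (- sin (b * N \<omega>) * N \<omega>)\<bar> \<le> (Y \<omega>)\<^sup>2 * \<bar>N \<omega>\<bar>" for b \<omega>
      unfolding abs_mult by (intro mult_mono) (auto simp: abs_mult mult_left_le_one_le)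
  qed measurable
  moreover have "((\<lambda>b. (s - b\<^sup>2 * c\<^sup>2) * exp (- (b\<^sup>2 * v) / 2)) has_real_derivative
      - b * (2 * c\<^sup>2 + v * (s - b\<^sup>2 * c\<^sup>2)) * exp (- (b\<^sup>2 * v) / 2)) (at b)" for b
    by (auto intro!: derivative_eq_intros simp: field_simps)
  ultimately have D1: "expectation (\<lambda>\<omega>. (Y \<omega>)\<^sup>2 * (- sin (b * N \<omega>) * N \<omega>)) =
      - b * (2 * c\<^sup>2 + v * (s - b\<^sup>2 * c\<^sup>2)) * exp (- (b\<^sup>2 * v) / 2)" for b
    unfolding F by (rule DERIV_unique)
  have "((\<lambda>b. expectation (\<lambda>\<omega>. (Y \<omega>)\<^sup>2 * (- sin (b * N \<omega>) * N \<omega>))) has_real_derivative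
      expectation (\<lambda>\<omega>. (Y \<omega>)\<^sup>2 * (- cos (b * N \<omega>) * (N \<omega>)\<^sup>2))) (at b)" for b
  proof (rule DERIV_expectation[OF _ _ _ _ YN])
    show "integrable M (\<lambda>\<omega>. (Y \<omega>)\<^sup>2 * (- sin (b * N \<omega>) * N \<omega>))" for b
      by (rule Bochner_Integration.integrable_bound[OF Y1]) (auto simp: abs_mult intro!: mult_left_mono mult_left_le_one_le)
    show "((\<lambda>b. (Y \<omega>)\<^sup>2 * (- sin (b * N \<omega>) * N \<omega>)) has_real_derivative (Y \<omega>)\<^sup>2 * (- cos (b * N \<omega>) * (N \<omega>)\<^sup>2)) (at b)" for b \<omega>
      by (auto intro!: derivative_eq_intros simp: power2_eq_square)
    show "\<bar>(Y \<omega>)\<^sup>2 * (- cos (b * N \<omega>) * (N \<omega>)\<^sup>2)\<bar> \<le> (Y \<omega>)\<^sup>2 * (N \<omega>)\<^sup>2" for b \<omega>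
      unfolding abs_mult by (intro mult_mono) (auto simp: abs_mult mult_left_le_one_le)
  qed measurable
  note D2 = this[of 0, unfolded D1]
  have "((\<lambda>b. - b * (2 * c\<^sup>2 + v * (s - b\<^sup>2 * c\<^sup>2)) * exp (- (b\<^sup>2 * v) / 2)) has_real_derivative - (2 * c\<^sup>2 + v * s)) (at 0)"
    by (auto intro!: derivative_eq_intros)
  from DERIV_unique[OF D2 this] show ?thesis by (simp add: c_def s_def v_def algebra_simps)
qed

lemma L2_lin:
  assumes Y: "Y \<in> chaos" and W: "W \<in> chaos"
  shows "L2 (\<lambda>\<omega>. a * Y \<omega> + b * W \<omega>) \<le> \<bar>a\<bar> * L2 Y + \<bar>b\<bar> * L2 W"
proof (rule power2_le_imp_le)
  have "(L2 (\<lambda>\<omega>. a * Y \<omega> + b * W \<omega>))\<^sup>2 = a\<^sup>2 * (L2 Y)\<^sup>2 + 2 * a * b * expectation (\<lambda>\<omega>. Y \<omega> * W \<omega>) + b\<^sup>2 * (L2 W)\<^sup>2"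
    unfolding L2_square by (intro square_lin_integrable(2) chaos_measurable chaos_square Y W)
  also have "2 * a * b * expectation (\<lambda>\<omega>. Y \<omega> * W \<omega>) \<le> \<bar>2 * a * b\<bar> * (L2 Y * L2 W)"
    by (rule order_trans[OF abs_ge_self], subst abs_mult, intro mult_left_mono L2_CS Y W) simp
  also have "a\<^sup>2 * (L2 Y)\<^sup>2 + \<bar>2 * a * b\<bar> * (L2 Y * L2 W) + b\<^sup>2 * (L2 W)\<^sup>2 = (\<bar>a\<bar> * L2 Y + \<bar>b\<bar> * L2 W)\<^sup>2"
    by (simp add: power2_sum power_mult_distrib abs_mult)
  finally show "(L2 (\<lambda>\<omega>. a * Y \<omega> + b * W \<omega>))\<^sup>2 \<le> (\<bar>a\<bar> * L2 Y + \<bar>b\<bar> * L2 W)\<^sup>2" by simp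
qed simp

end

section \<open>The two-stage Ornstein-Uhlenbeck process\<close>

locale fbm_ou = fbm +
  fixes \<theta> \<rho> :: real
  assumes \<theta>: "\<theta> > 0" and \<rho>: "\<rho> > 0" and ne: "\<theta> \<noteq> \<rho>"
begin

definition X :: "real \<Rightarrow> 'a \<Rightarrow> real" where "X t \<omega> = ou \<theta> (ou \<rho> (\<lambda>s. B s \<omega>)) t"

text \<open>The time integral of \<open>X\<close>. The Skorohod integral, denoted by the same letter
  in the theorem, is a different process.\<close>

definition S :: "real \<Rightarrow> 'a \<Rightarrow> real" where "S t \<omega> = prim (\<lambda>s. X s \<omega>) t"

definition A :: "real \<Rightarrow> 'a \<Rightarrow> real" where "A t \<omega> = prim (\<lambda>s. (X s \<omega>)\<^sup>2) t"

definition xvar :: "real \<Rightarrow> real" where "xvar t = expectation (\<lambda>\<omega>. (X t \<omega>)\<^sup>2)"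

lemma X_path0: "path0 (\<lambda>t. X t \<omega>)"
  unfolding X_def by (intro ou_path0 B_path)

lemma X_eq: "X t = (\<lambda>\<omega>. (\<rho> / (\<rho> - \<theta>)) * Z \<rho> t \<omega> + (- \<theta> / (\<rho> - \<theta>)) * Z \<theta> t \<omega>)"
  unfolding X_def Z_def by (rule ext, rule ou_ou_eq[OF B_path ne])

lemma S_eq: "S t = (\<lambda>\<omega>. (1 / (\<rho> - \<theta>)) * Z \<theta> t \<omega> + (- 1 / (\<rho> - \<theta>)) * Z \<rho> t \<omega>)"
  unfolding S_def X_def Z_def by (rule ext, rule prim_ou_ou_eq[OF B_path ne])

lemma X_chaos: "X t \<in> chaos" unfolding X_eq by (intro chaos_lin Z_chaos)

lemma S_chaos: "S t \<in> chaos" unfolding S_eq by (intro chaos_lin Z_chaos)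

lemma X_measurable[measurable]: "X t \<in> borel_measurable M" by (rule chaos_measurable[OF X_chaos])

lemma S_measurable[measurable]: "S t \<in> borel_measurable M" by (rule chaos_measurable[OF S_chaos])

lemma cov_lin:
  assumes "W \<in> chaos" "Y \<in> chaos" "Y' \<in> chaos"
  shows "expectation (\<lambda>\<omega>. W \<omega> * (a * Y \<omega> + b * Y' \<omega>)) = a * expectation (\<lambda>\<omega>. W \<omega> * Y \<omega>) + b * expectation (\<lambda>\<omega>. W \<omega> * Y' \<omega>)"
proof -
  have "expectation (\<lambda>\<omega>. W \<omega> * (a * Y \<omega> + b * Y' \<omega>)) = expectation (\<lambda>\<omega>. a * (W \<omega> * Y \<omega>) + b * (W \<omega> * Y' \<omega>))"
    by (simp add: algebra_simps)
  then show ?thesis using assms by (simp add: chaos_prod_integrable)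
qed

lemma cov_X:
  assumes W: "W \<in> chaos"
  shows "expectation (\<lambda>\<omega>. W \<omega> * X t \<omega>) = ou \<theta> (ou \<rho> (covB W)) t"
  unfolding X_eq cov_lin[OF W Z_chaos Z_chaos] cov_Z[OF W] by (rule ou_ou_eq[OF covB_path0[OF W] ne, symmetric])

lemma cov_S:
  assumes W: "W \<in> chaos"
  shows "expectation (\<lambda>\<omega>. W \<omega> * S t \<omega>) = prim (ou \<theta> (ou \<rho> (covB W))) t"
  unfolding S_eq cov_lin[OF W Z_chaos Z_chaos] cov_Z[OF W] by (rule prim_ou_ou_eq[OF covB_path0[OF W] ne, symmetric])

lemma L2_bounds:
  obtains K where "K > 0" "\<And>t. L2 (X t) \<le> K" "\<And>t. L2 (S t) \<le> K"
proof -
  define k where "k = (1 + \<rho>) / \<rho> + (1 + \<theta>) / \<theta>"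
  have k: "(1 + \<rho>) / \<rho> > 0" "(1 + \<theta>) / \<theta> > 0" using \<theta> \<rho> by auto
  have zk: "L2 (Z \<rho> t) \<le> k" "L2 (Z \<theta> t) \<le> k" for t
    using Z_L2_bound[OF \<rho>, of t] Z_L2_bound[OF \<theta>, of t] k unfolding k_def by linarith+
  have lin: "L2 (\<lambda>\<omega>. a * Z \<rho> t \<omega> + b * Z \<theta> t \<omega>) \<le> (\<bar>a\<bar> + \<bar>b\<bar>) * k" for a b t
  proof -
    have "L2 (\<lambda>\<omega>. a * Z \<rho> t \<omega> + b * Z \<theta> t \<omega>) \<le> \<bar>a\<bar> * L2 (Z \<rho> t) + \<bar>b\<bar> * L2 (Z \<theta> t)" by (intro L2_lin Z_chaos)
    also have "\<dots> \<le> \<bar>a\<bar> * k + \<bar>b\<bar> * k" by (intro add_mono mult_left_mono zk) auto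
    finally show ?thesis by (simp add: algebra_simps)
  qed
  define K where "K = (\<bar>\<rho> / (\<rho> - \<theta>)\<bar> + \<bar>- \<theta> / (\<rho> - \<theta>)\<bar>) * k + (\<bar>- 1 / (\<rho> - \<theta>)\<bar> + \<bar>1 / (\<rho> - \<theta>)\<bar>) * k + 1"
  have k0: "k > 0" using k by (simp add: k_def)
  have nn: "(\<bar>\<rho> / (\<rho> - \<theta>)\<bar> + \<bar>- \<theta> / (\<rho> - \<theta>)\<bar>) * k \<ge> 0" "(\<bar>- 1 / (\<rho> - \<theta>)\<bar> + \<bar>1 / (\<rho> - \<theta>)\<bar>) * k \<ge> 0"
    using k0 by (intro mult_nonneg_nonneg; simp)+
  show ?thesis
  proof (rule that)
    show "K > 0" using nn unfolding K_def by linarith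
    show "L2 (X t) \<le> K" for t
      using lin[of "\<rho> / (\<rho> - \<theta>)" t "- \<theta> / (\<rho> - \<theta>)"] nn unfolding K_def X_eq by linarith
    show "L2 (S t) \<le> K" for t
      using lin[of "- 1 / (\<rho> - \<theta>)" t "1 / (\<rho> - \<theta>)"] nn unfolding K_def S_eq by (simp only: add.commute)
  qed
qed

text \<open>The exponent H is lowered to 1/2, which for |t - s| \<le> 1 also absorbs the linear
  term. Fourth moments of increments are then of order (t - s)^2, which suffices for
  chaining.\<close>

lemma X_increment_bound:
  obtains C where "C > 0" "\<And>s t. \<bar>t - s\<bar> \<le> 1 \<Longrightarrow> L2 (\<lambda>\<omega>. X t \<omega> - X s \<omega>) \<le> C * sqrt \<bar>t - s\<bar>"
proof -
  define a b where "a = \<rho> / (\<rho> - \<theta>)" and "b = - \<theta> / (\<rho> - \<theta>)"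
  have zi: "L2 (\<lambda>\<omega>. Z c t \<omega> - Z c s \<omega>) \<le> (2 + c) * sqrt \<bar>t - s\<bar>" if "\<bar>t - s\<bar> \<le> 1" "c > 0" for c s t
  proof -
    have "\<bar>t - s\<bar> powr H \<le> \<bar>t - s\<bar> powr (1 / 2)" using that H by (intro powr_mono') auto
    then have 1: "\<bar>t - s\<bar> powr H \<le> sqrt \<bar>t - s\<bar>" by (simp add: powr_half_sqrt)
    have "\<bar>t - s\<bar> * \<bar>t - s\<bar> \<le> \<bar>t - s\<bar> * 1" by (intro mult_left_mono that) simp
    then have 2: "\<bar>t - s\<bar> \<le> sqrt \<bar>t - s\<bar>"
      by (intro real_le_rsqrt) (simp only: power2_eq_square mult_1_right)
    have "L2 (\<lambda>\<omega>. Z c t \<omega> - Z c s \<omega>) \<le> \<bar>t - s\<bar> powr H + (1 + c) * \<bar>t - s\<bar>" by (rule Z_increment_bound[OF that(2)])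
    also have "\<dots> \<le> sqrt \<bar>t - s\<bar> + (1 + c) * sqrt \<bar>t - s\<bar>"
      using that 1 2 by (intro add_mono mult_left_mono) auto
    finally show ?thesis by (simp add: algebra_simps)
  qed
  define C where "C = \<bar>a\<bar> * (2 + \<rho>) + \<bar>b\<bar> * (2 + \<theta>) + 1"
  show ?thesis
  proof (rule that)
    show "C > 0" unfolding C_def using \<theta> \<rho> by (intro add_nonneg_pos add_nonneg_nonneg mult_nonneg_nonneg) auto
    fix s t :: real assume st: "\<bar>t - s\<bar> \<le> 1"
    have e: "(\<lambda>\<omega>. X t \<omega> - X s \<omega>) = (\<lambda>\<omega>. a * (Z \<rho> t \<omega> - Z \<rho> s \<omega>) + b * (Z \<theta> t \<omega> - Z \<theta> s \<omega>))"
      by (simp add: X_eq a_def b_def algebra_simps)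
    have "L2 (\<lambda>\<omega>. X t \<omega> - X s \<omega>) \<le> \<bar>a\<bar> * L2 (\<lambda>\<omega>. Z \<rho> t \<omega> - Z \<rho> s \<omega>) + \<bar>b\<bar> * L2 (\<lambda>\<omega>. Z \<theta> t \<omega> - Z \<theta> s \<omega>)"
      unfolding e by (intro L2_lin chaos_diff Z_chaos)
    also have "\<dots> \<le> \<bar>a\<bar> * ((2 + \<rho>) * sqrt \<bar>t - s\<bar>) + \<bar>b\<bar> * ((2 + \<theta>) * sqrt \<bar>t - s\<bar>)"
      using st \<theta> \<rho> by (intro add_mono mult_left_mono zi) auto
    also have "\<dots> \<le> C * sqrt \<bar>t - s\<bar>" by (simp add: C_def algebra_simps)
    finally show "L2 (\<lambda>\<omega>. X t \<omega> - X s \<omega>) \<le> C * sqrt \<bar>t - s\<bar>" .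
  qed
qed

text \<open>A difference of squares factors into difference and sum, so Cauchy-Schwarz transfers the
  L2 continuity of \<open>X\<close> to its second moment.\<close>

lemma xvar_path0: "path0 xvar"
  unfolding path0_def
proof (intro conjI allI impI)
  show "xvar t = 0" if "t \<le> 0" for t
    using X_path0 that by (simp add: xvar_def path0_def)
  obtain K where K: "K > 0" "\<And>t. L2 (X t) \<le> K" "\<And>t. L2 (S t) \<le> K" by (rule L2_bounds) blast
  obtain C where C: "C > 0" "\<And>s t. \<bar>t - s\<bar> \<le> 1 \<Longrightarrow> L2 (\<lambda>\<omega>. X t \<omega> - X s \<omega>) \<le> C * sqrt \<bar>t - s\<bar>" by (rule X_increment_bound) blast
  have b: "\<bar>xvar s - xvar t\<bar> \<le> C * sqrt \<bar>s - t\<bar> * (2 * K)" if "\<bar>s - t\<bar> \<le> 1" for s t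
  proof -
    have D: "(\<lambda>\<omega>. X s \<omega> - X t \<omega>) \<in> chaos" and P: "(\<lambda>\<omega>. 1 * X s \<omega> + 1 * X t \<omega>) \<in> chaos"
      by (intro chaos_diff chaos_lin X_chaos)+
    have "xvar s - xvar t = expectation (\<lambda>\<omega>. (X s \<omega>)\<^sup>2 - (X t \<omega>)\<^sup>2)"
      unfolding xvar_def by (intro Bochner_Integration.integral_diff[symmetric] chaos_square X_chaos)
    also have "\<dots> = expectation (\<lambda>\<omega>. (X s \<omega> - X t \<omega>) * (1 * X s \<omega> + 1 * X t \<omega>))"
      by (simp add: power2_eq_square algebra_simps)
    finally have "\<bar>xvar s - xvar t\<bar> \<le> L2 (\<lambda>\<omega>. X s \<omega> - X t \<omega>) * L2 (\<lambda>\<omega>. 1 * X s \<omega> + 1 * X t \<omega>)"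
      by (simp only: L2_CS[OF D P])
    also have "\<dots> \<le> C * sqrt \<bar>s - t\<bar> * (2 * K)"
    proof (rule mult_mono)
      show "L2 (\<lambda>\<omega>. X s \<omega> - X t \<omega>) \<le> C * sqrt \<bar>s - t\<bar>" by (rule C(2)[OF that])
      have "L2 (\<lambda>\<omega>. 1 * X s \<omega> + 1 * X t \<omega>) \<le> \<bar>1\<bar> * L2 (X s) + \<bar>1\<bar> * L2 (X t)" by (intro L2_lin X_chaos)
      then show "L2 (\<lambda>\<omega>. 1 * X s \<omega> + 1 * X t \<omega>) \<le> 2 * K" using K(2)[of s] K(2)[of t] by simp
    qed (use C(1) in auto)
    finally show ?thesis .
  qed
  show "continuous_on UNIV xvar"
  proof (intro continuous_at_imp_continuous_on ballI)
    fix t :: real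
    have "((\<lambda>s. C * sqrt \<bar>s - t\<bar> * (2 * K)) \<longlongrightarrow> C * sqrt \<bar>t - t\<bar> * (2 * K)) (at t)" by (intro tendsto_intros)
    then have l: "((\<lambda>s. C * sqrt \<bar>s - t\<bar> * (2 * K)) \<longlongrightarrow> 0) (at t)" by simp
    have "\<forall>\<^sub>F s in at t. dist s t < 1" by (intro eventually_at_ball'[of 1 t UNIV, simplified, THEN eventually_mono]) (auto simp: dist_commute)
    then have ev: "\<forall>\<^sub>F s in at t. \<bar>xvar s - xvar t\<bar> \<le> C * sqrt \<bar>s - t\<bar> * (2 * K)"
      by eventually_elim (auto intro!: b simp: dist_real_def)
    have "((\<lambda>s. \<bar>xvar s - xvar t\<bar>) \<longlongrightarrow> 0) (at t)"
      by (rule tendsto_sandwich[OF _ ev tendsto_const l]) simp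
    then show "isCont xvar t" unfolding isCont_def by (simp add: tendsto_rabs_zero_iff LIM_zero_iff)
  qed
qed

lemma xvar_nonneg: "xvar t \<ge> 0" by (simp add: xvar_def)

lemma fourth_moment:
  assumes Y: "Y \<in> chaos"
  shows "expectation (\<lambda>\<omega>. (Y \<omega>)\<^sup>2 * (Y \<omega>)\<^sup>2) = 3 * (L2 Y) ^ 4"
proof -
  have "(L2 Y) ^ 4 = ((L2 Y)\<^sup>2)\<^sup>2" by simp
  moreover have "expectation (\<lambda>\<omega>. Y \<omega> * Y \<omega>) = (L2 Y)\<^sup>2" by (subst L2_square) (simp only: power2_eq_square)
  ultimately show ?thesis unfolding wick_4[OF Y Y] L2_square[of Y, symmetric] by (simp add: power2_eq_square[of "(L2 Y)\<^sup>2"])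
qed

lemma A_integrable: "integrable M (A t)"
  and expectation_A: "expectation (A t) = prim xvar t"
proof -
  obtain K where K: "K > 0" "\<And>t. L2 (X t) \<le> K" "\<And>t. L2 (S t) \<le> K" by (rule L2_bounds) blast
  have b: "expectation (\<lambda>\<omega>. \<bar>(X s \<omega>)\<^sup>2\<bar>) \<le> K\<^sup>2" for s
    using power_mono[OF K(2), of s 2] by (simp add: L2_square)
  have c: "continuous_on UNIV (\<lambda>s. (X s \<omega>)\<^sup>2)" for \<omega> by (rule path0_continuous_on[OF path0_square[OF X_path0]])
  have m: "(\<lambda>\<omega>. (X s \<omega>)\<^sup>2) \<in> borel_measurable M" for s by measurable
  note E = expectation_prim[of "\<lambda>s \<omega>. (X s \<omega>)\<^sup>2" t, OF m c chaos_square[OF X_chaos] b]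
  show "integrable M (A t)" "expectation (A t) = prim xvar t"
    using E(1,2) by (simp_all add: A_def[abs_def] xvar_def[abs_def])
qed

text \<open>The second difference of \<open>B\<close> has the constant variance \<open>4 - 2 powr (2 * H) > 0\<close> and is
  controlled by \<open>X\<close>, so \<open>E \<integral> X\<^sup>2\<close> grows linearly.\<close>

lemma prim_xvar_increment:
  obtains c where "c > 0" "\<And>n. 0 \<le> n \<Longrightarrow> prim xvar (n + 3) - prim xvar n \<ge> c"
proof -
  define \<alpha> where "\<alpha> = prim xvar"
  define k where "k = 12 * (\<theta> + \<rho>)\<^sup>2 + 3 * (\<theta> * \<rho>)\<^sup>2"
  have k: "k \<ge> 0" by (simp add: k_def)
  define v where "v = 4 - 2 powr (2 * H)"
  have "2 powr (2 * H) < 2 powr (2 :: real)" using H by (intro powr_less_mono) auto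
  then have v: "v > 0" by (simp add: v_def)
  have am: "\<alpha> r \<le> \<alpha> s" if "r \<le> s" for r s
    unfolding \<alpha>_def by (rule prim_nonneg_mono[OF xvar_path0 xvar_nonneg that])
  have bound: "v \<le> 9 * (xvar (t + 2) + 4 * xvar (t + 1) + xvar t) + k * (\<alpha> (n + 3) - \<alpha> n)"
    if n: "0 \<le> n" "n \<le> t" "t \<le> n + 1" for n t
  proof -
    let ?D = "\<lambda>\<omega>. B (t + 2) \<omega> - 2 * B (t + 1) \<omega> + B t \<omega>"
    have D: "?D \<in> chaos"
      using chaos_lin[OF chaos_lin[OF span_chaos[OF B_in_span[of "t + 2"]] span_chaos[OF B_in_span[of "t + 1"]], of 1 "-2"] span_chaos[OF B_in_span[of t]], of 1 1] by simp
    have i: "integrable M (\<lambda>\<omega>. B r \<omega> * B s \<omega>)" for r s by (intro chaos_prod_integrable span_chaos B_in_span)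
    have ev: "expectation (\<lambda>\<omega>. (?D \<omega>)\<^sup>2) = v"
    proof -
      have "(\<lambda>\<omega>. (?D \<omega>)\<^sup>2) = (\<lambda>\<omega>. B (t + 2) \<omega> * B (t + 2) \<omega> + 4 * (B (t + 1) \<omega> * B (t + 1) \<omega>) + B t \<omega> * B t \<omega>
          - 4 * (B (t + 2) \<omega> * B (t + 1) \<omega>) + 2 * (B (t + 2) \<omega> * B t \<omega>) - 4 * (B (t + 1) \<omega> * B t \<omega>))"
        by (auto simp: power2_eq_square algebra_simps)
      then have "expectation (\<lambda>\<omega>. (?D \<omega>)\<^sup>2) = expectation (\<lambda>\<omega>. B (t + 2) \<omega> * B (t + 2) \<omega>) + 4 * expectation (\<lambda>\<omega>. B (t + 1) \<omega> * B (t + 1) \<omega>) + expectation (\<lambda>\<omega>. B t \<omega> * B t \<omega>)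
          - 4 * expectation (\<lambda>\<omega>. B (t + 2) \<omega> * B (t + 1) \<omega>) + 2 * expectation (\<lambda>\<omega>. B (t + 2) \<omega> * B t \<omega>) - 4 * expectation (\<lambda>\<omega>. B (t + 1) \<omega> * B t \<omega>)"
        using i by simp
      also have "\<dots> = v" using n by (simp add: B_cov v_def field_simps)
      finally show ?thesis .
    qed
    have "v \<le> expectation (\<lambda>\<omega>. 9 * ((X (t + 2) \<omega>)\<^sup>2 + 4 * (X (t + 1) \<omega>)\<^sup>2 + (X t \<omega>)\<^sup>2) + k * (A (n + 3) \<omega> - A n \<omega>))"
      unfolding ev[symmetric]
    proof (rule integral_mono[OF chaos_square[OF D]])
      show "integrable M (\<lambda>\<omega>. 9 * ((X (t + 2) \<omega>)\<^sup>2 + 4 * (X (t + 1) \<omega>)\<^sup>2 + (X t \<omega>)\<^sup>2) + k * (A (n + 3) \<omega> - A n \<omega>))"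
        using chaos_square[OF X_chaos] A_integrable by simp
      show "(?D \<omega>)\<^sup>2 \<le> 9 * ((X (t + 2) \<omega>)\<^sup>2 + 4 * (X (t + 1) \<omega>)\<^sup>2 + (X t \<omega>)\<^sup>2) + k * (A (n + 3) \<omega> - A n \<omega>)" for \<omega>
        using ou_ou_second_difference[OF B_path n, of \<omega> \<theta> \<rho>] unfolding X_def A_def k_def .
    qed
    also have "\<dots> = 9 * (xvar (t + 2) + 4 * xvar (t + 1) + xvar t) + k * (\<alpha> (n + 3) - \<alpha> n)"
    proof -
      have "integrable M (\<lambda>\<omega>. (X s \<omega>)\<^sup>2)" "integrable M (\<lambda>\<omega>. A s \<omega>)" for s
        by (rule chaos_square[OF X_chaos] A_integrable)+
      then have "expectation (\<lambda>\<omega>. 9 * ((X (t + 2) \<omega>)\<^sup>2 + 4 * (X (t + 1) \<omega>)\<^sup>2 + (X t \<omega>)\<^sup>2) + k * (A (n + 3) \<omega> - A n \<omega>))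
        = 9 * (expectation (\<lambda>\<omega>. (X (t + 2) \<omega>)\<^sup>2) + 4 * expectation (\<lambda>\<omega>. (X (t + 1) \<omega>)\<^sup>2) + expectation (\<lambda>\<omega>. (X t \<omega>)\<^sup>2))
          + k * (expectation (A (n + 3)) - expectation (A n))"
        by simp
      then show ?thesis unfolding expectation_A xvar_def \<alpha>_def .
    qed
    finally show ?thesis .
  qed
  have inc: "v \<le> (54 + k) * (\<alpha> (n + 3) - \<alpha> n)" if n: "0 \<le> n" for n
  proof -
    \<comment> \<open>The inequality \<open>bound\<close> involves \<open>xvar\<close> at three
      times. The mean value theorem for \<open>?P\<close> supplies a z at which their weighted sum
      is an increment of primitives; the weights 1 + 4 + 1 give 6, and 9 * 6 = 54.\<close>
    let ?P = "\<lambda>t. \<alpha> (t + 2) + 4 * \<alpha> (t + 1) + \<alpha> t"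
    have "(?P has_real_derivative xvar (t + 2) * 1 + 4 * (xvar (t + 1) * 1) + xvar t) (at t)" for t
      unfolding \<alpha>_def
      by (intro DERIV_add DERIV_cmult DERIV_chain2[where f = "prim xvar" and g = "\<lambda>t. t + _"] prim_has_derivative xvar_path0)
         (auto intro!: derivative_eq_intros)
    then obtain z where z: "n < z" "z < n + 1" "?P (n + 1) - ?P n = (n + 1 - n) * (xvar (z + 2) + 4 * xvar (z + 1) + xvar z)"
      using MVT2[of n "n + 1" ?P "\<lambda>t. xvar (t + 2) + 4 * xvar (t + 1) + xvar t"] by auto
    have "?P (n + 1) - ?P n \<le> 6 * (\<alpha> (n + 3) - \<alpha> n)"
    proof -
      have e: "n + 1 + 2 = n + 3" "n + 1 + 1 = n + 2" by simp_all
      have gen: "s + 4 * r + q - (r + 4 * q + p) \<le> 6 * (s - p)" if "p \<le> q" "q \<le> r" "r \<le> s" for p q r s :: real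
        using that by simp
      show ?thesis unfolding e by (rule gen; rule am; simp)
    qed
    with z have "xvar (z + 2) + 4 * xvar (z + 1) + xvar z \<le> 6 * (\<alpha> (n + 3) - \<alpha> n)" by simp
    then have "9 * (xvar (z + 2) + 4 * xvar (z + 1) + xvar z) \<le> 9 * (6 * (\<alpha> (n + 3) - \<alpha> n))"
      by (rule mult_left_mono) simp
    moreover have "v \<le> 9 * (xvar (z + 2) + 4 * xvar (z + 1) + xvar z) + k * (\<alpha> (n + 3) - \<alpha> n)"
      by (rule bound) (use n z in auto)
    moreover have "9 * (6 * (\<alpha> (n + 3) - \<alpha> n)) + k * (\<alpha> (n + 3) - \<alpha> n) = (54 + k) * (\<alpha> (n + 3) - \<alpha> n)"
      by (simp add: algebra_simps)
    ultimately show ?thesis by linarith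
  qed
  show ?thesis
  proof (rule that)
    show "v / (54 + k) > 0" using v k by simp
    show "prim xvar (n + 3) - prim xvar n \<ge> v / (54 + k)" if "0 \<le> n" for n
      using inc[OF that] k unfolding \<alpha>_def by (simp add: field_simps)
  qed
qed

text \<open>Summation over blocks of length 3; the shift by 3 pays for the incomplete last
  block.\<close>

lemma prim_xvar_lower:
  obtains c where "c > 0" "\<And>T. 0 \<le> T \<Longrightarrow> prim xvar T \<ge> c * (T - 3)"
proof -
  obtain c where c: "c > 0" "\<And>n. 0 \<le> n \<Longrightarrow> prim xvar (n + 3) - prim xvar n \<ge> c" by (rule prim_xvar_increment) blast
  have k: "prim xvar (3 * real k) \<ge> c * real k" for k
  proof (induction k)
    case (Suc k)
    then show ?case using c(2)[of "3 * real k"] by (simp add: algebra_simps)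
  qed (simp add: prim_nonpos)
  show ?thesis
  proof (rule that[of "c / 3"])
    show "c / 3 > 0" using c by simp
    fix T :: real assume T: "0 \<le> T"
    define k where "k = nat \<lfloor>T / 3\<rfloor>"
    have "real k = real_of_int \<lfloor>T / 3\<rfloor>" using T by (simp add: k_def)
    then have kr: "real k \<le> T / 3" "T / 3 < real k + 1" by linarith+
    have "(T - 3) / 3 \<le> real k" using kr by simp
    from mult_left_mono[OF this, of c] have "c / 3 * (T - 3) \<le> c * real k" using c by simp
    also have "\<dots> \<le> prim xvar (3 * real k)" by (rule k)
    also have "\<dots> \<le> prim xvar T" using kr by (intro prim_nonneg_mono[OF xvar_path0 xvar_nonneg]) simp
    finally show "prim xvar T \<ge> c / 3 * (T - 3)" .
  qed
qed

text \<open>\<open>Cov (X\<^sub>r\<^sup>2, X\<^sub>s\<^sup>2) = 2 (E X\<^sub>r X\<^sub>s)\<^sup>2\<close> is at most a multiple of \<open>E U\<^sub>r U\<^sub>s\<close> for \<open>U = Z \<rho> + Z \<theta>\<close>, as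
  all covariances of the \<open>Z\<close> are nonnegative. The double integral of \<open>E U\<^sub>r U\<^sub>s\<close> is the second moment of
  \<open>\<integral> U\<close>, and \<open>\<integral> Z a = (B - Z a) / a\<close>.\<close>

lemma variance_A:
  obtains C where "C > 0" "\<And>T. T \<ge> 1 \<Longrightarrow> integrable M (\<lambda>\<omega>. (A T \<omega> - prim xvar T)\<^sup>2)"
    "\<And>T. T \<ge> 1 \<Longrightarrow> expectation (\<lambda>\<omega>. (A T \<omega> - prim xvar T)\<^sup>2) \<le> C * T powr (2 * H)"
proof -
  obtain K where K: "K > 0" "\<And>t. L2 (X t) \<le> K" "\<And>t. L2 (S t) \<le> K" by (rule L2_bounds) blast
  define D where "D s \<omega> = (X s \<omega>)\<^sup>2 - xvar s" for s \<omega>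
  \<comment> \<open>The coefficients of \<open>Z \<rho>\<close> and \<open>Z \<theta>\<close> in
    \<open>X\<close> have opposite signs. Replacing them by 1 in \<open>U\<close>, at the price of
    the common bound \<open>g\<close>, is possible because the covariances of the \<open>Z\<close>
    are nonnegative.\<close>
  define U where "U s \<omega> = 1 * Z \<rho> s \<omega> + 1 * Z \<theta> s \<omega>" for s \<omega>
  define g where "g = max \<bar>\<rho> / (\<rho> - \<theta>)\<bar> \<bar>- \<theta> / (\<rho> - \<theta>)\<bar>"
  define \<kappa> where "\<kappa> = 2 * K\<^sup>2 * g\<^sup>2"
  have UG: "U s \<in> chaos" for s unfolding U_def by (intro chaos_lin Z_chaos)
  have Up: "path0 (\<lambda>s. U s \<omega>)" for \<omega> unfolding U_def by (intro path0_lin Z_path0)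
  have Dp: "path0 (\<lambda>s. D s \<omega>)" for \<omega>
    using path0_lin[OF path0_square[OF X_path0] xvar_path0, of 1 \<omega> "-1"] by (simp add: D_def)
  have Dm[measurable]: "D s \<in> borel_measurable M" for s unfolding D_def[abs_def] by measurable
  have x2: "integrable M (\<lambda>\<omega>. (X s \<omega>)\<^sup>2)" for s by (rule chaos_square[OF X_chaos])
  have x4: "integrable M (\<lambda>\<omega>. (X r \<omega>)\<^sup>2 * (X s \<omega>)\<^sup>2)" for r s by (rule chaos_square_prod_integrable[OF X_chaos X_chaos])
  have De: "D r \<omega> * D s \<omega> = (X r \<omega>)\<^sup>2 * (X s \<omega>)\<^sup>2 - xvar s * (X r \<omega>)\<^sup>2 - xvar r * (X s \<omega>)\<^sup>2 + xvar r * xvar s" for r s \<omega>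
    by (simp add: D_def algebra_simps)
  have DDi: "integrable M (\<lambda>\<omega>. D r \<omega> * D s \<omega>)" for r s unfolding De using x2 x4 by simp
  have DD: "expectation (\<lambda>\<omega>. D r \<omega> * D s \<omega>) = 2 * (expectation (\<lambda>\<omega>. X r \<omega> * X s \<omega>))\<^sup>2" for r s
    unfolding De using x2 x4 wick_4[OF X_chaos X_chaos, of r s]
    by (simp add: xvar_def prob_space mult.commute[of "X s _" "X r _"])
  have D2i: "integrable M (\<lambda>\<omega>. (D s \<omega>)\<^sup>2)" for s using DDi[of s s] by (simp add: power2_eq_square)
  have cK: "\<bar>expectation (\<lambda>\<omega>. X r \<omega> * X s \<omega>)\<bar> \<le> K * K" for r s
    by (rule order_trans[OF L2_CS[OF X_chaos X_chaos]]) (use K in \<open>auto intro!: mult_mono\<close>)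
  have D2b: "expectation (\<lambda>\<omega>. (D s \<omega>)\<^sup>2) \<le> 2 * (K * K)\<^sup>2" for s
    using DD[of s s] power_mono[OF cK abs_ge_zero, of s s 2] by (simp add: power2_eq_square)
  have cU: "\<bar>expectation (\<lambda>\<omega>. X r \<omega> * X s \<omega>)\<bar> \<le> g\<^sup>2 * expectation (\<lambda>\<omega>. U r \<omega> * U s \<omega>)" for r s
  proof -
    define a b where "a = \<rho> / (\<rho> - \<theta>)" and "b = - \<theta> / (\<rho> - \<theta>)"
    define p where "p i j = expectation (\<lambda>\<omega>. Z i r \<omega> * Z j s \<omega>)" for i j
    have p: "p \<rho> \<rho> \<ge> 0" "p \<rho> \<theta> \<ge> 0" "p \<theta> \<rho> \<ge> 0" "p \<theta> \<theta> \<ge> 0"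
      unfolding p_def using \<theta> \<rho> by (auto intro: cov_Z_nonneg)
    have e: "expectation (\<lambda>\<omega>. (a * Z \<rho> r \<omega> + b * Z \<theta> r \<omega>) * (a * Z \<rho> s \<omega> + b * Z \<theta> s \<omega>)) =
       (a * a) * p \<rho> \<rho> + (a * b) * p \<rho> \<theta> + (b * a) * p \<theta> \<rho> + (b * b) * p \<theta> \<theta>" for a b
    proof -
      have "(\<lambda>\<omega>. (a * Z \<rho> r \<omega> + b * Z \<theta> r \<omega>) * (a * Z \<rho> s \<omega> + b * Z \<theta> s \<omega>)) =
        (\<lambda>\<omega>. (a * a) * (Z \<rho> r \<omega> * Z \<rho> s \<omega>) + (a * b) * (Z \<rho> r \<omega> * Z \<theta> s \<omega>) + (b * a) * (Z \<theta> r \<omega> * Z \<rho> s \<omega>) + (b * b) * (Z \<theta> r \<omega> * Z \<theta> s \<omega>))"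
        by (auto simp: algebra_simps)
      then show ?thesis by (simp add: chaos_prod_integrable Z_chaos p_def)
    qed
    have m: "\<bar>u * w * q\<bar> \<le> g\<^sup>2 * q" if "\<bar>u\<bar> \<le> g" "\<bar>w\<bar> \<le> g" "q \<ge> 0" for u w q
    proof -
      have "\<bar>u\<bar> * \<bar>w\<bar> \<le> g * g" using that by (intro mult_mono) auto
      then show ?thesis using that(3) by (simp add: abs_mult power2_eq_square mult_right_mono)
    qed
    have g: "\<bar>a\<bar> \<le> g" "\<bar>b\<bar> \<le> g" by (simp_all add: a_def b_def g_def)
    have "\<bar>(a * a) * p \<rho> \<rho> + (a * b) * p \<rho> \<theta> + (b * a) * p \<theta> \<rho> + (b * b) * p \<theta> \<theta>\<bar>
      \<le> g\<^sup>2 * p \<rho> \<rho> + g\<^sup>2 * p \<rho> \<theta> + g\<^sup>2 * p \<theta> \<rho> + g\<^sup>2 * p \<theta> \<theta>"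
      using m[OF g(1) g(1) p(1)] m[OF g(1) g(2) p(2)] m[OF g(2) g(1) p(3)] m[OF g(2) g(2) p(4)] by linarith
    then show ?thesis
      unfolding X_eq U_def e a_def[symmetric] b_def[symmetric] by (simp add: algebra_simps)
  qed
  \<comment> \<open>One factor of the square is bounded by K^2, the other by the covariance of
    \<open>U\<close>.\<close>
  have DU: "2 * (expectation (\<lambda>\<omega>. X r \<omega> * X s \<omega>))\<^sup>2 \<le> \<kappa> * expectation (\<lambda>\<omega>. U r \<omega> * U s \<omega>)" for r s
  proof -
    have "(expectation (\<lambda>\<omega>. X r \<omega> * X s \<omega>))\<^sup>2 = \<bar>expectation (\<lambda>\<omega>. X r \<omega> * X s \<omega>)\<bar> * \<bar>expectation (\<lambda>\<omega>. X r \<omega> * X s \<omega>)\<bar>"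
      by (simp add: power2_eq_square flip: abs_mult)
    also have "\<dots> \<le> (K * K) * (g\<^sup>2 * expectation (\<lambda>\<omega>. U r \<omega> * U s \<omega>))"
      using K(1) by (intro mult_mono cK cU) auto
    finally show ?thesis by (simp add: \<kappa>_def power2_eq_square mult.assoc)
  qed
  obtain L where L: "L > 0" "\<And>s. expectation (\<lambda>\<omega>. (U s \<omega>)\<^sup>2) \<le> L"
  proof -
    define l where "l = (1 + \<rho>) / \<rho> + (1 + \<theta>) / \<theta>"
    have l: "l > 0" using \<theta> \<rho> by (simp add: l_def add_pos_pos)
    have "L2 (U s) \<le> l" for s
      using L2_lin[OF Z_chaos Z_chaos, of 1 \<rho> s 1 \<theta> s] Z_L2_bound[OF \<rho>, of s] Z_L2_bound[OF \<theta>, of s] by (simp add: U_def[abs_def] l_def)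
    then have "expectation (\<lambda>\<omega>. (U s \<omega>)\<^sup>2) \<le> l\<^sup>2" for s
      using power_mono[of "L2 (U s)" l 2] by (simp add: L2_square)
    then show ?thesis using l by (intro that[of "l\<^sup>2"]) auto
  qed
  have Um[measurable]: "U s \<in> borel_measurable M" for s by (rule chaos_measurable[OF UG])
  have \<kappa>: "\<kappa> \<ge> 0" by (simp add: \<kappa>_def)
  have main: "integrable M (\<lambda>\<omega>. (A T \<omega> - prim xvar T)\<^sup>2) \<and>
     expectation (\<lambda>\<omega>. (A T \<omega> - prim xvar T)\<^sup>2) \<le> \<kappa> * expectation (\<lambda>\<omega>. (prim (\<lambda>s. U s \<omega>) T)\<^sup>2)" if T: "T \<ge> 0" for T
  proof -
    have AD: "A T \<omega> - prim xvar T = prim (\<lambda>s. D s \<omega>) T" for \<omega>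
      using prim_lin[OF path0_square[OF X_path0] xvar_path0, of 1 \<omega> "-1" T] by (simp add: D_def A_def)
    note PD = prim_square_expectation[of D T "2 * (K * K)\<^sup>2", OF Dm Dp D2i D2b T]
    note PU = prim_square_expectation[of U T L, OF Um Up chaos_square[OF UG] L(2) T]
    note c1 = expectation_mult_prim[of "D r" D T "2 * (K * K)\<^sup>2" for r, OF Dm D2i Dm Dp D2i D2b]
    note c2 = expectation_mult_prim[of "U r" U T L for r, OF Um chaos_square[OF UG] Um Up chaos_square[OF UG] L(2)]
    note c3 = expectation_mult_prim[of "\<lambda>\<omega>. prim (\<lambda>s. D s \<omega>) T" D T "2 * (K * K)\<^sup>2", OF PD(1,2) Dm Dp D2i D2b]
    note c4 = expectation_mult_prim[of "\<lambda>\<omega>. prim (\<lambda>s. U s \<omega>) T" U T L, OF PU(1,2) Um Up chaos_square[OF UG] L(2)]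
    \<comment> \<open>The comparison of covariances is integrated once per time variable: here in s
      for fixed r, below in r with the primitives over \<open>{0..T}\<close> as weights.\<close>
    have inn: "expectation (\<lambda>\<omega>. prim (\<lambda>s. D s \<omega>) T * D r \<omega>) \<le> \<kappa> * expectation (\<lambda>\<omega>. prim (\<lambda>s. U s \<omega>) T * U r \<omega>)" for r
    proof -
      have "expectation (\<lambda>\<omega>. prim (\<lambda>s. D s \<omega>) T * D r \<omega>) = prim (\<lambda>s. expectation (\<lambda>\<omega>. D r \<omega> * D s \<omega>)) T"
        using c1(1)[of r] by (simp add: mult.commute)
      also have "\<dots> \<le> prim (\<lambda>s. \<kappa> * expectation (\<lambda>\<omega>. U r \<omega> * U s \<omega>)) T"
        unfolding prim_def
        by (intro integral_le c1(2) integrable_on_mult_right c2(2)) (simp add: DD DU)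
      also have "\<dots> = \<kappa> * expectation (\<lambda>\<omega>. prim (\<lambda>s. U s \<omega>) T * U r \<omega>)"
        using c2(1)[of r] by (simp add: mult.commute prim_cmult)
      finally show ?thesis .
    qed
    have "expectation (\<lambda>\<omega>. (prim (\<lambda>s. D s \<omega>) T)\<^sup>2) = prim (\<lambda>r. expectation (\<lambda>\<omega>. prim (\<lambda>s. D s \<omega>) T * D r \<omega>)) T"
      using c3(1) by (simp add: power2_eq_square)
    also have "\<dots> \<le> prim (\<lambda>r. \<kappa> * expectation (\<lambda>\<omega>. prim (\<lambda>s. U s \<omega>) T * U r \<omega>)) T"
      unfolding prim_def[of _ T]
      by (intro integral_le c3(2)[unfolded prim_def[of _ T]] integrable_on_mult_right c4(2)[unfolded prim_def[of _ T]] inn[unfolded prim_def[of _ T]])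
    also have "\<dots> = \<kappa> * expectation (\<lambda>\<omega>. (prim (\<lambda>s. U s \<omega>) T)\<^sup>2)"
      using c4(1) by (simp add: power2_eq_square prim_cmult)
    finally show ?thesis unfolding AD using PD(2) by simp
  qed
  have UB: "expectation (\<lambda>\<omega>. (prim (\<lambda>s. U s \<omega>) T)\<^sup>2) \<le> ((1 + (1 + \<rho>) / \<rho>) / \<rho> + (1 + (1 + \<theta>) / \<theta>) / \<theta>)\<^sup>2 * T powr (2 * H)" if T: "T \<ge> 1" for T
  proof -
    have Th: "T powr H \<ge> 1" using T H by (intro ge_one_powr_ge_zero) auto
    have LB: "L2 (B T) = T powr H"
    proof -
      have "T powr (2 * H) = (T powr H)\<^sup>2" by (simp add: power2_eq_square flip: powr_add)
      then show ?thesis using B_square[of T] T by (simp add: L2_def)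
    qed
    have PZ: "(\<lambda>\<omega>. prim (\<lambda>s. Z a s \<omega>) T) \<in> chaos \<and> L2 (\<lambda>\<omega>. prim (\<lambda>s. Z a s \<omega>) T) \<le> (1 + (1 + a) / a) / a * T powr H" if a: "a > 0" for a
    proof -
      have e: "(\<lambda>\<omega>. prim (\<lambda>s. Z a s \<omega>) T) = (\<lambda>\<omega>. (1 / a) * B T \<omega> + (- 1 / a) * Z a T \<omega>)"
      proof
        fix \<omega>
        have "Z a T \<omega> = B T \<omega> - a * prim (\<lambda>s. Z a s \<omega>) T"
          unfolding Z_def by (rule ou_eq[OF B_path])
        then show "prim (\<lambda>s. Z a s \<omega>) T = (1 / a) * B T \<omega> + (- 1 / a) * Z a T \<omega>"
          using a by (simp add: field_simps)
      qed
      have "L2 (\<lambda>\<omega>. (1 / a) * B T \<omega> + (- 1 / a) * Z a T \<omega>) \<le> \<bar>1 / a\<bar> * L2 (B T) + \<bar>- 1 / a\<bar> * L2 (Z a T)"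
        by (intro L2_lin span_chaos B_in_span Z_chaos)
      also have "\<dots> \<le> (1 / a) * T powr H + (1 / a) * ((1 + a) / a * T powr H)"
      proof (intro add_mono)
        have "L2 (Z a T) \<le> (1 + a) / a * 1" using Z_L2_bound[OF a] by simp
        also have "\<dots> \<le> (1 + a) / a * T powr H" using Th a by (intro mult_left_mono) auto
        finally have z: "L2 (Z a T) \<le> (1 + a) / a * T powr H" .
        have "\<bar>- 1 / a\<bar> = 1 / a" using a by simp
        then show "\<bar>- 1 / a\<bar> * L2 (Z a T) \<le> (1 / a) * ((1 + a) / a * T powr H)"
          using a by (simp only:) (rule mult_left_mono[OF z], simp)
      qed (use a LB in simp)
      also have "\<dots> = (1 + (1 + a) / a) / a * T powr H" by (simp add: add_divide_distrib algebra_simps)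
      finally show ?thesis unfolding e by (intro conjI chaos_lin span_chaos B_in_span Z_chaos)
    qed
    have e: "(\<lambda>\<omega>. prim (\<lambda>s. U s \<omega>) T) = (\<lambda>\<omega>. 1 * prim (\<lambda>s. Z \<rho> s \<omega>) T + 1 * prim (\<lambda>s. Z \<theta> s \<omega>) T)"
      unfolding U_def by (rule ext, rule prim_lin[OF Z_path0 Z_path0])
    have "L2 (\<lambda>\<omega>. prim (\<lambda>s. U s \<omega>) T) \<le> \<bar>1\<bar> * L2 (\<lambda>\<omega>. prim (\<lambda>s. Z \<rho> s \<omega>) T) + \<bar>1\<bar> * L2 (\<lambda>\<omega>. prim (\<lambda>s. Z \<theta> s \<omega>) T)"
      unfolding e using PZ[OF \<rho>] PZ[OF \<theta>] by (intro L2_lin) auto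
    also have "\<dots> \<le> ((1 + (1 + \<rho>) / \<rho>) / \<rho> + (1 + (1 + \<theta>) / \<theta>) / \<theta>) * T powr H"
      using PZ[OF \<rho>] PZ[OF \<theta>] unfolding distrib_right by simp
    finally have "(L2 (\<lambda>\<omega>. prim (\<lambda>s. U s \<omega>) T))\<^sup>2 \<le> (((1 + (1 + \<rho>) / \<rho>) / \<rho> + (1 + (1 + \<theta>) / \<theta>) / \<theta>) * T powr H)\<^sup>2"
      by (intro power_mono) auto
    also have "\<dots> = ((1 + (1 + \<rho>) / \<rho>) / \<rho> + (1 + (1 + \<theta>) / \<theta>) / \<theta>)\<^sup>2 * T powr (2 * H)"
      by (simp add: power_mult_distrib power2_eq_square[of "T powr H"] flip: powr_add)
    finally show ?thesis by (simp only: L2_square)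
  qed
  show ?thesis
  proof (rule that[of "\<kappa> * ((1 + (1 + \<rho>) / \<rho>) / \<rho> + (1 + (1 + \<theta>) / \<theta>) / \<theta>)\<^sup>2 + 1"])
    let ?c = "\<kappa> * ((1 + (1 + \<rho>) / \<rho>) / \<rho> + (1 + (1 + \<theta>) / \<theta>) / \<theta>)\<^sup>2"
    have "?c \<ge> 0" using \<kappa> by simp
    then show "?c + 1 > 0" by simp
    fix T :: real assume T: "T \<ge> 1"
    show "integrable M (\<lambda>\<omega>. (A T \<omega> - prim xvar T)\<^sup>2)" using main[of T] T by simp
    have "expectation (\<lambda>\<omega>. (A T \<omega> - prim xvar T)\<^sup>2) \<le> \<kappa> * expectation (\<lambda>\<omega>. (prim (\<lambda>s. U s \<omega>) T)\<^sup>2)" using main[of T] T by simp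
    also have "\<dots> \<le> \<kappa> * (((1 + (1 + \<rho>) / \<rho>) / \<rho> + (1 + (1 + \<theta>) / \<theta>) / \<theta>)\<^sup>2 * T powr (2 * H))"
      by (intro mult_left_mono UB T \<kappa>)
    also have "\<dots> \<le> (?c + 1) * T powr (2 * H)" by (simp add: distrib_right mult.assoc)
    finally show "expectation (\<lambda>\<omega>. (A T \<omega> - prim xvar T)\<^sup>2) \<le> (?c + 1) * T powr (2 * H)" .
  qed
qed

end

section \<open>Almost sure asymptotics\<close>

text \<open>The pairs with codes up to N lie in the square \<open>{..N} \<times> {..N}\<close>, over
  which the double sum is a product of partial sums.\<close>

lemma summable_prod_decode:
  fixes f g :: "nat \<Rightarrow> real"
  assumes f: "summable f" "\<And>n. f n \<ge> 0" and g: "summable g" "\<And>n. g n \<ge> 0"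
  shows "summable (\<lambda>i. f (fst (prod_decode i)) * g (snd (prod_decode i)))"
proof (rule bounded_imp_summable)
  fix N
  have le: "fst (prod_decode i) \<le> i" "snd (prod_decode i) \<le> i" for i
    using le_prod_encode_1[of "fst (prod_decode i)" "snd (prod_decode i)"]
      le_prod_encode_2[of "snd (prod_decode i)" "fst (prod_decode i)"] by simp_all
  have "(\<Sum>i\<le>N. f (fst (prod_decode i)) * g (snd (prod_decode i))) = (\<Sum>p\<in>prod_decode ` {..N}. f (fst p) * g (snd p))"
    by (subst sum.reindex) (auto intro: inj_on_subset[OF inj_prod_decode])
  also have "\<dots> \<le> (\<Sum>p\<in>{..N} \<times> {..N}. f (fst p) * g (snd p))"
  proof (rule sum_mono2)
    show "prod_decode ` {..N} \<subseteq> {..N} \<times> {..N}"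
    proof
      fix p assume "p \<in> prod_decode ` {..N}"
      then obtain i where "p = prod_decode i" "i \<le> N" by auto
      then show "p \<in> {..N} \<times> {..N}" using le[of i] by (simp add: mem_Times_iff)
    qed
  qed (use f g in auto)
  also have "\<dots> = (\<Sum>a\<le>N. f a) * (\<Sum>b\<le>N. g b)"
    by (simp add: sum_product sum.cartesian_product case_prod_beta)
  also have "\<dots> \<le> suminf f * suminf g"
    using f g by (intro mult_mono sum_le_suminf sum_nonneg suminf_nonneg) auto
  finally show "(\<Sum>i\<le>N. f (fst (prod_decode i)) * g (snd (prod_decode i))) \<le> suminf f * suminf g" .
qed (use f g in auto)

lemma summable_inverse_Suc_square: "summable (\<lambda>n. c / (real (Suc n))\<^sup>2)"
proof -
  have "summable (\<lambda>n. inverse (real (Suc n)) ^ 2)"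
    using inverse_power_summable[of 2, where 'a = real] by (subst summable_Suc_iff) (simp add: power_inverse)
  then have "summable (\<lambda>n. c * inverse (real (Suc n)) ^ 2)" by (rule summable_mult)
  then show ?thesis by (simp add: divide_inverse power_inverse)
qed

text \<open>Between two grid points monotonicity bounds the difference by its values at both ends
  plus the growth of \<open>Q\<close>, at most L (a (n + 1) - a n). As the ratios tend to 1, this
  growth is negligible against T.\<close>

lemma tendsto_0_along_grid:
  fixes d :: "real \<Rightarrow> real" and a :: "nat \<Rightarrow> real"
  assumes mono: "\<And>s t. s \<le> t \<Longrightarrow> P s \<le> P t" and lip: "\<And>s t. s \<le> t \<Longrightarrow> Q s \<le> Q t \<and> Q t - Q s \<le> L * (t - s)" and L: "L \<ge> 0"
    and a: "\<And>n. a n \<ge> real (Suc n)" "\<And>n. a n \<le> a (Suc n)" and ratio: "(\<lambda>n. a (Suc n) / a n) \<longlonglongrightarrow> 1"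
    and lim: "(\<lambda>n. (P (a n) - Q (a n)) / a n) \<longlonglongrightarrow> 0"
  shows "((\<lambda>T. (P T - Q T) / T) \<longlongrightarrow> 0) at_top"
proof -
  define e where "e n = \<bar>(P (a n) - Q (a n)) / a n\<bar>" for n
  define r where "r n = a (Suc n) / a n" for n
  define b where "b n = e (Suc n) * r n + e n + L * (r n - 1)" for n
  have a0: "a n > 0" for n using a(1)[of n] by simp
  have r1: "r n \<ge> 1" for n using a(2)[of n] a0[of n] by (simp add: r_def)
  have e0: "e \<longlonglongrightarrow> 0" unfolding e_def by (rule tendsto_rabs_zero[OF lim])
  have "b \<longlonglongrightarrow> 0 * 1 + 0 + L * (1 - 1)"
    unfolding b_def r_def using e0 ratio by (intro tendsto_intros LIMSEQ_Suc[OF e0])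
  then have b: "b \<longlonglongrightarrow> 0" by simp
  have bound: "\<bar>(P T - Q T) / T\<bar> \<le> b n" if T: "a n \<le> T" "T \<le> a (Suc n)" for n T
  proof -
    have T0: "T > 0" using a0[of n] T by linarith
    define p p' where "p = P (a n) - Q (a n)" and "p' = P (a (Suc n)) - Q (a (Suc n))"
    have inc: "Q (a (Suc n)) - Q (a n) \<le> L * (a (Suc n) - a n)" using lip[OF a(2)] by blast
    have "P T - Q T \<le> p' + L * (a (Suc n) - a n)" "p - L * (a (Suc n) - a n) \<le> P T - Q T"
      using mono[OF T(1)] mono[OF T(2)] lip[OF T(1)] lip[OF T(2)] inc unfolding p_def p'_def by linarith+
    moreover have "0 \<le> L * (a (Suc n) - a n)" using L a(2)[of n] by simp
    ultimately have "\<bar>P T - Q T\<bar> \<le> \<bar>p'\<bar> + \<bar>p\<bar> + L * (a (Suc n) - a n)" by linarith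
    also have "\<dots> = a n * b n"
      using a0[of n] a0[of "Suc n"] by (simp add: b_def e_def r_def p_def p'_def abs_divide field_simps)
    also have "\<dots> \<le> T * b n"
    proof (rule mult_right_mono[OF T(1)])
      show "0 \<le> b n" unfolding b_def using r1[of n] L by (simp add: e_def)
    qed
    finally show ?thesis using T0 by (simp add: abs_divide field_simps)
  qed
  show ?thesis
  proof (rule tendstoI)
    fix \<epsilon> :: real assume "\<epsilon> > 0"
    then have "\<forall>\<^sub>F n in sequentially. b n < \<epsilon>" using b by (rule order_tendstoD(2)[rotated])
    then obtain N where N: "\<And>n. n \<ge> N \<Longrightarrow> b n < \<epsilon>" unfolding eventually_sequentially by blast
    show "\<forall>\<^sub>F T in at_top. dist ((P T - Q T) / T) 0 < \<epsilon>"
      unfolding eventually_at_top_linorder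
    proof (intro exI[of _ "a N"] allI impI)
      fix T assume T: "a N \<le> T"
      \<comment> \<open>\<open>Max I\<close> is the last grid index not beyond T; it exists because
        a n \<ge> n + 1 makes \<open>I\<close> finite.\<close>
      define I where "I = {n. a n \<le> T}"
      have "finite I"
      proof (rule finite_subset)
        show "I \<subseteq> {.. nat \<lceil>T\<rceil>}"
        proof
          fix n assume "n \<in> I"
          then have "real n \<le> T" using a(1)[of n] by (simp add: I_def)
          then show "n \<in> {.. nat \<lceil>T\<rceil>}" by (simp, linarith)
        qed
      qed simp
      have NI: "N \<in> I" using T by (simp add: I_def)
      have m: "Max I \<in> I" "Max I \<ge> N"
        using NI by (auto intro!: Max_in Max_ge \<open>finite I\<close>)
      have "Suc (Max I) \<notin> I" using Max_ge[OF \<open>finite I\<close>, of "Suc (Max I)"] by auto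
      with m(1)
      have "\<bar>(P T - Q T) / T\<bar> \<le> b (Max I)" by (intro bound) (auto simp: I_def)
      then show "dist ((P T - Q T) / T) 0 < \<epsilon>" using N[OF m(2)] by simp
    qed
  qed
qed

section \<open>Pathwise growth, law of large numbers, limit of the estimator\<close>

context fbm_ou
begin

text \<open>Dyadic chaining on \<open>[n, n + 1]\<close> with fourth moments. Enumerating the pairs of interval and
  dyadic level as one sequence makes the almost sure convergence uniform in the level.\<close>

lemma X_square_sublinear: "AE \<omega> in M. ((\<lambda>T. (X T \<omega>)\<^sup>2 / T) \<longlongrightarrow> 0) at_top"
proof -
  obtain K where K: "K > 0" "\<And>t. L2 (X t) \<le> K" "\<And>t. L2 (S t) \<le> K" by (rule L2_bounds) blast
  obtain C where C: "C > 0" "\<And>s t. \<bar>t - s\<bar> \<le> 1 \<Longrightarrow> L2 (\<lambda>\<omega>. X t \<omega> - X s \<omega>) \<le> C * sqrt \<bar>t - s\<bar>" by (rule X_increment_bound) blast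
  \<comment> \<open>The expected sum of fourth powers at level k is of order 2^(-k) = p^k p^k. One
    factor p^k normalises \<open>R\<close>, the other is left for summability over k, and p = q^4
    turns the normalisation into increments of size q^k after the fourth root.\<close>
  define q p :: real where "q = (1 / 2) powr (1 / 8)" and "p = q ^ 4"
  have q: "0 < q" "q < 1" unfolding q_def using powr_less_mono2[of "1 / 8" "1 / 2" 1] by simp_all
  have p: "0 < p" "p < 1" using q by (auto simp: p_def power_less_one_iff)
  have pp: "p * p = 1 / 2"
    unfolding p_def q_def by (simp add: powr_power flip: powr_add power_add)
  define D where "D n k j \<omega> = X (real n + real (Suc j) / 2 ^ k) \<omega> - X (real n + real j / 2 ^ k) \<omega>" for n k j \<omega>
  define R where "R n k \<omega> = (\<Sum>j<(2::nat) ^ k. (D n k j \<omega>)\<^sup>2 * (D n k j \<omega>)\<^sup>2) / (p ^ k * (real (Suc n))\<^sup>2)" for n k \<omega>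
  have DG: "D n k j \<in> chaos" for n k j unfolding D_def[abs_def] by (intro chaos_diff X_chaos)
  have Di: "integrable M (\<lambda>\<omega>. (D n k j \<omega>)\<^sup>2 * (D n k j \<omega>)\<^sup>2)" for n k j
    by (rule chaos_square_prod_integrable[OF DG DG])
  have DL: "L2 (D n k j) \<le> C * sqrt (1 / 2 ^ k)" for n k j
  proof -
    have e: "(real n + real (Suc j) / 2 ^ k) - (real n + real j / 2 ^ k) = 1 / 2 ^ k"
      by (simp add: field_simps)
    have "\<bar>1 / 2 ^ k :: real\<bar> \<le> 1" by simp
    then show ?thesis
      using C(2)[of "real n + real (Suc j) / 2 ^ k" "real n + real j / 2 ^ k"] unfolding e D_def[abs_def] by simp
  qed
  have Ri: "integrable M (R n k)" for n k
    unfolding R_def[abs_def] by (intro integrable_divide Bochner_Integration.integrable_sum Di)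
  have Rnn: "R n k \<omega> \<ge> 0" for n k \<omega>
    unfolding R_def using p by (intro divide_nonneg_nonneg sum_nonneg) auto
  have RE: "expectation (R n k) \<le> (3 * C ^ 4 / (real (Suc n))\<^sup>2) * p ^ k" for n k
  proof -
    have d4: "expectation (\<lambda>\<omega>. (D n k j \<omega>)\<^sup>2 * (D n k j \<omega>)\<^sup>2) \<le> 3 * C ^ 4 * ((1 / 2) ^ k * (1 / 2) ^ k)" for j
    proof -
      have "(L2 (D n k j)) ^ 4 \<le> (C * sqrt (1 / 2 ^ k)) ^ 4" by (intro power_mono DL) simp
      also have "\<dots> = C ^ 4 * ((sqrt (1 / 2 ^ k))\<^sup>2 * (sqrt (1 / 2 ^ k))\<^sup>2)"
        unfolding power4_eq_xxxx power2_eq_square by (simp only: mult_ac)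
      also have "(sqrt (1 / 2 ^ k))\<^sup>2 = (1 / 2) ^ k" by (simp add: power_divide)
      finally show ?thesis unfolding fourth_moment[OF DG] by simp
    qed
    have "expectation (R n k) = (\<Sum>j<(2::nat) ^ k. expectation (\<lambda>\<omega>. (D n k j \<omega>)\<^sup>2 * (D n k j \<omega>)\<^sup>2)) / (p ^ k * (real (Suc n))\<^sup>2)"
      unfolding R_def[abs_def] by (simp only: integral_divide_zero Bochner_Integration.integral_sum[OF Di])
    also have "\<dots> \<le> (\<Sum>j<(2::nat) ^ k. 3 * C ^ 4 * ((1 / 2) ^ k * (1 / 2) ^ k)) / (p ^ k * (real (Suc n))\<^sup>2)"
      using p by (intro divide_right_mono sum_mono d4) auto
    also have "(\<Sum>j<(2::nat) ^ k. 3 * C ^ 4 * ((1 / 2) ^ k * (1 / 2) ^ k)) = 3 * C ^ 4 * (1 / 2) ^ k"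
      by (simp add: power_divide)
    also have "(1 / 2 :: real) ^ k = p ^ k * p ^ k" unfolding pp[symmetric] by (rule power_mult_distrib)
    also have "3 * C ^ 4 * (p ^ k * p ^ k) / (p ^ k * (real (Suc n))\<^sup>2) = (3 * C ^ 4 / (real (Suc n))\<^sup>2) * p ^ k"
      using p by (simp add: field_simps)
    finally show ?thesis .
  qed
  have R0: "AE \<omega> in M. (\<lambda>i. R (fst (prod_decode i)) (snd (prod_decode i)) \<omega>) \<longlonglongrightarrow> 0"
  proof (rule AE_tendsto_zero_of_summable_expectation[OF Ri Rnn RE])
    show "summable (\<lambda>i. 3 * C ^ 4 / (real (Suc (fst (prod_decode i))))\<^sup>2 * p ^ snd (prod_decode i))"
      by (rule summable_prod_decode[OF summable_inverse_Suc_square _ summable_geometric]) (use p C in auto)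
  qed
  have "AE \<omega> in M. (\<lambda>n. (X (real n) \<omega>)\<^sup>2 * (X (real n) \<omega>)\<^sup>2 / (real (Suc n))\<^sup>2) \<longlonglongrightarrow> 0"
  proof (rule AE_tendsto_zero_of_summable_expectation[OF _ _ _ summable_inverse_Suc_square[of "3 * K ^ 4"]])
    fix n
    show "integrable M (\<lambda>\<omega>. (X (real n) \<omega>)\<^sup>2 * (X (real n) \<omega>)\<^sup>2 / (real (Suc n))\<^sup>2)"
      by (intro integrable_divide chaos_square_prod_integrable X_chaos)
    have "3 * L2 (X (real n)) ^ 4 \<le> 3 * K ^ 4" by (intro mult_left_mono power_mono K) auto
    then show "expectation (\<lambda>\<omega>. (X (real n) \<omega>)\<^sup>2 * (X (real n) \<omega>)\<^sup>2 / (real (Suc n))\<^sup>2) \<le> 3 * K ^ 4 / (real (Suc n))\<^sup>2"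
      by (simp only: integral_divide_zero fourth_moment[OF X_chaos]) (intro divide_right_mono, auto)
  qed simp
  with R0 show ?thesis
  proof eventually_elim
    fix \<omega>
    assume R: "(\<lambda>i. R (fst (prod_decode i)) (snd (prod_decode i)) \<omega>) \<longlonglongrightarrow> 0"
      and Q: "(\<lambda>n. (X (real n) \<omega>)\<^sup>2 * (X (real n) \<omega>)\<^sup>2 / (real (Suc n))\<^sup>2) \<longlonglongrightarrow> 0"
    \<comment> \<open>The summand 1 stands for the value at the integer time, the fraction for the
      geometric series of the chaining.\<close>
    define c where "c = 1 + 1 / (1 - q)"
    have c: "c > 0" using q by (simp add: c_def add_pos_pos)
    show "((\<lambda>T. (X T \<omega>)\<^sup>2 / T) \<longlongrightarrow> 0) at_top"
    proof (rule tendstoI)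
      fix e :: real assume e: "e > 0"
      \<comment> \<open>Chosen such that (w c)^2 below is e / 4 times n + 1, hence at most e T /
        2.\<close>
      define h where "h = sqrt (e / (4 * c\<^sup>2))"
      have h: "h > 0" "h\<^sup>2 = e / (4 * c\<^sup>2)" using e c by (simp_all add: h_def)
      then have h4: "h ^ 4 > 0" by simp
      obtain I where I: "\<And>i. i \<ge> I \<Longrightarrow> R (fst (prod_decode i)) (snd (prod_decode i)) \<omega> < h ^ 4"
        using order_tendstoD(2)[OF R h4] unfolding eventually_sequentially by blast
      obtain J where J: "\<And>n. n \<ge> J \<Longrightarrow> (X (real n) \<omega>)\<^sup>2 * (X (real n) \<omega>)\<^sup>2 / (real (Suc n))\<^sup>2 < h ^ 4"
        using order_tendstoD(2)[OF Q h4] unfolding eventually_sequentially by blast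
      \<comment> \<open>Uniformity in the level k: the code of (n, k) is at least n.\<close>
      have RI: "R n k \<omega> < h ^ 4" if "n \<ge> I" for n k
        using I[of "prod_encode (n, k)"] le_prod_encode_1[of n k] that by simp
      show "\<forall>\<^sub>F T in at_top. dist ((X T \<omega>)\<^sup>2 / T) 0 < e"
        unfolding eventually_at_top_linorder
      proof (intro exI[of _ "real (max I J) + 1"] allI impI)
        fix T :: real assume T: "real (max I J) + 1 \<le> T"
        define n where "n = nat \<lfloor>T\<rfloor>"
        define x where "x = T - real n"
        define w where "w = h * sqrt (real (Suc n))"
        have "real n = real_of_int \<lfloor>T\<rfloor>" using T by (simp add: n_def)
        then have x: "0 \<le> x" "x < 1" "T = real n + x" unfolding x_def by linarith+
        have "real (max I J) < real n" using T x by linarith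
        then have n: "n \<ge> I" "n \<ge> J" "n \<ge> 1" by auto
        have w: "w > 0" "w ^ 4 = h ^ 4 * (real (Suc n))\<^sup>2"
        proof -
          show "w > 0" using h by (simp add: w_def)
          have "(sqrt y) ^ 4 = y\<^sup>2" if "y \<ge> 0" for y
            using power_mult[of "sqrt y" 2 2] that by simp
          then show "w ^ 4 = h ^ 4 * (real (Suc n))\<^sup>2" unfolding w_def power_mult_distrib by (simp only: of_nat_0_le_iff)
        qed
        have root4: "\<bar>y\<bar> \<le> z" if "y\<^sup>2 * y\<^sup>2 \<le> z ^ 4" "z \<ge> 0" for y z :: real
        proof -
          have "(y\<^sup>2)\<^sup>2 \<le> (z\<^sup>2)\<^sup>2" using that(1) by simp
          then have "y\<^sup>2 \<le> z\<^sup>2" by (rule power2_le_imp_le) simp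
          then have "\<bar>y\<bar> \<le> \<bar>z\<bar>" by (simp only: abs_le_square_iff)
          then show ?thesis using that(2) by simp
        qed
        have "\<bar>X (real n + x) \<omega> - X (real n) \<omega>\<bar> \<le> w / (1 - q)"
        proof (rule dyadic_chaining)
          fix k j :: nat assume j: "j < 2 ^ k"
          have "(D n k j \<omega>)\<^sup>2 * (D n k j \<omega>)\<^sup>2 \<le> (\<Sum>j<(2::nat) ^ k. (D n k j \<omega>)\<^sup>2 * (D n k j \<omega>)\<^sup>2)"
            using j by (intro member_le_sum) auto
          also have "\<dots> = R n k \<omega> * (p ^ k * (real (Suc n))\<^sup>2)" using p by (simp add: R_def)
          also have "\<dots> \<le> h ^ 4 * (p ^ k * (real (Suc n))\<^sup>2)"
            using RI[OF n(1), of k] p by (intro mult_right_mono) auto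
          also have "\<dots> = (w * q ^ k) ^ 4"
            unfolding power_mult_distrib w(2) p_def by (simp add: mult_ac flip: power_mult)
          finally have "\<bar>D n k j \<omega>\<bar> \<le> w * q ^ k" using w(1) q by (intro root4) auto
          then show "\<bar>X (real n + real (Suc j) / 2 ^ k) \<omega> - X (real n + real j / 2 ^ k) \<omega>\<bar> \<le> w * q ^ k"
            by (simp only: D_def)
        qed (use q w x path0_continuous_on[OF X_path0] in auto)
        moreover have "\<bar>X (real n) \<omega>\<bar> \<le> w"
        proof (rule root4)
          have "(X (real n) \<omega>)\<^sup>2 * (X (real n) \<omega>)\<^sup>2 < h ^ 4 * (real (Suc n))\<^sup>2"
            using J[OF n(2)] by (simp only: divide_less_eq) (simp split: if_splits)
          then show "(X (real n) \<omega>)\<^sup>2 * (X (real n) \<omega>)\<^sup>2 \<le> w ^ 4" unfolding w(2) by simp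
        qed (use w in simp)
        ultimately have "\<bar>X T \<omega>\<bar> \<le> w * c"
          unfolding x(3)[symmetric] c_def by (simp add: algebra_simps)
        then have "(X T \<omega>)\<^sup>2 \<le> (w * c)\<^sup>2" using w c by (simp add: abs_le_square_iff[symmetric])
        also have "(w * c)\<^sup>2 = h\<^sup>2 * c\<^sup>2 * real (Suc n)" by (simp add: w_def power_mult_distrib)
        also have "\<dots> = e / 4 * real (Suc n)" using h c by simp
        also have "\<dots> \<le> e / 4 * (2 * T)" using n x e by (intro mult_left_mono) auto
        finally have "(X T \<omega>)\<^sup>2 / T \<le> e / 2" using T by (simp add: field_simps)
        with e have lt: "(X T \<omega>)\<^sup>2 / T < e" by linarith
        have "0 \<le> (X T \<omega>)\<^sup>2 / T" using T by (intro divide_nonneg_nonneg) simp_all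
        with lt show "dist ((X T \<omega>)\<^sup>2 / T) 0 < e" unfolding dist_real_def diff_0_right by (simp only: abs_of_nonneg)
      qed
    qed
  qed
qed

lemma xvar_increments:
  obtains L where "L \<ge> 0" "\<And>s t. s \<le> t \<Longrightarrow> prim xvar s \<le> prim xvar t \<and> prim xvar t - prim xvar s \<le> L * (t - s)"
proof -
  obtain K where K: "K > 0" "\<And>t. L2 (X t) \<le> K" "\<And>t. L2 (S t) \<le> K" by (rule L2_bounds) blast
  have xb: "\<bar>xvar t\<bar> \<le> K\<^sup>2" for t
    using power_mono[OF K(2)[of t] L2_nonneg, of 2] by (simp add: xvar_def L2_square)
  show ?thesis
  proof (rule that[of "K\<^sup>2"])
    fix s t :: real assume st: "s \<le> t"
    have "\<bar>prim xvar t - prim xvar s\<bar> \<le> K\<^sup>2 * \<bar>t - s\<bar>"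
      using field_differentiable_bound[of UNIV "prim xvar" xvar "K\<^sup>2" t s] xb prim_has_derivative[OF xvar_path0]
      by (auto simp: has_field_derivative_at_within)
    then show "prim xvar s \<le> prim xvar t \<and> prim xvar t - prim xvar s \<le> K\<^sup>2 * (t - s)"
      using st prim_nonneg_mono[OF xvar_path0 xvar_nonneg st] by simp
  qed simp
qed

text \<open>Variances of order T^(2 H), divided by T^2, are summable along a polynomial grid of high
  degree. Such a grid still has ratios tending to 1, so monotonicity fills the gaps.\<close>

lemma A_law_of_large_numbers: "AE \<omega> in M. ((\<lambda>T. (A T \<omega> - prim xvar T) / T) \<longlongrightarrow> 0) at_top"
proof -
  obtain C where C: "C > 0" "\<And>T. T \<ge> 1 \<Longrightarrow> integrable M (\<lambda>\<omega>. (A T \<omega> - prim xvar T)\<^sup>2)"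
    "\<And>T. T \<ge> 1 \<Longrightarrow> expectation (\<lambda>\<omega>. (A T \<omega> - prim xvar T)\<^sup>2) \<le> C * T powr (2 * H)" by (rule variance_A) blast
  obtain L where L: "L \<ge> 0" "\<And>s t. s \<le> t \<Longrightarrow> prim xvar s \<le> prim xvar t \<and> prim xvar t - prim xvar s \<le> L * (t - s)"
    by (rule xvar_increments) blast
  \<comment> \<open>The degree is taken so large that m (2 - 2 H) \<ge> 2; the normalised variances
    are then at most C / (n + 1)^2.\<close>
  obtain m :: nat where m: "1 / (1 - H) \<le> real m" using real_arch_simple by blast
  have m2: "real m * (2 - 2 * H) \<ge> 2" using m H by (simp add: field_simps)
  have "1 / (1 - H) > 0" using H by simp
  then have m1: "m \<ge> 1" using m by (cases m) auto
  define a where "a n = real (Suc n) ^ m" for n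
  have a1: "a n \<ge> real (Suc n)" for n
    unfolding a_def using power_increasing[OF m1, of "real (Suc n)"] by simp
  have a2: "a n \<le> a (Suc n)" for n unfolding a_def by (intro power_mono) auto
  have ratio: "(\<lambda>n. a (Suc n) / a n) \<longlonglongrightarrow> 1"
  proof -
    have "(\<lambda>n. 1 + 1 / real (Suc n)) \<longlonglongrightarrow> 1 + 0"
      by (intro tendsto_intros) (rule lim_1_over_n[THEN LIMSEQ_Suc])
    then have "(\<lambda>n. (1 + 1 / real (Suc n)) ^ m) \<longlonglongrightarrow> (1 + 0) ^ m" by (rule tendsto_power)
    moreover have "a (Suc n) / a n = (1 + 1 / real (Suc n)) ^ m" for n
    proof -
      have "1 + 1 / real (Suc n) = real (Suc (Suc n)) / real (Suc n)" by (simp add: field_simps)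
      then show ?thesis unfolding a_def power_divide[symmetric] by (simp only:)
    qed
    ultimately show ?thesis by simp
  qed
  have "AE \<omega> in M. (\<lambda>n. ((A (a n) \<omega> - prim xvar (a n)) / a n)\<^sup>2) \<longlonglongrightarrow> 0"
  proof (rule AE_tendsto_zero_of_summable_expectation[OF _ _ _ summable_inverse_Suc_square[of C]])
    fix n
    have an: "a n \<ge> 1" using a1[of n] by simp
    show "integrable M (\<lambda>\<omega>. ((A (a n) \<omega> - prim xvar (a n)) / a n)\<^sup>2)"
      unfolding power_divide by (intro integrable_divide C(2) an)
    have "expectation (\<lambda>\<omega>. ((A (a n) \<omega> - prim xvar (a n)) / a n)\<^sup>2) = expectation (\<lambda>\<omega>. (A (a n) \<omega> - prim xvar (a n))\<^sup>2) / (a n)\<^sup>2"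
      unfolding power_divide by simp
    also have "\<dots> \<le> C * a n powr (2 * H) / (a n)\<^sup>2" by (intro divide_right_mono C(3) an) simp
    also have "\<dots> = C * a n powr (2 * H - 2)"
    proof -
      have "a n powr 2 = (a n)\<^sup>2" using an powr_realpow[of "a n" 2] by simp
      then show ?thesis by (simp add: powr_diff)
    qed
    also have "a n powr (2 * H - 2) = real (Suc n) powr (- (real m * (2 - 2 * H)))"
    proof -
      have "a n = real (Suc n) powr real m" unfolding a_def by (rule powr_realpow[symmetric]) simp
      moreover have "real m * (2 * H - 2) = - (real m * (2 - 2 * H))" by (simp add: algebra_simps)
      ultimately show ?thesis by (simp only: powr_powr)
    qed
    also have "C * \<dots> \<le> C * real (Suc n) powr (- 2)"
      using m2 C(1) by (intro mult_left_mono powr_mono) auto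
    also have "\<dots> = C / (real (Suc n))\<^sup>2"
      using powr_realpow[of "real (Suc n)" 2] by (simp add: powr_minus divide_inverse)
    finally show "expectation (\<lambda>\<omega>. ((A (a n) \<omega> - prim xvar (a n)) / a n)\<^sup>2) \<le> C / (real (Suc n))\<^sup>2" .
  qed simp
  then show ?thesis
  proof eventually_elim
    fix \<omega> assume "(\<lambda>n. ((A (a n) \<omega> - prim xvar (a n)) / a n)\<^sup>2) \<longlonglongrightarrow> 0"
    then have "(\<lambda>n. (A (a n) \<omega> - prim xvar (a n)) / a n) \<longlonglongrightarrow> 0"
      using tendsto_real_sqrt[of "\<lambda>n. ((A (a n) \<omega> - prim xvar (a n)) / a n)\<^sup>2" 0] by (simp add: tendsto_rabs_zero_iff)
    moreover have "A s \<omega> \<le> A t \<omega>" if "s \<le> t" for s t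
      unfolding A_def by (rule prim_nonneg_mono[OF path0_square[OF X_path0] _ that]) simp
    ultimately show "((\<lambda>T. (A T \<omega> - prim xvar T) / T) \<longlongrightarrow> 0) at_top"
      by (intro tendsto_0_along_grid[where a = a and L = L] L a1 a2 ratio)
  qed
qed

text \<open>The expectation of the process \<open>Y\<close> defined below. The first and the last
  term stay bounded in T; the middle one grows linearly.\<close>

definition EY :: "real \<Rightarrow> real" where
  "EY T = xvar T / 2 + (\<theta> + \<rho>) * prim xvar T + \<theta> * \<rho> * expectation (\<lambda>\<omega>. (S T \<omega>)\<^sup>2) / 2"

text \<open>After subtraction of \<theta> + \<rho> the quotient is \<open>u T\<close> over
  \<open>A T \<omega> / T\<close>. The numerator collects the bounded part of \<open>EY\<close>, the
  square of \<open>X\<close> and the fluctuation of \<open>A\<close>, all divided by T and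
  vanishing; the denominator stays away from 0.\<close>

lemma estimator_limit: "AE \<omega> in M. ((\<lambda>T. (EY T - (X T \<omega>)\<^sup>2 / 2) / A T \<omega>) \<longlongrightarrow> \<theta> + \<rho>) at_top"
  using X_square_sublinear A_law_of_large_numbers
proof eventually_elim
  fix \<omega>
  assume x: "((\<lambda>T. (X T \<omega>)\<^sup>2 / T) \<longlongrightarrow> 0) at_top" and a: "((\<lambda>T. (A T \<omega> - prim xvar T) / T) \<longlongrightarrow> 0) at_top"
  obtain K where K: "K > 0" "\<And>t. L2 (X t) \<le> K" "\<And>t. L2 (S t) \<le> K" by (rule L2_bounds) blast
  obtain c where c: "c > 0" "\<And>T. 0 \<le> T \<Longrightarrow> prim xvar T \<ge> c * (T - 3)" by (rule prim_xvar_lower) blast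
  have K2: "xvar T \<le> K\<^sup>2" "expectation (\<lambda>\<omega>. (S T \<omega>)\<^sup>2) \<le> K\<^sup>2" for T
    using power_mono[OF K(2)[of T] L2_nonneg, of 2] power_mono[OF K(3)[of T] L2_nonneg, of 2] by (simp_all add: xvar_def L2_square)
  define k where "k = (1 + \<theta> * \<rho>) * K\<^sup>2 / 2"
  define r where "r T = xvar T / 2 + \<theta> * \<rho> * expectation (\<lambda>\<omega>. (S T \<omega>)\<^sup>2) / 2" for T
  have rb: "0 \<le> r T" "r T \<le> k" for T
  proof -
    have "\<theta> * \<rho> * expectation (\<lambda>\<omega>. (S T \<omega>)\<^sup>2) \<le> \<theta> * \<rho> * K\<^sup>2" using \<theta> \<rho> K2(2) by (intro mult_left_mono) auto
    then show "r T \<le> k" using K2(1)[of T] by (simp add: r_def k_def algebra_simps)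
    show "0 \<le> r T" unfolding r_def using \<theta> \<rho> xvar_nonneg by simp
  qed
  have k0: "((\<lambda>T::real. k / T) \<longlongrightarrow> 0) at_top" by (intro tendsto_divide_0[OF tendsto_const] filterlim_at_top_imp_at_infinity filterlim_ident)
  have r0: "((\<lambda>T. r T / T) \<longlongrightarrow> 0) at_top"
  proof (rule tendsto_sandwich[OF _ _ tendsto_const k0])
    show "\<forall>\<^sub>F T in at_top. 0 \<le> r T / T"
      using eventually_gt_at_top[of 0] by eventually_elim (simp add: rb)
    show "\<forall>\<^sub>F T in at_top. r T / T \<le> k / T"
      using eventually_gt_at_top[of 0] by eventually_elim (simp add: divide_right_mono rb)
  qed
  define u where "u T = r T / T - (X T \<omega>)\<^sup>2 / T / 2 - (\<theta> + \<rho>) * ((A T \<omega> - prim xvar T) / T)" for T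
  have "(u \<longlongrightarrow> 0 - 0 / 2 - (\<theta> + \<rho>) * 0) at_top" unfolding u_def[abs_def] by (intro tendsto_intros r0 x a) simp
  then have u0: "((\<lambda>T. \<bar>u T\<bar> / (c / 4)) \<longlongrightarrow> 0) at_top"
    by (intro tendsto_divide_zero) (simp add: tendsto_rabs_zero)
  \<comment> \<open>For T \<ge> 6 the expected value is at least c T / 2, and the fluctuation
    eventually costs at most c T / 4.\<close>
  have Ab: "\<forall>\<^sub>F T in at_top. A T \<omega> / T \<ge> c / 4"
  proof -
    have "\<forall>\<^sub>F T in at_top. (A T \<omega> - prim xvar T) / T > - (c / 4)"
      by (rule order_tendstoD(1)[OF a]) (use c in simp)
    then show ?thesis using eventually_ge_at_top[of 6]
    proof eventually_elim
      case (elim T)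
      have "c * (T - 3) \<ge> c * (T / 2)" using elim c by (intro mult_left_mono) auto
      then have "prim xvar T \<ge> c / 2 * T" using c(2)[of T] elim by simp
      then have "prim xvar T / T \<ge> c / 2" using elim by (simp add: pos_le_divide_eq)
      then show ?case using elim unfolding diff_divide_distrib by linarith
    qed
  qed
  have "((\<lambda>T. (EY T - (X T \<omega>)\<^sup>2 / 2) / A T \<omega> - (\<theta> + \<rho>)) \<longlongrightarrow> 0) at_top"
  proof (rule Lim_null_comparison[OF _ u0])
    show "\<forall>\<^sub>F T in at_top. norm ((EY T - (X T \<omega>)\<^sup>2 / 2) / A T \<omega> - (\<theta> + \<rho>)) \<le> \<bar>u T\<bar> / (c / 4)"
      using Ab eventually_gt_at_top[of 0]
    proof eventually_elim
      case (elim T)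
      have AT: "A T \<omega> / T > 0" by (rule less_le_trans[OF _ elim(1)]) (use c(1) in simp)
      have A0: "A T \<omega> \<noteq> 0"
      proof
        assume "A T \<omega> = 0"
        with AT show False by simp
      qed
      have gen: "r / T - x / T / 2 - w * ((y - z) / T) = (r + w * z - x / 2 - w * y) / T" for r x w y z :: real
        by (simp only: diff_divide_distrib add_divide_distrib right_diff_distrib times_divide_eq_right divide_divide_eq_left mult.commute[of T 2])
      have ey: "EY T = r T + (\<theta> + \<rho>) * prim xvar T" by (simp add: EY_def r_def)
      have "u T = (EY T - (X T \<omega>)\<^sup>2 / 2 - (\<theta> + \<rho>) * A T \<omega>) / T"
        unfolding u_def ey by (rule gen)
      then have "u T / (A T \<omega> / T) = (EY T - (X T \<omega>)\<^sup>2 / 2 - (\<theta> + \<rho>) * A T \<omega>) / A T \<omega>"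
        using elim(2) by (simp only: divide_divide_eq_left divide_divide_eq_right) simp
      also have "\<dots> = (EY T - (X T \<omega>)\<^sup>2 / 2) / A T \<omega> - (\<theta> + \<rho>)"
        using A0 by (simp only: diff_divide_distrib) simp
      finally have "norm ((EY T - (X T \<omega>)\<^sup>2 / 2) / A T \<omega> - (\<theta> + \<rho>)) = norm (u T / (A T \<omega> / T))"
        by (rule arg_cong[OF sym])
      also have "\<dots> = \<bar>u T\<bar> / (A T \<omega> / T)"
        using AT unfolding real_norm_def abs_divide[of "u T"] by (simp only: abs_of_pos)
      also have "\<dots> \<le> \<bar>u T\<bar> / (c / 4)" using elim c by (intro divide_left_mono mult_pos_pos AT) auto
      finally show ?case .
    qed
  qed
  then show "((\<lambda>T. (EY T - (X T \<omega>)\<^sup>2 / 2) / A T \<omega>) \<longlongrightarrow> \<theta> + \<rho>) at_top" by (rule LIM_zero_cancel)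
qed

end

section \<open>The Skorohod integral\<close>

text \<open>Up to the factor \<open>H\<close>, the derivative in \<open>t\<close> of \<open>E (B\<^sub>t B\<^sub>r)\<close>, for \<open>b = 2 H - 1\<close>.\<close>

definition kerint :: "real \<Rightarrow> real \<Rightarrow> real \<Rightarrow> real" where
  "kerint b r t = t powr b + (max 0 (r - t)) powr b - (max 0 (t - r)) powr b"

text \<open>Positive parts let one primitive \<open>F\<close> cover both sides of the point
  \<open>s = t\<close>, where the kernel may be singular. \<open>F\<close> is continuous there since
  b > 0, and this single point is exempted from differentiability.\<close>

lemma kernel_has_integral:
  assumes b: "0 < b" and r: "0 \<le> r" and t: "0 \<le> t"
  shows "((\<lambda>s. \<bar>t - s\<bar> powr (b - 1)) has_integral kerint b r t / b) {0..r}"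
proof -
  define F where "F s = ((max 0 (s - t)) powr b - (max 0 (t - s)) powr b) / b" for s
  have "((\<lambda>s. \<bar>t - s\<bar> powr (b - 1)) has_integral (F r - F 0)) {0..r}"
  proof (rule fundamental_theorem_of_calculus_interior_strong[where S = "{t}"])
    show "continuous_on {0..r} F"
    proof -
      have "continuous_on {0..r} (\<lambda>s. (max 0 (s - t)) powr b)" "continuous_on {0..r} (\<lambda>s. (max 0 (t - s)) powr b)"
        by (rule continuous_on_powr'[OF _ continuous_on_const]; use b in \<open>auto intro!: continuous_intros\<close>)+
      then show ?thesis unfolding F_def[abs_def] using b
        by (intro continuous_on_divide continuous_on_diff continuous_on_const) auto
    qed
    fix s assume s: "s \<in> {0<..<r} - {t}"
    have "(F has_real_derivative \<bar>t - s\<bar> powr (b - 1)) (at s)"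
    proof (cases "s > t")
      case True
      have "((\<lambda>s. (s - t) powr b / b) has_real_derivative (b * (s - t) powr (b - 1)) * 1 / b) (at s)"
        using True by (intro DERIV_cdivide DERIV_chain2[where f = "\<lambda>y. y powr b" and g = "\<lambda>s. s - t"] has_real_derivative_powr)
          (auto intro!: derivative_eq_intros)
      then have "(F has_real_derivative (b * (s - t) powr (b - 1)) * 1 / b) (at s)"
        by (rule has_field_derivative_transform_within_open[where S = "{t<..}"]) (use True b in \<open>auto simp: F_def\<close>)
      then show ?thesis using True b by simp
    next
      case False
      then have st: "s < t" using s by auto
      have "((\<lambda>s. - ((t - s) powr b) / b) has_real_derivative - ((b * (t - s) powr (b - 1)) * (- 1)) / b) (at s)"
        using st by (intro DERIV_cdivide DERIV_minus DERIV_chain2[where f = "\<lambda>y. y powr b" and g = "\<lambda>s. t - s"] has_real_derivative_powr)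
          (auto intro!: derivative_eq_intros)
      then have "(F has_real_derivative - ((b * (t - s) powr (b - 1)) * (- 1)) / b) (at s)"
        by (rule has_field_derivative_transform_within_open[where S = "{..<t}"]) (use st b in \<open>auto simp: F_def\<close>)
      then show ?thesis using st b by simp
    qed
    then show "(F has_vector_derivative \<bar>t - s\<bar> powr (b - 1)) (at s)"
      by (simp add: has_real_derivative_iff_has_vector_derivative)
  qed (use r in auto)
  moreover have "F r - F 0 = kerint b r t / b"
    using t b by (simp add: F_def kerint_def add_divide_distrib diff_divide_distrib)
  ultimately show ?thesis by simp
qed

lemma kerint_continuous: "0 < b \<Longrightarrow> continuous_on A (kerint b r)" if "A \<subseteq> {0..}"
proof -
  assume b: "0 < b"
  have "continuous_on A (\<lambda>t. t powr b)" "continuous_on A (\<lambda>t. (max 0 (r - t)) powr b)" "continuous_on A (\<lambda>t. (max 0 (t - r)) powr b)"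
    by (rule continuous_on_powr'[OF _ continuous_on_const]; use b that in \<open>auto intro!: continuous_intros\<close>)+
  then show ?thesis unfolding kerint_def[abs_def] by (intro continuous_on_add continuous_on_diff)
qed

lemma kernel_nn_integral:
  assumes "0 < b" "0 \<le> r" "0 \<le> t"
  shows "(\<integral>\<^sup>+s. ennreal (indicator {0..r} s * \<bar>t - s\<bar> powr (b - 1)) \<partial>lborel) = ennreal (kerint b r t / b)"
  using nn_integral_has_integral_lebesgue[OF _ kernel_has_integral[OF assms]] by simp

text \<open>Tonelli, with the inner integral in closed form and bounded uniformly on
  \<open>{0..r}\<close>.\<close>

lemma kernel_integrable:
  assumes b: "0 < b" and r: "0 \<le> r" and T: "0 \<le> T"
  defines "k \<equiv> \<lambda>p. indicator {0..r} (fst p) * indicator {0..T} (snd p) * \<bar>snd p - fst p\<bar> powr (b - 1) :: real"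
  shows "integrable (lborel \<Otimes>\<^sub>M lborel) k"
proof (rule integrableI_bounded)
  show "k \<in> borel_measurable (lborel \<Otimes>\<^sub>M lborel)"
    unfolding k_def by measurable
  define c where "c = (r powr b + T powr b) / b"
  have "(\<integral>\<^sup>+p. ennreal (norm (k p)) \<partial>(lborel \<Otimes>\<^sub>M lborel))
     = (\<integral>\<^sup>+s. (\<integral>\<^sup>+t. ennreal (norm (k (s, t))) \<partial>lborel) \<partial>lborel)"
    by (subst lborel.nn_integral_fst[symmetric]) (simp_all add: k_def)
  also have "\<dots> \<le> (\<integral>\<^sup>+s. ennreal c * indicator {0..r} s \<partial>lborel)"
  proof (rule nn_integral_mono)
    fix s :: real
    show "(\<integral>\<^sup>+t. ennreal (norm (k (s, t))) \<partial>lborel) \<le> ennreal c * indicator {0..r} s"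
    proof (cases "s \<in> {0..r}")
      case True
      have "(\<integral>\<^sup>+t. ennreal (norm (k (s, t))) \<partial>lborel)
        = (\<integral>\<^sup>+t. ennreal (indicator {0..T} t * \<bar>s - t\<bar> powr (b - 1)) \<partial>lborel)"
        using True by (intro nn_integral_cong) (simp add: k_def abs_mult abs_minus_commute)
      also have "\<dots> = ennreal (kerint b T s / b)" using True by (intro kernel_nn_integral b T) auto
      also have "kerint b T s / b \<le> c"
      proof -
        have "s powr b \<le> r powr b" "(max 0 (T - s)) powr b \<le> T powr b" "0 \<le> (max 0 (s - T)) powr b"
          using True b T by (auto intro!: powr_mono2)
        then show ?thesis unfolding c_def kerint_def using b by (intro divide_right_mono) linarith+
      qed
      finally show ?thesis using True by (simp add: ennreal_leI)
    qed (simp add: k_def)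
  qed
  also have "\<dots> < \<infinity>" using r by (subst nn_integral_cmult_indicator) (auto simp: ennreal_mult_less_top emeasure_lborel_Icc_eq)
  finally show "(\<integral>\<^sup>+p. ennreal (norm (k p)) \<partial>(lborel \<Otimes>\<^sub>M lborel)) < \<infinity>" .
qed

text \<open>A continuous path is bounded on \<open>{0..T}\<close>, whence integrability. Integrating
  in s before t leaves the closed form \<open>kerint\<close>.\<close>

lemma kernel_path_integral:
  assumes b: "0 < b" and r: "0 \<le> r" and T: "0 \<le> T" and x: "path0 x"
  defines "k \<equiv> \<lambda>s t. indicator {0..r} s * (indicator {0..T} t * x t) * \<bar>t - s\<bar> powr (b - 1) :: real"
  shows "integrable (lborel \<Otimes>\<^sub>M lborel) (case_prod k)"
    and "(\<integral>p. case_prod k p \<partial>(lborel \<Otimes>\<^sub>M lborel)) = integral {0..T} (\<lambda>t. x t * (kerint b r t / b))"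
proof -
  have xc: "continuous_on A x" for A by (rule path0_continuous_on[OF x])
  have xm[measurable]: "x \<in> borel_measurable borel" by (rule borel_measurable_continuous_onI[OF xc])
  obtain C where C: "\<And>t. t \<in> {0..T} \<Longrightarrow> \<bar>x t\<bar> \<le> C"
  proof -
    have "bounded (x ` {0..T})" by (intro compact_imp_bounded compact_continuous_image xc) auto
    then obtain C where "\<forall>y\<in>x ` {0..T}. norm y \<le> C" unfolding bounded_iff by blast
    then show ?thesis by (intro that[of C]) auto
  qed
  show i: "integrable (lborel \<Otimes>\<^sub>M lborel) (case_prod k)"
  proof (rule Bochner_Integration.integrable_bound)
    show "integrable (lborel \<Otimes>\<^sub>M lborel) (\<lambda>p. C * (indicator {0..r} (fst p) * indicator {0..T} (snd p) * \<bar>snd p - fst p\<bar> powr (b - 1)))"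
      by (intro integrable_mult_right kernel_integrable b r T)
    show "case_prod k \<in> borel_measurable (lborel \<Otimes>\<^sub>M lborel)" unfolding k_def by measurable
    show "AE p in lborel \<Otimes>\<^sub>M lborel. norm (case_prod k p) \<le> norm (C * (indicator {0..r} (fst p) * indicator {0..T} (snd p) * \<bar>snd p - fst p\<bar> powr (b - 1)))"
    proof (rule AE_I2)
      fix p :: "real \<times> real"
      obtain s t where p: "p = (s, t)" by (cases p)
      show "norm (case_prod k p) \<le> norm (C * (indicator {0..r} (fst p) * indicator {0..T} (snd p) * \<bar>snd p - fst p\<bar> powr (b - 1)))"
      proof (cases "s \<in> {0..r} \<and> t \<in> {0..T}")
        case True
        then have "\<bar>x t\<bar> \<le> \<bar>C\<bar>" using C[of t] by simp
        then have "\<bar>x t\<bar> * \<bar>t - s\<bar> powr (b - 1) \<le> \<bar>C\<bar> * \<bar>t - s\<bar> powr (b - 1)" by (rule mult_right_mono) simp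
        then show ?thesis using True by (simp add: p k_def abs_mult)
      next
        case False
        then have "case_prod k p = 0" by (auto simp: p k_def indicator_def)
        then show ?thesis by simp
      qed
    qed
  qed
  have inner: "(\<integral>s. k s t \<partial>lborel) = indicator {0..T} t * (x t * (kerint b r t / b))" for t
  proof (cases "t \<in> {0..T}")
    case True
    have "(\<integral>s. k s t \<partial>lborel) = (\<integral>s. x t * (indicator {0..r} s * \<bar>t - s\<bar> powr (b - 1)) \<partial>lborel)"
      using True by (simp add: k_def mult_ac)
    also have "\<dots> = x t * (\<integral>s. indicator {0..r} s * \<bar>t - s\<bar> powr (b - 1) \<partial>lborel)" by simp
    also have "(\<integral>s. indicator {0..r} s * \<bar>t - s\<bar> powr (b - 1) \<partial>lborel) = kerint b r t / b"
    proof -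
      have nn: "0 \<le> kerint b r t / b"
        by (rule has_integral_nonneg[OF kernel_has_integral[OF b r]]) (use True in auto)
      have "(\<integral>s. indicator {0..r} s * \<bar>t - s\<bar> powr (b - 1) \<partial>lborel) = enn2real (\<integral>\<^sup>+s. ennreal (indicator {0..r} s * \<bar>t - s\<bar> powr (b - 1)) \<partial>lborel)"
        by (rule integral_eq_nn_integral) auto
      also have "\<dots> = enn2real (ennreal (kerint b r t / b))"
        using True by (subst kernel_nn_integral[OF b r]) auto
      finally show ?thesis using nn by (simp only: enn2real_ennreal)
    qed
    finally show ?thesis using True by simp
  qed (simp add: k_def)
  have "(\<integral>p. case_prod k p \<partial>(lborel \<Otimes>\<^sub>M lborel)) = (\<integral>t. (\<integral>s. k s t \<partial>lborel) \<partial>lborel)"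
    by (rule lborel_pair.integral_snd[OF i, symmetric])
  also have "\<dots> = (LINT t:{0..T}|lborel. x t * (kerint b r t / b))"
    unfolding inner set_lebesgue_integral_def by simp
  also have "\<dots> = integral {0..T} (\<lambda>t. x t * (kerint b r t / b))"
  proof (rule set_borel_integral_eq_integral(2), rule borel_integrable_atLeastAtMost')
    have "continuous_on {0..T} (kerint b r)" by (rule kerint_continuous[OF _ b]) auto
    then show "continuous_on {0..T} (\<lambda>t. x t * (kerint b r t / b))"
      using b by (intro continuous_on_mult continuous_on_divide continuous_on_const xc) auto
  qed
  finally show "(\<integral>p. case_prod k p \<partial>(lborel \<Otimes>\<^sub>M lborel)) = integral {0..T} (\<lambda>t. x t * (kerint b r t / b))" .
qed

text \<open>By linearity one indicator at a time. The factor H (2 H - 1) of the inner product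
  cancels the denominator 2 H - 1 of the kernel integral, and what remains is the derivative of the
  covariance of \<open>B\<close>.\<close>

lemma fbm_inner_step_path:
  fixes n :: nat
  assumes H: "1 / 2 < H" and t: "\<forall>i<n. 0 \<le> t i" and T: "0 \<le> T" and x: "path0 x"
  shows "fbm_inner H (\<lambda>s. \<Sum>i<n. d i * indicator {0..t i} s) (\<lambda>s. indicator {0..T} s * x s)
    = integral {0..T} (\<lambda>s. (\<Sum>i<n. d i * (H * kerint (2 * H - 1) (t i) s)) * x s)"
proof -
  define b where "b = 2 * H - 1"
  have b: "b > 0" "2 * H - 2 = b - 1" using H by (simp_all add: b_def)
  define k where "k i s r = indicator {0..t i} s * (indicator {0..T} r * x r) * \<bar>r - s\<bar> powr (b - 1)" for i and s r :: real
  have ki: "integrable (lborel \<Otimes>\<^sub>M lborel) (case_prod (k i))" if "i < n" for i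
    unfolding k_def using t that by (intro kernel_path_integral(1)[OF b(1) _ T x]) auto
  have kv: "(\<integral>p. case_prod (k i) p \<partial>(lborel \<Otimes>\<^sub>M lborel)) = integral {0..T} (\<lambda>s. x s * (kerint b (t i) s / b))" if "i < n" for i
    unfolding k_def using t that by (intro kernel_path_integral(2)[OF b(1) _ T x]) auto
  have pt: "indicator ({0..} \<times> {0..}) (s, r) * ((\<Sum>i<n. d i * indicator {0..t i} s) * (indicator {0..T} r * x r) * \<bar>r - s\<bar> powr (2 * H - 2))
      = (\<Sum>i<n. d i * case_prod (k i) (s, r))" for s r
  proof (cases "0 \<le> s \<and> 0 \<le> r")
    case True
    then have "indicator ({0..} \<times> {0..}) (s, r) = (1 :: real)" by simp
    then show ?thesis
      unfolding b(2) k_def sum_distrib_right by (simp only: mult_1_left prod.case) (intro sum.cong, simp_all only: mult.assoc)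
  next
    case False
    then have "indicator ({0..} \<times> {0..}) (s, r) = (0 :: real)" "k i s r = 0" for i
      by (auto simp: k_def indicator_def)
    then show ?thesis by simp
  qed
  have "(\<lambda>(s, r). indicator ({0..} \<times> {0..}) (s, r) * ((\<Sum>i<n. d i * indicator {0..t i} s) * (indicator {0..T} r * x r) * \<bar>r - s\<bar> powr (2 * H - 2)))
     = (\<lambda>p. \<Sum>i<n. d i * case_prod (k i) p)"
    by (rule ext) (simp only: split_paired_all prod.case pt)
  then have "fbm_inner H (\<lambda>s. \<Sum>i<n. d i * indicator {0..t i} s) (\<lambda>s. indicator {0..T} s * x s)
     = H * b * (\<integral>p. (\<Sum>i<n. d i * case_prod (k i) p) \<partial>(lborel \<Otimes>\<^sub>M lborel))"
    unfolding fbm_inner_def b_def by (simp only:)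
  also have "(\<integral>p. (\<Sum>i<n. d i * case_prod (k i) p) \<partial>(lborel \<Otimes>\<^sub>M lborel)) = (\<Sum>i<n. d i * integral {0..T} (\<lambda>s. x s * (kerint b (t i) s / b)))"
    using ki kv by (subst Bochner_Integration.integral_sum) (auto intro!: sum.cong)
  also have "H * b * \<dots> = (\<Sum>i<n. integral {0..T} (\<lambda>s. d i * (H * kerint b (t i) s) * x s))"
    unfolding sum_distrib_left
  proof (intro sum.cong refl)
    fix i
    have "(\<lambda>s. d i * (H * kerint b (t i) s) * x s) = (\<lambda>s. (H * b * d i) * (x s * (kerint b (t i) s / b)))"
      using b by (auto simp: field_simps)
    then show "H * b * (d i * integral {0..T} (\<lambda>s. x s * (kerint b (t i) s / b))) = integral {0..T} (\<lambda>s. d i * (H * kerint b (t i) s) * x s)"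
      by (simp only: Henstock_Kurzweil_Integration.integral_mult_right mult.assoc)
  qed
  also have "\<dots> = integral {0..T} (\<lambda>s. \<Sum>i<n. d i * (H * kerint b (t i) s) * x s)"
  proof (rule integral_sum[symmetric])
    fix i
    have "continuous_on {0..T} (kerint b (t i))" by (rule kerint_continuous[OF _ b(1)]) auto
    then show "(\<lambda>s. d i * (H * kerint b (t i) s) * x s) integrable_on {0..T}"
      by (intro integrable_continuous_interval continuous_on_mult continuous_on_const path0_continuous_on[OF x])
  qed simp
  finally show ?thesis unfolding b_def sum_distrib_right .
qed

section \<open>Trigonometric test functionals\<close>

definition wave :: "nat \<Rightarrow> (nat \<Rightarrow> real) \<Rightarrow> real \<Rightarrow> real \<Rightarrow> (nat \<Rightarrow> real) \<Rightarrow> real" where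
  "wave n c C \<phi> x = C * cos (\<phi> + (\<Sum>i<n. c i * x i))"

lemma wave_has_derivative:
  assumes i: "i < n"
  shows "((\<lambda>h. wave n c C \<phi> (x(i := h))) has_real_derivative - (C * c i * sin (\<phi> + (\<Sum>j<n. c j * (x(i := h)) j)))) (at h)"
proof -
  have s: "(\<Sum>j<n. c j * (x(i := h)) j) = c i * h + (\<Sum>j\<in>{..<n} - {i}. c j * x j)" for h
    using i by (subst sum.remove[of _ i]) (auto intro!: sum.cong)
  show ?thesis unfolding wave_def s by (auto intro!: derivative_eq_intros)
qed

lemma partial_wave: "i < n \<Longrightarrow> partial i (wave n c C \<phi>) = (\<lambda>x. - (C * c i * sin (\<phi> + (\<Sum>j<n. c j * x j))))"
  by (rule ext) (simp add: partial_def DERIV_imp_deriv[OF wave_has_derivative])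

text \<open>A partial derivative multiplies the amplitude by a coefficient and shifts the phase by
  pi / 2, so iterated derivatives are waves again. This is why the amplitude is a parameter.\<close>

lemma wave_bounded_smooth: "bounded_smooth n (wave n c C \<phi>)"
proof -
  have pw: "partial i (wave n c D \<psi>) = wave n c (D * c i) (\<psi> + pi / 2)" if "i < n" for i D \<psi>
    unfolding partial_wave[OF that] wave_def by (rule ext) (simp add: cos_add add.assoc sin_add algebra_simps)
  have ex: "\<exists>D \<psi>. foldr partial \<alpha> (wave n c C \<phi>) = wave n c D \<psi>" if "set \<alpha> \<subseteq> {..<n}" for \<alpha>
    using that
  proof (induction \<alpha>)
    case Nil
    then show ?case by auto
  next
    case (Cons i \<alpha>)
    then obtain D \<psi> where "foldr partial \<alpha> (wave n c C \<phi>) = wave n c D \<psi>" by auto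
    with Cons.prems pw[of i D \<psi>] show ?case by auto
  qed
  have cont: "continuous_on UNIV (wave n c D \<psi>)" for D \<psi>
    unfolding wave_def[abs_def] by (intro continuous_intros continuous_on_product_coordinates)
  have bd: "bounded (range (wave n c D \<psi>))" for D \<psi>
    by (rule boundedI[of _ "\<bar>D\<bar>"]) (auto simp: wave_def abs_mult mult_left_le)
  have df: "(\<lambda>h. wave n c D \<psi> (x(i := h))) differentiable at (x i)" if "i < n" for D \<psi> i x
    using wave_has_derivative[OF that] real_differentiable_def by blast
  show ?thesis
    unfolding bounded_smooth_def
  proof (intro conjI allI impI)
    show "wave n c C \<phi> x = wave n c C \<phi> y" if "\<forall>i<n. x i = y i" for x y
      using that by (simp add: wave_def)
    fix \<alpha> assume "set \<alpha> \<subseteq> {..<n}"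
    then obtain D \<psi> where e: "foldr partial \<alpha> (wave n c C \<phi>) = wave n c D \<psi>" using ex by blast
    show "continuous_on UNIV (foldr partial \<alpha> (wave n c C \<phi>))" unfolding e by (rule cont)
    show "bounded (range (foldr partial \<alpha> (wave n c C \<phi>)))" unfolding e by (rule bd)
    show "(\<lambda>h. foldr partial \<alpha> (wave n c C \<phi>) (x(i := h))) differentiable at (x i)" if "i < n" for i x
      unfolding e by (rule df[OF that])
  qed
qed

text \<open>Since v = x + \<theta> times the primitive of x, the product x v is the derivative of
  the right-hand side in T. It evaluates the mixed integral of \<open>X\<close> and \<open>V\<close>
  in the estimator.\<close>

lemma ou_product_integral:
  assumes v: "path0 v"
  shows "integral {0..T} (\<lambda>t. ou \<theta> v t * v t) = prim (\<lambda>t. (ou \<theta> v t)\<^sup>2) T + \<theta> * (prim (ou \<theta> v) T)\<^sup>2 / 2"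
proof -
  have x: "path0 (ou \<theta> v)" by (rule ou_path0[OF v])
  have "prim (\<lambda>t. (ou \<theta> v t)\<^sup>2) T + \<theta> * (prim (ou \<theta> v) T)\<^sup>2 / 2 = prim (\<lambda>t. ou \<theta> v t * v t) T"
  proof (rule eq_prim)
    fix t
    have "v t = ou \<theta> v t + \<theta> * prim (ou \<theta> v) t" using ou_eq[OF v, of \<theta> t] by simp
    then have e: "(ou \<theta> v t)\<^sup>2 + \<theta> * (2 * prim (ou \<theta> v) t * ou \<theta> v t) / 2 = ou \<theta> v t * v t"
      by (simp add: power2_eq_square algebra_simps)
    show "((\<lambda>T. prim (\<lambda>t. (ou \<theta> v t)\<^sup>2) T + \<theta> * (prim (ou \<theta> v) T)\<^sup>2 / 2) has_real_derivative ou \<theta> v t * v t) (at t)"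
      unfolding e[symmetric]
      using DERIV_power[OF prim_has_derivative[OF x], of 2 t]
      by (intro DERIV_add DERIV_cmult DERIV_cdivide prim_has_derivative path0_square x) (simp_all add: mult_ac)
  qed (simp add: prim_nonpos)
  then show ?thesis by (simp only: prim_def)
qed

section \<open>The duality relation for trigonometric functionals\<close>

context fbm_ou
begin

text \<open>By the chain rule \<open>Y\<close> is the Young integral of \<open>X\<close> against \<open>B\<close>, and \<open>EY\<close> is its
  expectation, i.e. the trace term.\<close>

definition Y :: "real \<Rightarrow> 'a \<Rightarrow> real" where
  "Y T \<omega> = (X T \<omega>)\<^sup>2 / 2 + (\<theta> + \<rho>) * A T \<omega> + \<theta> * \<rho> * (S T \<omega>)\<^sup>2 / 2"

text \<open>Termwise differentiation of the covariance of \<open>B\<close>. Only positive times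
  occur: the path is constant before 0 and in general leaves 0 with nonzero slope.\<close>

lemma covB_span_derivative:
  fixes n :: nat
  assumes t: "\<forall>i<n. 0 \<le> t i" and s: "s > 0"
  shows "(covB (\<lambda>\<omega>. \<Sum>i<n. c i * B (t i) \<omega>) has_real_derivative (\<Sum>i<n. c i * (H * kerint (2 * H - 1) (t i) s))) (at s)"
proof -
  have one: "((\<lambda>s. (t' powr (2 * H) + s powr (2 * H) - \<bar>t' - s\<bar> powr (2 * H)) / 2) has_real_derivative H * kerint (2 * H - 1) t' s) (at s)" for t'
  proof -
    have "((\<lambda>s. (t' powr (2 * H) + s powr (2 * H) - \<bar>t' - s\<bar> powr (2 * H)) / 2) has_real_derivative
       (0 + (2 * H) * s powr (2 * H - 1) - ((2 * H) * sgn (t' - s) * \<bar>t' - s\<bar> powr (2 * H - 1)) * (- 1)) / 2) (at s)"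
      using H s by (intro DERIV_cdivide DERIV_diff DERIV_add DERIV_const has_real_derivative_powr
          DERIV_chain2[where f = "\<lambda>y. \<bar>y\<bar> powr (2 * H)" and g = "\<lambda>s. t' - s"] powr_abs_has_derivative)
        (auto intro!: derivative_eq_intros)
    moreover have "(0 + (2 * H) * s powr (2 * H - 1) - ((2 * H) * sgn (t' - s) * \<bar>t' - s\<bar> powr (2 * H - 1)) * (- 1)) / 2 = H * kerint (2 * H - 1) t' s"
      by (cases "t' - s" "0 :: real" rule: linorder_cases) (auto simp: kerint_def algebra_simps add_divide_distrib diff_divide_distrib)
    ultimately show ?thesis by (simp only:)
  qed
  have D: "((\<lambda>s. \<Sum>i<n. c i * ((t i powr (2 * H) + s powr (2 * H) - \<bar>t i - s\<bar> powr (2 * H)) / 2)) has_real_derivative (\<Sum>i<n. c i * (H * kerint (2 * H - 1) (t i) s))) (at s)"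
    by (intro DERIV_sum DERIV_cmult one)
  have e: "(\<Sum>i<n. c i * ((t i powr (2 * H) + s powr (2 * H) - \<bar>t i - s\<bar> powr (2 * H)) / 2)) = covB (\<lambda>\<omega>. \<Sum>i<n. c i * B (t i) \<omega>) s" if "s > 0" for s
  proof -
    have i: "integrable M (\<lambda>\<omega>. c i * (B (t i) \<omega> * B s \<omega>))" for i
      by (intro integrable_mult_right chaos_prod_integrable span_chaos B_in_span)
    have "covB (\<lambda>\<omega>. \<Sum>i<n. c i * B (t i) \<omega>) s = expectation (\<lambda>\<omega>. \<Sum>i<n. c i * (B (t i) \<omega> * B s \<omega>))"
      by (simp add: covB_def sum_distrib_right mult.assoc)
    also have "\<dots> = (\<Sum>i<n. expectation (\<lambda>\<omega>. c i * (B (t i) \<omega> * B s \<omega>)))"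
      by (rule Bochner_Integration.integral_sum[OF i])
    also have "\<dots> = (\<Sum>i<n. c i * ((t i powr (2 * H) + s powr (2 * H) - \<bar>t i - s\<bar> powr (2 * H)) / 2))"
      using t that by (intro sum.cong refl) (simp add: B_cov)
    finally show ?thesis by simp
  qed
  show ?thesis
    by (rule has_field_derivative_transform_within_open[OF D, where S = "{0<..}"]) (use s e in auto)
qed

lemma Y_integrable: "integrable M (Y T)"
  unfolding Y_def[abs_def]
  by (intro Bochner_Integration.integrable_add integrable_mult_right integrable_divide chaos_square X_chaos S_chaos A_integrable)

text \<open>Both sides equal minus cos \<phi> exp(-E N^2 / 2) times the same energy of h(s) = E(N
  X_s). On the left \<open>wick\<close> leaves the integral of h against the derivative of
  \<open>covB N\<close>, which the chain rule evaluates. On the right it turns each square in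
  \<open>Y\<close> into a variance minus the square of the corresponding covariance; the variances
  cancel against \<open>EY\<close>.\<close>

lemma skorohod_trig:
  fixes n :: nat and c t :: "nat \<Rightarrow> real" and \<phi> T :: real
  assumes t: "\<forall>i<n. 0 \<le> t i" and T: "T > 0"
  defines "N \<equiv> \<lambda>\<omega>. \<Sum>i<n. c i * B (t i) \<omega>"
  defines "g \<equiv> \<lambda>s. \<Sum>i<n. c i * (H * kerint (2 * H - 1) (t i) s)"
  shows "(\<lambda>\<omega>. sin (\<phi> + N \<omega>) * integral {0..T} (\<lambda>s. g s * X s \<omega>)) \<in> borel_measurable M"
    and "expectation (\<lambda>\<omega>. - (sin (\<phi> + N \<omega>) * integral {0..T} (\<lambda>s. g s * X s \<omega>))) = expectation (\<lambda>\<omega>. cos (\<phi> + N \<omega>) * (Y T \<omega> - EY T))"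
proof -
  have NG: "N \<in> chaos" unfolding N_def by (intro span_chaos) (auto simp: B_span_def)
  note Nm[measurable] = chaos_measurable[OF NG]
  define v where "v = exp (- expectation (\<lambda>\<omega>. (N \<omega>)\<^sup>2) / 2)"
  define h where "h = ou \<theta> (ou \<rho> (covB N))"
  have hp: "path0 h" unfolding h_def by (intro ou_path0 covB_path0 NG)
  have NX: "expectation (\<lambda>\<omega>. N \<omega> * X s \<omega>) = h s" for s unfolding h_def by (rule cov_X[OF NG])
  have NS: "expectation (\<lambda>\<omega>. N \<omega> * S s \<omega>) = prim h s" for s unfolding h_def by (rule cov_S[OF NG])
  have b: "2 * H - 1 > 0" using H by simp
  \<comment> \<open>\<open>g\<close> is continued constantly to negative times to be continuous on
    the whole line; on \<open>{0..T}\<close> nothing changes.\<close>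
  define g' where "g' s = g (max 0 s)" for s
  have gc: "continuous_on {0..} g"
    unfolding g_def by (intro continuous_on_sum continuous_on_mult continuous_on_const kerint_continuous[OF _ b]) simp
  have g'c: "continuous_on UNIV g'"
    unfolding g'_def[abs_def] by (rule continuous_on_compose2[OF gc]) (auto intro!: continuous_intros)
  have gi: "integral {0..T} (\<lambda>s. g s * X s \<omega>) = prim (\<lambda>s. g' s * X s \<omega>) T" for \<omega>
    unfolding prim_def by (intro integral_cong) (simp add: g'_def)
  have fp: "path0 (\<lambda>s. g' s * X s \<omega>)" for \<omega> by (rule path0_mult[OF X_path0 g'c])
  have fG: "(\<lambda>\<omega>. g' s * X s \<omega>) \<in> chaos" for s by (intro chaos_scale X_chaos)
  obtain K where K: "\<And>s. s \<in> {0..T} \<Longrightarrow> expectation (\<lambda>\<omega>. (g' s * X s \<omega>)\<^sup>2) \<le> K"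
  proof -
    have "continuous_on {0..T} (\<lambda>s. (g' s)\<^sup>2 * xvar s)"
      by (intro continuous_on_mult continuous_on_power continuous_on_subset[OF g'c] path0_continuous_on[OF xvar_path0]) auto
    then have "bounded ((\<lambda>s. (g' s)\<^sup>2 * xvar s) ` {0..T})" by (intro compact_imp_bounded compact_continuous_image) auto
    then obtain K where "\<forall>y\<in>(\<lambda>s. (g' s)\<^sup>2 * xvar s) ` {0..T}. norm y \<le> K" unfolding bounded_iff by blast
    then have K: "\<bar>(g' s)\<^sup>2 * xvar s\<bar> \<le> K" if "s \<in> {0..T}" for s using that by auto
    show ?thesis
    proof (rule that)
      fix s assume "s \<in> {0..T}"
      then show "expectation (\<lambda>\<omega>. (g' s * X s \<omega>)\<^sup>2) \<le> K"
        using K[of s] by (simp add: power_mult_distrib xvar_def)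
    qed
  qed
  have sm: "(\<lambda>\<omega>. sin (\<phi> + N \<omega>)) \<in> borel_measurable M" by measurable
  have s2: "integrable M (\<lambda>\<omega>. (sin (\<phi> + N \<omega>))\<^sup>2)"
    by (rule integrable_const_bound[where B = 1]) (auto simp: abs_square_le_1)
  have pm: "(\<lambda>\<omega>. prim (\<lambda>s. g' s * X s \<omega>) T) \<in> borel_measurable M"
    by (rule prim_square_expectation(1)[OF chaos_measurable[OF fG] fp chaos_square[OF fG] K]) (use T in auto)
  show "(\<lambda>\<omega>. sin (\<phi> + N \<omega>) * integral {0..T} (\<lambda>s. g s * X s \<omega>)) \<in> borel_measurable M"
    unfolding gi by (intro borel_measurable_times sm pm)
  have "expectation (\<lambda>\<omega>. sin (\<phi> + N \<omega>) * prim (\<lambda>s. g' s * X s \<omega>) T) = prim (\<lambda>s. expectation (\<lambda>\<omega>. sin (\<phi> + N \<omega>) * (g' s * X s \<omega>))) T"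
    by (rule expectation_mult_prim(1)[OF sm s2 chaos_measurable[OF fG] fp chaos_square[OF fG] K])
  also have "(\<lambda>s. expectation (\<lambda>\<omega>. sin (\<phi> + N \<omega>) * (g' s * X s \<omega>))) = (\<lambda>s. (cos \<phi> * v) * (h s * g' s))"
  proof
    fix s
    have "expectation (\<lambda>\<omega>. sin (\<phi> + N \<omega>) * (g' s * X s \<omega>)) = g' s * expectation (\<lambda>\<omega>. X s \<omega> * sin (\<phi> + N \<omega>))"
      by (simp add: mult_ac flip: integral_mult_right_zero)
    also have "\<dots> = (cos \<phi> * v) * (h s * g' s)" unfolding wick(1)[OF NG X_chaos] NX v_def by simp
    finally show "expectation (\<lambda>\<omega>. sin (\<phi> + N \<omega>) * (g' s * X s \<omega>)) = (cos \<phi> * v) * (h s * g' s)" .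
  qed
  also have "prim (\<lambda>s. (cos \<phi> * v) * (h s * g' s)) T = (cos \<phi> * v) * prim (\<lambda>s. h s * g' s) T" by (rule prim_cmult)
  \<comment> \<open>The chain rule for the deterministic path h, driven by \<open>covB N\<close>,
    whose derivative is g' at positive times.\<close>
  also have "prim (\<lambda>s. h s * g' s) T = (h T)\<^sup>2 / 2 + (\<theta> + \<rho>) * prim (\<lambda>s. (h s)\<^sup>2) T + \<theta> * \<rho> * (prim h T)\<^sup>2 / 2"
  proof -
    have dc: "(covB N has_real_derivative g' s) (at s)" if "s > 0" for s
      using covB_span_derivative[OF t that, of c] that by (simp add: N_def g'_def g_def)
    have "((\<lambda>s. h s * g' s) has_integral ((h T)\<^sup>2 / 2 + (\<theta> + \<rho>) * prim (\<lambda>s. (h s)\<^sup>2) T + \<theta> * \<rho> * (prim h T)\<^sup>2 / 2)) {0..T}"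
      unfolding h_def by (rule ou_ou_energy[OF covB_path0[OF NG] dc less_imp_le[OF T]])
    then show ?thesis unfolding prim_def[of "\<lambda>s. h s * g' s"] by (rule integral_unique)
  qed
  finally have L: "expectation (\<lambda>\<omega>. sin (\<phi> + N \<omega>) * prim (\<lambda>s. g' s * X s \<omega>) T)
    = (cos \<phi> * v) * ((h T)\<^sup>2 / 2 + (\<theta> + \<rho>) * prim (\<lambda>s. (h s)\<^sup>2) T + \<theta> * \<rho> * (prim h T)\<^sup>2 / 2)" .
  have cm: "(\<lambda>\<omega>. cos (\<phi> + N \<omega>)) \<in> borel_measurable M" by measurable
  have c2: "integrable M (\<lambda>\<omega>. (cos (\<phi> + N \<omega>))\<^sup>2)"
    by (rule integrable_const_bound[where B = 1]) (auto simp: abs_square_le_1)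
  have ci: "integrable M (\<lambda>\<omega>. cos (\<phi> + N \<omega>) * D \<omega>)" if "integrable M D" for D
    using integrable_mult_bounded[OF that cm] by (simp add: mult.commute)
  have cX: "expectation (\<lambda>\<omega>. cos (\<phi> + N \<omega>) * (X s \<omega>)\<^sup>2) = (cos \<phi> * v) * (xvar s - (h s)\<^sup>2)" for s
    using wick(2)[OF NG X_chaos, of s \<phi>] unfolding NX by (simp add: mult_ac v_def xvar_def)
  have cS: "expectation (\<lambda>\<omega>. cos (\<phi> + N \<omega>) * (S T \<omega>)\<^sup>2) = (cos \<phi> * v) * (expectation (\<lambda>\<omega>. (S T \<omega>)\<^sup>2) - (prim h T)\<^sup>2)"
    using wick(2)[OF NG S_chaos, of T \<phi>] unfolding NS by (simp add: mult_ac v_def)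
  have cA: "expectation (\<lambda>\<omega>. cos (\<phi> + N \<omega>) * A T \<omega>) = (cos \<phi> * v) * (prim xvar T - prim (\<lambda>s. (h s)\<^sup>2) T)"
  proof -
    obtain k where k: "k > 0" "\<And>t. L2 (X t) \<le> k" "\<And>t. L2 (S t) \<le> k" by (rule L2_bounds) blast
    \<comment> \<open>Fubini with the cosine as weight is applied to the squares of
      \<open>X\<close>, so its second-moment conditions concern fourth moments of
      \<open>X\<close>.\<close>
    have q: "integrable M (\<lambda>\<omega>. ((X s \<omega>)\<^sup>2)\<^sup>2)" for s
      using chaos_square_prod_integrable[OF X_chaos X_chaos, of s s] by (simp only: power2_eq_square)
    have qb: "expectation (\<lambda>\<omega>. ((X s \<omega>)\<^sup>2)\<^sup>2) \<le> 3 * k ^ 4" for s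
    proof -
      have "expectation (\<lambda>\<omega>. ((X s \<omega>)\<^sup>2)\<^sup>2) = 3 * (L2 (X s)) ^ 4"
        using fourth_moment[OF X_chaos, of s] by (simp only: power2_eq_square)
      also have "\<dots> \<le> 3 * k ^ 4" by (intro mult_left_mono power_mono k) auto
      finally show ?thesis .
    qed
    have "expectation (\<lambda>\<omega>. cos (\<phi> + N \<omega>) * A T \<omega>) = prim (\<lambda>s. expectation (\<lambda>\<omega>. cos (\<phi> + N \<omega>) * (X s \<omega>)\<^sup>2)) T"
      unfolding A_def by (rule expectation_mult_prim(1)[OF cm c2 _ path0_square[OF X_path0] q qb]) measurable
    also have "\<dots> = (cos \<phi> * v) * prim (\<lambda>s. 1 * xvar s + (- 1) * (h s)\<^sup>2) T"
      unfolding cX prim_cmult by simp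
    also have "prim (\<lambda>s. 1 * xvar s + (- 1) * (h s)\<^sup>2) T = 1 * prim xvar T + (- 1) * prim (\<lambda>s. (h s)\<^sup>2) T"
      by (rule prim_lin[OF xvar_path0 path0_square[OF hp]])
    finally show ?thesis by simp
  qed
  have i1: "integrable M (\<lambda>\<omega>. cos (\<phi> + N \<omega>) * (X T \<omega>)\<^sup>2)" by (rule ci[OF chaos_square[OF X_chaos]])
  have i2: "integrable M (\<lambda>\<omega>. cos (\<phi> + N \<omega>) * A T \<omega>)" by (rule ci[OF A_integrable])
  have i3: "integrable M (\<lambda>\<omega>. cos (\<phi> + N \<omega>) * (S T \<omega>)\<^sup>2)" by (rule ci[OF chaos_square[OF S_chaos]])
  have i4: "integrable M (\<lambda>\<omega>. cos (\<phi> + N \<omega>))" using ci[of "\<lambda>_. 1"] by simp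
  have "(\<lambda>\<omega>. cos (\<phi> + N \<omega>) * (Y T \<omega> - EY T)) = (\<lambda>\<omega>. (1 / 2) * (cos (\<phi> + N \<omega>) * (X T \<omega>)\<^sup>2) + (\<theta> + \<rho>) * (cos (\<phi> + N \<omega>) * A T \<omega>)
      + (\<theta> * \<rho> / 2) * (cos (\<phi> + N \<omega>) * (S T \<omega>)\<^sup>2) - EY T * cos (\<phi> + N \<omega>))"
    by (rule ext) (simp add: Y_def algebra_simps)
  then have "expectation (\<lambda>\<omega>. cos (\<phi> + N \<omega>) * (Y T \<omega> - EY T)) = (1 / 2) * expectation (\<lambda>\<omega>. cos (\<phi> + N \<omega>) * (X T \<omega>)\<^sup>2)
      + (\<theta> + \<rho>) * expectation (\<lambda>\<omega>. cos (\<phi> + N \<omega>) * A T \<omega>)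
      + (\<theta> * \<rho> / 2) * expectation (\<lambda>\<omega>. cos (\<phi> + N \<omega>) * (S T \<omega>)\<^sup>2) - EY T * expectation (\<lambda>\<omega>. cos (\<phi> + N \<omega>))"
    using i1 i2 i3 i4 by simp
  also have "\<dots> = - ((cos \<phi> * v) * ((h T)\<^sup>2 / 2 + (\<theta> + \<rho>) * prim (\<lambda>s. (h s)\<^sup>2) T + \<theta> * \<rho> * (prim h T)\<^sup>2 / 2))"
    unfolding cX cS cA expectation_cos_phase[OF NG] v_def[symmetric] EY_def by (simp add: algebra_simps)
  finally show "expectation (\<lambda>\<omega>. - (sin (\<phi> + N \<omega>) * integral {0..T} (\<lambda>s. g s * X s \<omega>))) = expectation (\<lambda>\<omega>. cos (\<phi> + N \<omega>) * (Y T \<omega> - EY T))"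
    unfolding gi by (simp add: L)
qed

end

section \<open>Passage to a version with regular paths\<close>

lemma (in prob_space) centered_gaussian_rv_cong_AE:
  assumes Y: "centered_gaussian_rv M Y" and [measurable]: "Y' \<in> borel_measurable M" and eq: "AE \<omega> in M. Y' \<omega> = Y \<omega>"
  shows "centered_gaussian_rv M Y'"
proof -
  have [measurable]: "Y \<in> borel_measurable M" using Y by (simp add: centered_gaussian_rv_def)
  have d: "distr M lborel Y' = distr M lborel Y" by (rule distr_cong_AE) (use eq in auto)
  consider "AE \<omega> in M. Y \<omega> = 0" | \<sigma> where "\<sigma> > 0" "distributed M lborel Y (normal_density 0 \<sigma>)"
    using Y by (auto simp: centered_gaussian_rv_def)
  then show ?thesis
  proof cases
    case 1
    with eq have "AE \<omega> in M. Y' \<omega> = 0" by eventually_elim simp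
    then show ?thesis by (simp add: centered_gaussian_rv_def)
  next
    case 2
    then have "distributed M lborel Y' (normal_density 0 \<sigma>)" by (simp add: distributed_def d)
    then show ?thesis using 2(1) by (auto simp: centered_gaussian_rv_def)
  qed
qed

text \<open>On the null set where the path is discontinuous or does not start at 0 the process is
  replaced by 0. Completeness keeps it measurable, and laws and covariances do not change.\<close>

lemma (in prob_space) fbm_continuous_version:
  assumes H: "1 / 2 < H" "H < 1" and B: "fractional_brownian_motion M H B" and gen: "completely_generated_by M B"
  shows "\<exists>B'. fbm M H B' \<and> (AE \<omega> in M. \<forall>t. B' t \<omega> = B (max 0 t) \<omega>)"
proof -
  have Bm[measurable]: "B (max 0 t) \<in> borel_measurable M" for t using gen by (simp add: completely_generated_by_def)
  have Bg: "centered_gaussian_rv M (\<lambda>\<omega>. \<Sum>i<n. c i * B (max 0 (t i)) \<omega>)" for n :: nat and c t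
  proof -
    have "centered_gaussian_process M B" using B by (simp add: fractional_brownian_motion_def)
    from this[unfolded centered_gaussian_process_def, THEN spec[where x = n], THEN spec[where x = c],
        THEN spec[where x = "\<lambda>i. max 0 (t i)"]]
    show ?thesis by simp
  qed
  have Bc: "expectation (\<lambda>\<omega>. B t \<omega> * B s \<omega>) = (t powr (2 * H) + s powr (2 * H) - \<bar>t - s\<bar> powr (2 * H)) / 2" if "0 \<le> t" "0 \<le> s" for s t
    using B that by (simp add: fractional_brownian_motion_def)
  have B0: "AE \<omega> in M. B 0 \<omega> = 0"
  proof -
    have "integrable M (\<lambda>\<omega>. (B 0 \<omega>)\<^sup>2)"
      using centered_gaussian_trig(1)[OF Bg[of "\<lambda>_. 1" "\<lambda>_. 0" 1]] by simp
    moreover have "expectation (\<lambda>\<omega>. (B 0 \<omega>)\<^sup>2) = 0" using Bc[of 0 0] by (simp add: power2_eq_square)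
    ultimately show ?thesis by (simp add: integral_nonneg_eq_0_iff_AE)
  qed
  define good where "good \<omega> \<longleftrightarrow> continuous_on {0..} (\<lambda>t. B t \<omega>) \<and> B 0 \<omega> = 0" for \<omega>
  have "AE \<omega> in M. continuous_on {0..} (\<lambda>t. B t \<omega>)" using B by (simp add: fractional_brownian_motion_def)
  with B0 have good: "AE \<omega> in M. good \<omega>" by eventually_elim (simp add: good_def)
  define B' where "B' t \<omega> = (if good \<omega> then B (max 0 t) \<omega> else 0)" for t \<omega>
  have eq: "AE \<omega> in M. \<forall>t. B' t \<omega> = B (max 0 t) \<omega>" using good by eventually_elim (simp add: B'_def)
  have eqt: "AE \<omega> in M. B' t \<omega> = B (max 0 t) \<omega>" for t using eq by eventually_elim simp
  have Bm': "B' t \<in> borel_measurable M" for t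
  proof -
    obtain N where N: "M = completion N" using gen unfolding completely_generated_by_def by blast
    show ?thesis using completion_measurable_AE_eq[of "B (max 0 t)" N "B' t"] eqt[of t] Bm[of t] unfolding N[symmetric] by blast
  qed
  have "fbm M H B'"
  proof (intro fbm.intro fbm_axioms.intro)
    show "prob_space M" by (rule prob_space_axioms)
    show "path0 (\<lambda>t. B' t \<omega>)" for \<omega>
    proof (cases "good \<omega>")
      case True
      then have c: "continuous_on {0..} (\<lambda>t. B t \<omega>)" and z: "B 0 \<omega> = 0" by (simp_all add: good_def)
      have "continuous_on UNIV (\<lambda>t. B (max 0 t) \<omega>)"
        by (rule continuous_on_compose2[OF c]) (auto intro!: continuous_intros)
      then show ?thesis using True z by (simp add: path0_def B'_def max_absorb1)
    qed (simp add: path0_def B'_def)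
    show "centered_gaussian_rv M (\<lambda>\<omega>. \<Sum>i<n. c i * B' (t i) \<omega>)" for n :: nat and c t
    proof (rule centered_gaussian_rv_cong_AE[OF Bg[of c t n]])
      show "(\<lambda>\<omega>. \<Sum>i<n. c i * B' (t i) \<omega>) \<in> borel_measurable M"
        by (intro borel_measurable_sum borel_measurable_times borel_measurable_const Bm')
      show "AE \<omega> in M. (\<Sum>i<n. c i * B' (t i) \<omega>) = (\<Sum>i<n. c i * B (max 0 (t i)) \<omega>)"
        using eq by eventually_elim simp
    qed
    show "expectation (\<lambda>\<omega>. B' t \<omega> * B' s \<omega>) = (t powr (2 * H) + s powr (2 * H) - \<bar>t - s\<bar> powr (2 * H)) / 2" if "0 \<le> s" "0 \<le> t" for s t
    proof -
      have "expectation (\<lambda>\<omega>. B' t \<omega> * B' s \<omega>) = expectation (\<lambda>\<omega>. B (max 0 t) \<omega> * B (max 0 s) \<omega>)"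
      proof (rule integral_cong_AE)
        show "AE \<omega> in M. B' t \<omega> * B' s \<omega> = B (max 0 t) \<omega> * B (max 0 s) \<omega>" using eq by eventually_elim simp
      qed (intro borel_measurable_times Bm' Bm)+
      then show ?thesis using Bc[of t s] that by (simp add: max_absorb2)
    qed
  qed (use H Bm' in auto)
  with eq show ?thesis by blast
qed

section \<open>Identification of the Skorohod integral\<close>

context fbm_ou
begin

text \<open>The duality relation is tested on cosines of linear combinations of
  \<open>B\<^sub>0\<close>. For these the inner product is almost surely the expression in
  \<open>skorohod_trig\<close>, so \<open>D\<close> and \<open>Y T \<omega> - EY T\<close> have
  equal expectations against all such cosines, and totality makes them equal.\<close>

lemma divergence_eq:
  assumes gen: "completely_generated_by M B\<^sub>0" and BB: "AE \<omega> in M. \<forall>t. B t \<omega> = B\<^sub>0 (max 0 t) \<omega>"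
    and XX: "AE \<omega> in M. \<forall>t\<ge>0. X\<^sub>0 t \<omega> = X t \<omega>" and T: "T > 0"
    and div: "has_divergence M H B\<^sub>0 (\<lambda>t \<omega>. indicator {0..T} t * X\<^sub>0 t \<omega>) D"
  shows "AE \<omega> in M. D \<omega> = Y T \<omega> - EY T"
proof -
  have D: "D \<in> borel_measurable M" "integrable M (\<lambda>\<omega>. (D \<omega>)\<^sup>2)" using div by (simp_all add: has_divergence_def)
  have Di: "integrable M D" by (rule integrable_of_square(1)[OF D])
  have Yi: "integrable M (\<lambda>\<omega>. Y T \<omega> - EY T)" using Y_integrable by simp
  obtain M' where M': "M = completion M'" using gen unfolding completely_generated_by_def by blast
  have "AE \<omega> in M. D \<omega> - (Y T \<omega> - EY T) = 0"
  proof (rule AE_eq_0_of_trigonometric[OF gen])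
    show "integrable M (\<lambda>\<omega>. D \<omega> - (Y T \<omega> - EY T))" by (intro Bochner_Integration.integrable_diff[OF Di Yi])
    fix n :: nat and c t :: "nat \<Rightarrow> real" and \<phi> :: real
    assume t: "\<forall>i<n. 0 \<le> t i"
    define N where "N \<omega> = (\<Sum>i<n. c i * B (t i) \<omega>)" for \<omega>
    define N\<^sub>0 where "N\<^sub>0 \<omega> = (\<Sum>i<n. c i * B\<^sub>0 (t i) \<omega>)" for \<omega>
    define g where "g s = (\<Sum>i<n. c i * (H * kerint (2 * H - 1) (t i) s))" for s
    have N0m[measurable]: "N\<^sub>0 \<in> borel_measurable M"
      unfolding N\<^sub>0_def[abs_def] using gen t by (intro borel_measurable_sum borel_measurable_times) (auto simp: completely_generated_by_def)
    have Nm[measurable]: "N \<in> borel_measurable M" unfolding N_def[abs_def] by measurable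
    have NN: "AE \<omega> in M. N\<^sub>0 \<omega> = N \<omega>"
      using BB
    proof eventually_elim
      case (elim \<omega>)
      then show ?case unfolding N_def N\<^sub>0_def using t by (intro sum.cong) (simp_all add: max_absorb2)
    qed
    let ?f = "wave n c 1 \<phi>"
    let ?R = "\<lambda>\<omega>. - (sin (\<phi> + N \<omega>) * integral {0..T} (\<lambda>s. g s * X s \<omega>))"
    let ?I = "\<lambda>\<omega>. fbm_inner H (\<lambda>s. malliavin_deriv B\<^sub>0 n ?f t s \<omega>) (\<lambda>s. indicator {0..T} s * X\<^sub>0 s \<omega>)"
    have Rm: "?R \<in> borel_measurable M"
      using skorohod_trig(1)[OF t T, of \<phi> c] unfolding N_def g_def by (rule borel_measurable_uminus)
    have IR: "AE \<omega> in M. ?I \<omega> = ?R \<omega>"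
      using XX NN
    proof eventually_elim
      case (elim \<omega>)
      have 1: "(\<lambda>s. indicator {0..T} s * X\<^sub>0 s \<omega>) = (\<lambda>s. indicator {0..T} s * X s \<omega>)"
        using elim(1) by (auto simp: indicator_def)
      have 2: "(\<lambda>s. malliavin_deriv B\<^sub>0 n ?f t s \<omega>) = (\<lambda>s. \<Sum>i<n. (- (c i * sin (\<phi> + N \<omega>))) * indicator {0..t i} s)"
        unfolding malliavin_deriv_def elim(2)[symmetric] N\<^sub>0_def by (intro ext sum.cong refl) (simp add: partial_wave)
      have "?I \<omega> = integral {0..T} (\<lambda>s. (\<Sum>i<n. (- (c i * sin (\<phi> + N \<omega>))) * (H * kerint (2 * H - 1) (t i) s)) * X s \<omega>)"
        unfolding 1 2 by (rule fbm_inner_step_path[OF H(1) t less_imp_le[OF T] X_path0])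
      also have "(\<lambda>s. (\<Sum>i<n. (- (c i * sin (\<phi> + N \<omega>))) * (H * kerint (2 * H - 1) (t i) s)) * X s \<omega>) = (\<lambda>s. (- sin (\<phi> + N \<omega>)) * (g s * X s \<omega>))"
        unfolding g_def sum_distrib_right sum_distrib_left by (intro ext sum.cong refl) (simp add: mult_ac)
      also have "integral {0..T} \<dots> = ?R \<omega>" unfolding Henstock_Kurzweil_Integration.integral_mult_right by (rule mult_minus_left)
      finally show ?case .
    qed
    have Im: "?I \<in> borel_measurable M"
      using completion_measurable_AE_eq[of ?R M' ?I] Rm IR unfolding M'[symmetric] by blast
    have "expectation (\<lambda>\<omega>. smooth_functional B\<^sub>0 ?f t \<omega> * D \<omega>) = expectation ?I"
      using div wave_bounded_smooth t unfolding has_divergence_def by blast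
    also have "\<dots> = expectation ?R" by (rule integral_cong_AE[OF Im Rm IR])
    also have "\<dots> = expectation (\<lambda>\<omega>. cos (\<phi> + N \<omega>) * (Y T \<omega> - EY T))"
      using skorohod_trig(2)[OF t T, of \<phi> c] unfolding N_def g_def .
    also have "\<dots> = expectation (\<lambda>\<omega>. (Y T \<omega> - EY T) * cos (\<phi> + N\<^sub>0 \<omega>))"
    proof (rule integral_cong_AE)
      have [measurable]: "(\<lambda>\<omega>. Y T \<omega> - EY T) \<in> borel_measurable M" by (rule borel_measurable_integrable[OF Yi])
      show "(\<lambda>\<omega>. cos (\<phi> + N \<omega>) * (Y T \<omega> - EY T)) \<in> borel_measurable M"
        "(\<lambda>\<omega>. (Y T \<omega> - EY T) * cos (\<phi> + N\<^sub>0 \<omega>)) \<in> borel_measurable M" by measurable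
      show "AE \<omega> in M. cos (\<phi> + N \<omega>) * (Y T \<omega> - EY T) = (Y T \<omega> - EY T) * cos (\<phi> + N\<^sub>0 \<omega>)"
        using NN by eventually_elim simp
    qed
    finally have e: "expectation (\<lambda>\<omega>. D \<omega> * cos (\<phi> + N\<^sub>0 \<omega>)) = expectation (\<lambda>\<omega>. (Y T \<omega> - EY T) * cos (\<phi> + N\<^sub>0 \<omega>))"
      by (simp add: smooth_functional_def wave_def N\<^sub>0_def mult.commute)
    have "expectation (\<lambda>\<omega>. D \<omega> * cos (\<phi> + N\<^sub>0 \<omega>) - (Y T \<omega> - EY T) * cos (\<phi> + N\<^sub>0 \<omega>)) = 0"
      by (subst Bochner_Integration.integral_diff) (auto intro!: integrable_mult_bounded Di Yi simp: e)
    then show "expectation (\<lambda>\<omega>. (D \<omega> - (Y T \<omega> - EY T)) * cos (\<phi> + (\<Sum>i<n. c i * B\<^sub>0 (t i) \<omega>))) = 0"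
      unfolding N\<^sub>0_def left_diff_distrib[of "D _"] .
  qed
  then show ?thesis by eventually_elim simp
qed

lemma Y_continuous: "continuous_on UNIV (\<lambda>T. Y T \<omega>)"
proof -
  have "continuous_on UNIV (\<lambda>T. X T \<omega>)" by (rule path0_continuous_on[OF X_path0])
  moreover have "continuous_on UNIV (\<lambda>T. A T \<omega>)" unfolding A_def
    by (rule path0_continuous_on[OF prim_path0[OF path0_square[OF X_path0]]])
  moreover have "continuous_on UNIV (\<lambda>T. S T \<omega>)" unfolding S_def
    by (rule path0_continuous_on[OF prim_path0[OF X_path0]])
  ultimately show ?thesis
    unfolding Y_def
    by (intro continuous_on_add continuous_on_divide continuous_on_mult continuous_on_const continuous_on_power) auto
qed

text \<open>\<open>Y - D\<close> is continuous in \<open>T\<close> and on positive rationals equal to the deterministic \<open>EY\<close>, hence it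
  does not depend on the sample point at all.\<close>

lemma continuous_version_eq:
  assumes eq: "\<And>T. T > 0 \<Longrightarrow> AE \<omega> in M. D T \<omega> = Y T \<omega> - EY T"
    and cont: "AE \<omega> in M. continuous_on {0<..} (\<lambda>T. D T \<omega>)"
  shows "AE \<omega> in M. \<forall>T>0. D T \<omega> = Y T \<omega> - EY T"
proof -
  define good where "good \<omega> \<longleftrightarrow> continuous_on {0<..} (\<lambda>T. D T \<omega>) \<and> (\<forall>q\<in>\<rat> \<inter> {0<..}. D q \<omega> = Y q \<omega> - EY q)" for \<omega>
  have "AE \<omega> in M. \<forall>q\<in>\<rat> \<inter> {0<..}. D q \<omega> = Y q \<omega> - EY q"
    by (subst AE_ball_countable) (auto intro: countable_rat eq)
  with cont have good: "AE \<omega> in M. good \<omega>" by eventually_elim (simp add: good_def)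
  have lim: "\<exists>q. (\<forall>n. q n \<in> \<rat> \<inter> {0<..}) \<and> q \<longlonglongrightarrow> T" if T: "T > 0" for T :: real
  proof -
    have "\<exists>q\<in>\<rat>. T < q \<and> q < T + 1 / real (Suc n)" for n by (rule Rats_dense_in_real) simp
    then obtain q where q: "\<And>n. q n \<in> \<rat>" "\<And>n. T < q n" "\<And>n. q n < T + 1 / real (Suc n)" by metis
    have "(\<lambda>n. T + 1 / real (Suc n)) \<longlonglongrightarrow> T + 0" by (intro tendsto_add tendsto_const lim_1_over_n[THEN LIMSEQ_Suc])
    then have l: "(\<lambda>n. T + 1 / real (Suc n)) \<longlonglongrightarrow> T" by simp
    have "q \<longlonglongrightarrow> T"
      by (rule tendsto_sandwich[OF _ _ tendsto_const l]; intro always_eventually allI less_imp_le q)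
    moreover have "q n \<in> \<rat> \<inter> {0<..}" for n using q(1)[of n] q(2)[of n] T by simp
    ultimately show ?thesis by blast
  qed
  have l: "(\<lambda>n. EY (q n)) \<longlonglongrightarrow> Y T \<omega> - D T \<omega>"
    if g: "good \<omega>" and q: "\<forall>n. q n \<in> \<rat> \<inter> {0<..}" "q \<longlonglongrightarrow> T" and T: "T > 0" for \<omega> q T
  proof -
    have "(\<lambda>n. D (q n) \<omega>) \<longlonglongrightarrow> D T \<omega>"
      by (rule continuous_on_tendsto_compose[of "{0<..}" "\<lambda>T. D T \<omega>" q T sequentially]) (use g q T in \<open>auto simp: good_def\<close>)
    moreover have "(\<lambda>n. Y (q n) \<omega>) \<longlonglongrightarrow> Y T \<omega>"
      by (rule continuous_on_tendsto_compose[OF Y_continuous q(2)]) auto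
    ultimately have "(\<lambda>n. Y (q n) \<omega> - D (q n) \<omega>) \<longlonglongrightarrow> Y T \<omega> - D T \<omega>" by (intro tendsto_diff)
    moreover have "Y (q n) \<omega> - D (q n) \<omega> = EY (q n)" for n
      using g q(1)[rule_format, of n] unfolding good_def by simp
    ultimately show ?thesis by (simp only:)
  qed
  show ?thesis
    using good
  proof eventually_elim
    fix \<omega> assume g: "good \<omega>"
    show "\<forall>T>0. D T \<omega> = Y T \<omega> - EY T"
    proof (intro allI impI)
      fix T :: real assume T: "T > 0"
      \<comment> \<open>What holds almost surely holds somewhere: some good sample point satisfies
        the identity at this T. The limit of \<open>EY\<close> along the rationals is common to all
        good points and carries the identity over.\<close>
      have "AE \<omega>' in M. good \<omega>' \<and> D T \<omega>' = Y T \<omega>' - EY T" using good eq[OF T] by eventually_elim simp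
      then obtain \<omega>' where w: "good \<omega>'" "D T \<omega>' = Y T \<omega>' - EY T"
        using eventually_happens'[OF ae_filter_bot] by blast
      obtain q where q: "\<forall>n. q n \<in> \<rat> \<inter> {0<..}" "q \<longlonglongrightarrow> T" using lim[OF T] by blast
      have "Y T \<omega> - D T \<omega> = Y T \<omega>' - D T \<omega>'"
        by (rule LIMSEQ_unique[OF l[OF g q T] l[OF w(1) q T]])
      then show "D T \<omega> = Y T \<omega> - EY T" using w(2) by simp
    qed
  qed
qed

end

theorem theorem4:
  fixes M :: "'a measure"
    and H \<theta> \<rho> :: real
    and B V X S :: "real \<Rightarrow> 'a \<Rightarrow> real"
  assumes "prob_space M"
    and "1 / 2 < H" and "H < 1"
    and "0 < \<theta>" and "0 < \<rho>" and "\<theta> \<noteq> \<rho>"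
    and "fractional_brownian_motion M H B"
    and "completely_generated_by M B"
    and "solves_OU M \<rho> B V"
    and "solves_OU M \<theta> V X"
    and "skorohod_integral_process M H B X S"
  shows "AE \<omega> in M. ((\<lambda>T. theta_hat \<theta> \<rho> X V S T \<omega>) \<longlongrightarrow> \<theta> + \<rho>) at_top"
proof -
  obtain B' where B': "fbm M H B'" and BB: "AE \<omega> in M. \<forall>t. B' t \<omega> = B (max 0 t) \<omega>"
    using prob_space.fbm_continuous_version[OF assms(1-3,7,8)] by blast
  interpret F: fbm_ou M H B' \<theta> \<rho>
    by (intro fbm_ou.intro fbm_ou_axioms.intro B' assms)
  \<comment> \<open>Both equations are solved path by path; the inner solution is the driving path
    of the outer equation.\<close>
  have sol: "AE \<omega> in M. (\<forall>t\<ge>0. V t \<omega> = ou \<rho> (\<lambda>s. B' s \<omega>) t) \<and> (\<forall>t\<ge>0. X t \<omega> = F.X t \<omega>)"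
    using assms(9,10)[unfolded solves_OU_def] BB
  proof eventually_elim
    case (elim \<omega>)
    have p: "path0 (\<lambda>s. B' s \<omega>)" by (rule F.B_path)
    have Bt: "B t \<omega> = B' t \<omega>" if "t \<ge> 0" for t using elim(3) that by (simp add: max_absorb2)
    have B0: "B' 0 \<omega> = 0" using p by (simp add: path0_def)
    have V: "V t \<omega> = ou \<rho> (\<lambda>s. B' s \<omega>) t" if "t \<ge> 0" for t
    proof (rule ou_unique[OF _ _ p _ that])
      show "continuous_on {0..} (\<lambda>t. V t \<omega>)" "V 0 \<omega> = 0" using elim(1) by simp_all
      show "V t \<omega> = - \<rho> * integral {0..t} (\<lambda>t. V t \<omega>) + B' t \<omega>" if "t \<ge> 0" for t
        using elim(1) that Bt[OF that] Bt[of 0] B0 by simp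
    qed
    have "X t \<omega> = ou \<theta> (ou \<rho> (\<lambda>s. B' s \<omega>)) t" if "t \<ge> 0" for t
    proof (rule ou_unique[OF _ _ ou_path0[OF p] _ that])
      show "continuous_on {0..} (\<lambda>t. X t \<omega>)" "X 0 \<omega> = 0" using elim(2) by simp_all
      show "X t \<omega> = - \<theta> * integral {0..t} (\<lambda>t. X t \<omega>) + ou \<rho> (\<lambda>s. B' s \<omega>) t" if "t \<ge> 0" for t
        using elim(1,2) that V[OF that] by simp
    qed
    with V show ?case by (simp add: F.X_def)
  qed
  then have XX: "AE \<omega> in M. \<forall>t\<ge>0. X t \<omega> = F.X t \<omega>" by eventually_elim simp
  have "AE \<omega> in M. S T \<omega> = F.Y T \<omega> - F.EY T" if "T > 0" for T
    using assms(11) that unfolding skorohod_integral_process_def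
    by (intro F.divergence_eq[OF assms(8) BB XX that]) blast
  moreover have "AE \<omega> in M. continuous_on {0<..} (\<lambda>T. S T \<omega>)"
    using assms(11) by (simp add: skorohod_integral_process_def)
  ultimately have "AE \<omega> in M. \<forall>T>0. S T \<omega> = F.Y T \<omega> - F.EY T" by (rule F.continuous_version_eq)
  with sol F.estimator_limit show ?thesis
  proof eventually_elim
    case (elim \<omega>)
    have "theta_hat \<theta> \<rho> X V S T \<omega> = (F.EY T - (F.X T \<omega>)\<^sup>2 / 2) / F.A T \<omega>" if T: "T > 0" for T
    proof -
      let ?v = "ou \<rho> (\<lambda>s. B' s \<omega>)"
      have 1: "integral {0..T} (\<lambda>t. (X t \<omega>)\<^sup>2) = F.A T \<omega>"
        unfolding F.A_def prim_def using elim(1) by (intro integral_cong) simp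
      have "integral {0..T} (\<lambda>t. X t \<omega> * V t \<omega>) = integral {0..T} (\<lambda>t. ou \<theta> ?v t * ?v t)"
        using elim(1) by (intro integral_cong) (simp add: F.X_def)
      also have "\<dots> = F.A T \<omega> + \<theta> * (F.S T \<omega>)\<^sup>2 / 2"
        unfolding ou_product_integral[OF ou_path0[OF F.B_path]] F.A_def F.S_def F.X_def ..
      finally have 2: "integral {0..T} (\<lambda>t. X t \<omega> * V t \<omega>) = F.A T \<omega> + \<theta> * (F.S T \<omega>)\<^sup>2 / 2" .
      have 3: "S T \<omega> = F.Y T \<omega> - F.EY T" using elim(3) T by blast
      \<comment> \<open>The multiples of the integral of X^2 and of the squared integral of X
        cancel, which leaves X^2 / 2 minus \<open>F.EY T\<close>.\<close>
      have "integral_against_X \<theta> \<rho> X V S T \<omega> = - (F.EY T - (F.X T \<omega>)\<^sup>2 / 2)"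
        unfolding integral_against_X_def 1 2 3 F.Y_def by (simp add: algebra_simps)
      then show ?thesis unfolding theta_hat_def 1 by (simp only: minus_divide_left minus_minus)
    qed
    note th = this
    have "\<forall>\<^sub>F T in at_top. (F.EY T - (F.X T \<omega>)\<^sup>2 / 2) / F.A T \<omega> = theta_hat \<theta> \<rho> X V S T \<omega>"
      using eventually_gt_at_top[of "0::real"] by eventually_elim (simp only: th)
    then show ?case by (rule Lim_transform_eventually[OF elim(2)])
  qed
qed

end
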